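(* For any recursively inseparable pair $\langle A,B\rangle$, there is an r.e. theory $U_{\langle A,B\rangle}$ such that $\mathsf{G1}$ holds for $U_{\langle A,B\rangle}$ and $U_{\langle A,B\rangle}\lhd\mathbf R$ (namely the theory $U_{\langle A,B\rangle}$ described below).
   Context: A recursively inseparable pair is a pair $\langle A,B\rangle$ of disjoint r.e. subsets of $\mathbb N$ with no recursive $X\subseteq\mathbb N$ such that $A\subseteq X$ and $X\cap B=\emptyset$. $U_{\langle A,B\rangle}$ is the theory in language $\{\mathbf 0,\mathbf S,\mathbf P\}$ ($\mathbf P$ unary relation, $\overline n=\mathbf S^n\mathbf 0$) with axioms $\overline m\neq\overline n$ ($m\neq n$), $\mathbf P(\overline n)$ ($n\in A$), $\neg\mathbf P(\overline n)$ ($n\in B$). $\mathbf R$ is Robinson's theory in language $\{\mathbf 0,\mathbf S,+,\cdot,\le\}$ ($\le$ primitive) with schemes $\overline m+\overline n=\overline{m+n}$; $\overline m\cdot\overline n=\overline{m\cdot n}$; $\overline m\neq\overline n$ for $m\neq n$; $\forall x(x\le\overline n\to x=\overline 0\vee\dots\vee x=\overline n)$; $\forall x(x\le\overline n\vee\overline n\le x)$. "$\mathsf{G1}$ holds for $T$": for every recursively axiomatizable consistent theory $S$, if $T$ is interpretable in $S$ then $S$ is incomplete. $S\lhd T$: $S$ is interpretable in $T$ but $T$ is not interpretable in $S$ (relative interpretations). *)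

theory Defs
  imports Main "HOL-Library.Nat_Bijection"
begin

datatype recf = Zr | Sc | Id nat | Cn recf "recf list" | Pr recf recf | Mn recf

inductive eval :: "recf \<Rightarrow> nat list \<Rightarrow> nat \<Rightarrow> bool" where
  ev_Zr: "eval Zr xs 0"
| ev_Sc: "eval Sc (x # xs) (Suc x)"
| ev_Id: "i < length xs \<Longrightarrow> eval (Id i) xs (xs ! i)"
| ev_Cn: "list_all2 (\<lambda>g y. eval g xs y) gs ys \<Longrightarrow> eval f ys z \<Longrightarrow> eval (Cn f gs) xs z"
| ev_Pr0: "eval f xs y \<Longrightarrow> eval (Pr f g) (0 # xs) y"
| ev_PrS: "eval (Pr f g) (n # xs) y \<Longrightarrow> eval g (y # n # xs) z \<Longrightarrow> eval (Pr f g) (Suc n # xs) z"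
| ev_Mn: "eval f (n # xs) 0 \<Longrightarrow> (\<forall>m<n. \<exists>v. eval f (m # xs) v \<and> v \<noteq> 0) \<Longrightarrow> eval (Mn f) xs n"

definition recursive_set :: "nat set \<Rightarrow> bool" where
  "recursive_set X \<longleftrightarrow> (\<exists>f. \<forall>n. eval f [n] (if n \<in> X then 1 else 0))"

definition re_set :: "nat set \<Rightarrow> bool" where
  "re_set X \<longleftrightarrow> (\<exists>f. \<forall>n. n \<in> X \<longleftrightarrow> (\<exists>v. eval f [n] v))"

definition rec_inseparable :: "nat set \<Rightarrow> nat set \<Rightarrow> bool" where
  "rec_inseparable A B \<longleftrightarrow> re_set A \<and> re_set B \<and> A \<inter> B = {} \<and>
     \<not> (\<exists>X. recursive_set X \<and> A \<subseteq> X \<and> X \<inter> B = {})"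

text \<open>Symbols are natural numbers; a symbol is identified by its name together with
  its arity (the number of arguments it is applied to).\<close>
datatype trm = Var nat | Fn nat "trm list"

datatype fm = Bot | Eq trm trm | Rel nat "trm list" | Imp fm fm | All nat fm

definition Neg :: "fm \<Rightarrow> fm" where "Neg \<phi> = Imp \<phi> Bot"
definition Top :: fm where "Top = Imp Bot Bot"
definition Or :: "fm \<Rightarrow> fm \<Rightarrow> fm" where "Or \<phi> \<psi> = Imp (Neg \<phi>) \<psi>"
definition And :: "fm \<Rightarrow> fm \<Rightarrow> fm" where "And \<phi> \<psi> = Neg (Imp \<phi> (Neg \<psi>))"
definition Ex :: "nat \<Rightarrow> fm \<Rightarrow> fm" where "Ex x \<phi> = Neg (All x (Neg \<phi>))"

definition exs :: "nat list \<Rightarrow> fm \<Rightarrow> fm" where "exs xs \<phi> = foldr Ex xs \<phi>"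
definition alls :: "nat list \<Rightarrow> fm \<Rightarrow> fm" where "alls xs \<phi> = foldr All xs \<phi>"
definition conjs :: "fm list \<Rightarrow> fm" where "conjs \<phi>s = foldr And \<phi>s Top"
definition disjs :: "fm list \<Rightarrow> fm" where "disjs \<phi>s = foldr Or \<phi>s Bot"

fun tvars :: "trm \<Rightarrow> nat set" where
  "tvars (Var x) = {x}"
| "tvars (Fn f ts) = (\<Union>t\<in>set ts. tvars t)"

fun fv :: "fm \<Rightarrow> nat set" where
  "fv Bot = {}"
| "fv (Eq s t) = tvars s \<union> tvars t"
| "fv (Rel r ts) = (\<Union>t\<in>set ts. tvars t)"
| "fv (Imp \<phi> \<psi>) = fv \<phi> \<union> fv \<psi>"
| "fv (All x \<phi>) = fv \<phi> - {x}"

fun vars :: "fm \<Rightarrow> nat set" where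
  "vars Bot = {}"
| "vars (Eq s t) = tvars s \<union> tvars t"
| "vars (Rel r ts) = (\<Union>t\<in>set ts. tvars t)"
| "vars (Imp \<phi> \<psi>) = vars \<phi> \<union> vars \<psi>"
| "vars (All x \<phi>) = insert x (vars \<phi>)"

definition fresh :: "nat set \<Rightarrow> nat" where
  "fresh X = Suc (Max (insert 0 X))"

fun tsubst :: "(nat \<Rightarrow> trm) \<Rightarrow> trm \<Rightarrow> trm" where
  "tsubst \<sigma> (Var x) = \<sigma> x"
| "tsubst \<sigma> (Fn f ts) = Fn f (map (tsubst \<sigma>) ts)"

fun ssubst :: "(nat \<Rightarrow> trm) \<Rightarrow> fm \<Rightarrow> fm" where
  "ssubst \<sigma> Bot = Bot"
| "ssubst \<sigma> (Eq s t) = Eq (tsubst \<sigma> s) (tsubst \<sigma> t)"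
| "ssubst \<sigma> (Rel r ts) = Rel r (map (tsubst \<sigma>) ts)"
| "ssubst \<sigma> (Imp \<phi> \<psi>) = Imp (ssubst \<sigma> \<phi>) (ssubst \<sigma> \<psi>)"
| "ssubst \<sigma> (All x \<phi>) =
     (let z = fresh (insert x (vars \<phi> \<union> (\<Union>y\<in>fv \<phi>. tvars (\<sigma> y))))
      in All z (ssubst (\<sigma>(x := Var z)) \<phi>))"

definition inst :: "fm \<Rightarrow> nat list \<Rightarrow> fm" where
  "inst \<phi> vs = ssubst (\<lambda>i. if i < length vs then Var (vs ! i) else Var i) \<phi>"

record lang =
  fsyms :: "(nat \<times> nat) set"   \<comment> \<open>(name, arity) of function/constant symbols\<close>
  rsyms :: "(nat \<times> nat) set"   \<comment> \<open>(name, arity) of relation symbols\<close>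

fun trm_in :: "lang \<Rightarrow> trm \<Rightarrow> bool" where
  "trm_in L (Var x) = True"
| "trm_in L (Fn f ts) = ((f, length ts) \<in> fsyms L \<and> (\<forall>t\<in>set ts. trm_in L t))"

fun fm_in :: "lang \<Rightarrow> fm \<Rightarrow> bool" where
  "fm_in L Bot = True"
| "fm_in L (Eq s t) = (trm_in L s \<and> trm_in L t)"
| "fm_in L (Rel r ts) = ((r, length ts) \<in> rsyms L \<and> (\<forall>t\<in>set ts. trm_in L t))"
| "fm_in L (Imp \<phi> \<psi>) = (fm_in L \<phi> \<and> fm_in L \<psi>)"
| "fm_in L (All x \<phi>) = fm_in L \<phi>"

definition sentences :: "lang \<Rightarrow> fm set" where
  "sentences L = {\<phi>. fm_in L \<phi> \<and> fv \<phi> = {}}"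

inductive prv :: "fm set \<Rightarrow> fm \<Rightarrow> bool" where
  prv_ax: "\<phi> \<in> T \<Longrightarrow> prv T \<phi>"
| prv_K: "prv T (Imp \<phi> (Imp \<psi> \<phi>))"
| prv_S: "prv T (Imp (Imp \<phi> (Imp \<psi> \<chi>)) (Imp (Imp \<phi> \<psi>) (Imp \<phi> \<chi>)))"
| prv_DN: "prv T (Imp (Neg (Neg \<phi>)) \<phi>)"
| prv_inst: "prv T (Imp (All x \<phi>) (ssubst (Var(x := t)) \<phi>))"
| prv_vac: "x \<notin> fv \<phi> \<Longrightarrow> prv T (Imp \<phi> (All x \<phi>))"
| prv_dist: "prv T (Imp (All x (Imp \<phi> \<psi>)) (Imp (All x \<phi>) (All x \<psi>)))"
| prv_refl: "prv T (Eq t t)"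
| prv_leib: "prv T (Imp (Eq s t) (Imp (ssubst (Var(x := s)) \<phi>) (ssubst (Var(x := t)) \<phi>)))"
| prv_MP: "prv T (Imp \<phi> \<psi>) \<Longrightarrow> prv T \<phi> \<Longrightarrow> prv T \<psi>"
| prv_Gen: "prv T \<phi> \<Longrightarrow> prv T (All x \<phi>)"

type_synonym thy = "lang \<times> fm set"

definition wf_thy :: "thy \<Rightarrow> bool" where
  "wf_thy T \<longleftrightarrow> snd T \<subseteq> sentences (fst T)"

definition consistent :: "thy \<Rightarrow> bool" where
  "consistent T \<longleftrightarrow> \<not> prv (snd T) Bot"

definition complete :: "thy \<Rightarrow> bool" where
  "complete T \<longleftrightarrow> (\<forall>\<phi>\<in>sentences (fst T). prv (snd T) \<phi> \<or> prv (snd T) (Neg \<phi>))"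

fun enc_list :: "nat list \<Rightarrow> nat" where
  "enc_list [] = 0"
| "enc_list (x # xs) = Suc (prod_encode (x, enc_list xs))"

fun enc_trm :: "trm \<Rightarrow> nat" where
  "enc_trm (Var x) = prod_encode (0, x)"
| "enc_trm (Fn f ts) = prod_encode (1, prod_encode (f, enc_list (map enc_trm ts)))"

fun enc_fm :: "fm \<Rightarrow> nat" where
  "enc_fm Bot = prod_encode (0, 0)"
| "enc_fm (Eq s t) = prod_encode (1, prod_encode (enc_trm s, enc_trm t))"
| "enc_fm (Rel r ts) = prod_encode (2, prod_encode (r, enc_list (map enc_trm ts)))"
| "enc_fm (Imp \<phi> \<psi>) = prod_encode (3, prod_encode (enc_fm \<phi>, enc_fm \<psi>))"
| "enc_fm (All x \<phi>) = prod_encode (4, prod_encode (x, enc_fm \<phi>))"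

definition re_thy :: "thy \<Rightarrow> bool" where
  "re_thy T \<longleftrightarrow> re_set (enc_fm ` snd T)"

definition rec_axiomatizable :: "thy \<Rightarrow> bool" where
  "rec_axiomatizable T \<longleftrightarrow> (\<exists>Ax. Ax \<subseteq> sentences (fst T) \<and> recursive_set (enc_fm ` Ax) \<and>
      (\<forall>\<phi>. prv Ax \<phi> \<longleftrightarrow> prv (snd T) \<phi>))"

text \<open>An interpretation: a domain formula (free variable 0), for each relation symbol (r,n)
  a formula with free variables among 0..n-1, and for each function symbol (f,n) a formula
  with free variables among 0..n (the graph, output variable n). Equality is translated
  as equality.\<close>
type_synonym interp = "fm \<times> (nat \<times> nat \<Rightarrow> fm) \<times> (nat \<times> nat \<Rightarrow> fm)"

definition idom :: "interp \<Rightarrow> fm" where "idom I = fst I"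
definition irel :: "interp \<Rightarrow> nat \<times> nat \<Rightarrow> fm" where "irel I = fst (snd I)"
definition ifun :: "interp \<Rightarrow> nat \<times> nat \<Rightarrow> fm" where "ifun I = snd (snd I)"

text \<open>tr_trm I t y: "the value of t is y"; tr_args I ts b: the values of ts are
  b, b+1, ... (and lie in the domain)\<close>
fun tr_trm :: "interp \<Rightarrow> trm \<Rightarrow> nat \<Rightarrow> fm"
and tr_args :: "interp \<Rightarrow> trm list \<Rightarrow> nat \<Rightarrow> fm" where
  "tr_trm I (Var x) y = Eq (Var y) (Var x)"
| "tr_trm I (Fn f ts) y =
    (let n = length ts; b = fresh (insert y (\<Union>t\<in>set ts. tvars t))
     in exs [b..<b+n] (And (tr_args I ts b) (inst (ifun I (f, n)) ([b..<b+n] @ [y]))))"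
| "tr_args I [] b = Top"
| "tr_args I (t # ts) b = And (And (inst (idom I) [b]) (tr_trm I t b)) (tr_args I ts (Suc b))"

fun tr :: "interp \<Rightarrow> fm \<Rightarrow> fm" where
  "tr I Bot = Bot"
| "tr I (Eq s t) = (let b = fresh (tvars s \<union> tvars t)
     in exs [b, Suc b] (And (tr_args I [s, t] b) (Eq (Var b) (Var (Suc b)))))"
| "tr I (Rel r ts) = (let n = length ts; b = fresh (\<Union>t\<in>set ts. tvars t)
     in exs [b..<b+n] (And (tr_args I ts b) (inst (irel I (r, n)) [b..<b+n])))"
| "tr I (Imp \<phi> \<psi>) = Imp (tr I \<phi>) (tr I \<psi>)"
| "tr I (All x \<phi>) = All x (Imp (inst (idom I) [x]) (tr I \<phi>))"

definition fun_ok :: "interp \<Rightarrow> nat \<times> nat \<Rightarrow> fm" where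
  "fun_ok I fn = (let n = snd fn; F = ifun I fn in
     alls [0..<n] (Imp (conjs (map (\<lambda>i. inst (idom I) [i]) [0..<n]))
       (Ex n (And (inst (idom I) [n]) (And (inst F [0..<Suc n])
          (All (Suc n) (Imp (And (inst (idom I) [Suc n]) (inst F ([0..<n] @ [Suc n])))
                             (Eq (Var (Suc n)) (Var n)))))))))"

definition is_interpretation :: "interp \<Rightarrow> thy \<Rightarrow> thy \<Rightarrow> bool" where
  "is_interpretation I T S \<longleftrightarrow>
     fm_in (fst S) (idom I) \<and> fv (idom I) \<subseteq> {0} \<and>
     (\<forall>(r, n)\<in>rsyms (fst T). fm_in (fst S) (irel I (r, n)) \<and> fv (irel I (r, n)) \<subseteq> {..<n}) \<and>
     (\<forall>(f, n)\<in>fsyms (fst T). fm_in (fst S) (ifun I (f, n)) \<and> fv (ifun I (f, n)) \<subseteq> {..n}) \<and>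
     prv (snd S) (Ex 0 (idom I)) \<and>
     (\<forall>fn\<in>fsyms (fst T). prv (snd S) (fun_ok I fn)) \<and>
     (\<forall>\<phi>\<in>snd T. prv (snd S) (tr I \<phi>))"

definition interpretable :: "thy \<Rightarrow> thy \<Rightarrow> bool" where
  "interpretable T S \<longleftrightarrow> (\<exists>I. is_interpretation I T S)"

definition strictly_below :: "thy \<Rightarrow> thy \<Rightarrow> bool" where
  "strictly_below S T \<longleftrightarrow> interpretable S T \<and> \<not> interpretable T S"

definition G1_holds :: "thy \<Rightarrow> bool" where
  "G1_holds T \<longleftrightarrow> (\<forall>S. wf_thy S \<and> rec_axiomatizable S \<and> consistent S \<and> interpretable T S
                      \<longrightarrow> \<not> complete S)"

text \<open>symbols: function 0 = constant 0, function 1 = unary S (successor),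
  function 2 = binary +, function 3 = binary \<cdot>; relation 0 unary P, relation 1 binary \<le>\<close>
fun num :: "nat \<Rightarrow> trm" where
  "num 0 = Fn 0 []"
| "num (Suc n) = Fn 1 [num n]"

definition L_U :: lang where
  "L_U = \<lparr>fsyms = {(0, 0), (1, 1)}, rsyms = {(0, 1)}\<rparr>"

definition U_thy :: "nat set \<Rightarrow> nat set \<Rightarrow> thy" where
  "U_thy A B = (L_U,
     {Neg (Eq (num m) (num n)) | m n. m \<noteq> n} \<union>
     {Rel 0 [num n] | n. n \<in> A} \<union>
     {Neg (Rel 0 [num n]) | n. n \<in> B})"

definition L_R :: lang where
  "L_R = \<lparr>fsyms = {(0, 0), (1, 1), (2, 2), (3, 2)}, rsyms = {(1, 2)}\<rparr>"

definition plus :: "trm \<Rightarrow> trm \<Rightarrow> trm" where "plus s t = Fn 2 [s, t]"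
definition times :: "trm \<Rightarrow> trm \<Rightarrow> trm" where "times s t = Fn 3 [s, t]"
definition leq :: "trm \<Rightarrow> trm \<Rightarrow> fm" where "leq s t = Rel 1 [s, t]"

definition R_thy :: thy where
  "R_thy = (L_R,
     {Eq (plus (num m) (num n)) (num (m + n)) | m n. True} \<union>
     {Eq (times (num m) (num n)) (num (m * n)) | m n. True} \<union>
     {Neg (Eq (num m) (num n)) | m n. m \<noteq> n} \<union>
     {All 0 (Imp (leq (Var 0) (num n)) (disjs (map (\<lambda>i. Eq (Var 0) (num i)) [0..<Suc n]))) | n. True} \<union>
     {All 0 (Or (leq (Var 0) (num n)) (leq (num n) (Var 0))) | n. True})"

end

theory Submission
  imports Defs "HOL-Library.Countable" "HOL-Number_Theory.Cong"
begin

text \<open>If a complete consistent recursively axiomatizable \<open>S\<close> interpreted \<open>U\<close>, then the set of \<open>n\<close>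
  for which \<open>S\<close> proves the translation of \<open>P(n)\<close> would be recursive and would separate \<open>A\<close> from \<open>B\<close>.
  \<open>R\<close> interprets \<open>U\<close> because a Rosser-style comparison of witnesses gives a formula that \<open>R\<close>
  proves at each numeral in \<open>A\<close> and refutes at each numeral in \<open>B\<close>. Conversely, \<open>U\<close> has a model, a
  disjoint union of coloured lines, in which truth depends only on bounded neighbourhoods. By the
  pigeonhole principle no formula orders an infinite set of its elements, whereas the order of \<open>R\<close>
  does so on the numerals.

  Statements about provability are reduced to statements about models by the completeness theorem,
  and recursive enumerability is established through definability by existentially quantified bounded
  formulas, which are closed under inductive definitions.\<close>

section \<open>Structures and satisfaction\<close>

lemma fresh_notin: "finite X \<Longrightarrow> fresh X \<notin> X"
  unfolding fresh_def by (metis Max_ge Suc_n_not_le_n finite_insert insertI2)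

lemma less_fresh: "finite X \<Longrightarrow> x \<in> X \<Longrightarrow> x < fresh X"
  by (simp add: fresh_def less_Suc_eq_le)

lemma finite_tvars [simp]: "finite (tvars t)"
  by (induction t) auto

lemma finite_vars [simp]: "finite (vars \<phi>)"
  by (induction \<phi>) auto

lemma fv_subset_vars: "fv \<phi> \<subseteq> vars \<phi>"
  by (induction \<phi>) auto

lemma finite_fv [simp]: "finite (fv \<phi>)"
  using finite_subset[OF fv_subset_vars] by simp

lemma fv_connectives [simp]:
  "fv (Neg \<phi>) = fv \<phi>" "fv Top = {}" "fv (And \<phi> \<psi>) = fv \<phi> \<union> fv \<psi>"
  "fv (Or \<phi> \<psi>) = fv \<phi> \<union> fv \<psi>" "fv (Ex x \<phi>) = fv \<phi> - {x}"
  by (auto simp: Neg_def Top_def And_def Or_def Ex_def)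

lemma fm_in_connectives [simp]:
  "fm_in L (Neg \<phi>) = fm_in L \<phi>" "fm_in L Top" "fm_in L (And \<phi> \<psi>) = (fm_in L \<phi> \<and> fm_in L \<psi>)"
  "fm_in L (Or \<phi> \<psi>) = (fm_in L \<phi> \<and> fm_in L \<psi>)" "fm_in L (Ex x \<phi>) = fm_in L \<phi>"
  by (auto simp: Neg_def Top_def And_def Or_def Ex_def)

lemma tsubst_cong: "(\<And>x. x \<in> tvars t \<Longrightarrow> \<sigma> x = \<tau> x) \<Longrightarrow> tsubst \<sigma> t = tsubst \<tau> t"
  by (induction t) auto

lemma tsubst_eq_iff: "tsubst \<sigma> t = tsubst \<tau> t \<longleftrightarrow> (\<forall>x\<in>tvars t. \<sigma> x = \<tau> x)"
  by (induction t) auto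

lemma tsubst_tsubst: "tsubst \<sigma> (tsubst \<tau> t) = tsubst (\<lambda>x. tsubst \<sigma> (\<tau> x)) t"
  by (induction t) auto

lemma tsubst_Var [simp]: "tsubst Var t = t"
  by (induction t) (auto simp: map_idI)

lemma tsubst_upd_notin: "x \<notin> tvars u \<Longrightarrow> tsubst (Var(x := s)) u = u"
  using tsubst_eq_iff[of "Var(x := s)" u Var] by auto

lemma map_tsubst_upd_notin: "x \<notin> (\<Union>u\<in>set us. tvars u) \<Longrightarrow> map (tsubst (Var(x := s))) us = us"
  by (auto intro!: map_idI tsubst_upd_notin)

definition subst_var :: "(nat \<Rightarrow> trm) \<Rightarrow> nat \<Rightarrow> fm \<Rightarrow> nat" where
  "subst_var \<sigma> x \<phi> = fresh (insert x (vars \<phi> \<union> (\<Union>y\<in>fv \<phi>. tvars (\<sigma> y))))"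

lemma ssubst_All:
  "ssubst \<sigma> (All x \<phi>) = All (subst_var \<sigma> x \<phi>) (ssubst (\<sigma>(x := Var (subst_var \<sigma> x \<phi>))) \<phi>)"
  by (simp add: subst_var_def Let_def)

lemma subst_var_notin:
  assumes "y \<in> fv \<phi>"
  shows "subst_var \<sigma> x \<phi> \<notin> tvars (\<sigma> y)"
proof -
  have "subst_var \<sigma> x \<phi> \<notin> insert x (vars \<phi> \<union> (\<Union>y\<in>fv \<phi>. tvars (\<sigma> y)))"
    unfolding subst_var_def by (rule fresh_notin) simp
  with assms show ?thesis by auto
qed

lemma size_ssubst [simp]: "size (ssubst \<sigma> \<phi>) = size \<phi>"
  by (induction \<phi> arbitrary: \<sigma>) (simp_all add: Let_def)

record 'a struct =
  univ :: "'a set"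
  fint :: "nat \<Rightarrow> 'a list \<Rightarrow> 'a"
  rint :: "nat \<Rightarrow> 'a list \<Rightarrow> bool"

fun val :: "'a struct \<Rightarrow> (nat \<Rightarrow> 'a) \<Rightarrow> trm \<Rightarrow> 'a" where
  "val M e (Var x) = e x"
| "val M e (Fn f ts) = fint M f (map (val M e) ts)"

fun sat :: "'a struct \<Rightarrow> (nat \<Rightarrow> 'a) \<Rightarrow> fm \<Rightarrow> bool" where
  "sat M e Bot = False"
| "sat M e (Eq s t) = (val M e s = val M e t)"
| "sat M e (Rel r ts) = rint M r (map (val M e) ts)"
| "sat M e (Imp \<phi> \<psi>) = (sat M e \<phi> \<longrightarrow> sat M e \<psi>)"
| "sat M e (All x \<phi>) = (\<forall>d\<in>univ M. sat M (e(x := d)) \<phi>)"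

lemma sat_connectives [simp]:
  "sat M e (Neg \<phi>) = (\<not> sat M e \<phi>)"
  "sat M e Top"
  "sat M e (And \<phi> \<psi>) = (sat M e \<phi> \<and> sat M e \<psi>)"
  "sat M e (Or \<phi> \<psi>) = (sat M e \<phi> \<or> sat M e \<psi>)"
  "sat M e (Ex x \<phi>) = (\<exists>d\<in>univ M. sat M (e(x := d)) \<phi>)"
  by (auto simp: Neg_def Top_def And_def Or_def Ex_def)

lemma sat_conjs: "sat M e (conjs \<phi>s) \<longleftrightarrow> (\<forall>\<phi>\<in>set \<phi>s. sat M e \<phi>)"
  by (induction \<phi>s) (auto simp: conjs_def)

lemma sat_disjs: "sat M e (disjs \<phi>s) \<longleftrightarrow> (\<exists>\<phi>\<in>set \<phi>s. sat M e \<phi>)"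
  by (induction \<phi>s) (auto simp: disjs_def)

lemma val_cong: "(\<And>x. x \<in> tvars t \<Longrightarrow> e x = e' x) \<Longrightarrow> val M e t = val M e' t"
proof (induction t)
  case (Fn f ts)
  then have "map (val M e) ts = map (val M e') ts" by (intro map_cong) auto
  then show ?case by (simp only: val.simps)
qed simp

lemma sat_cong: "(\<And>x. x \<in> fv \<phi> \<Longrightarrow> e x = e' x) \<Longrightarrow> sat M e \<phi> = sat M e' \<phi>"
proof (induction \<phi> arbitrary: e e')
  case (Eq s t)
  then show ?case using val_cong[of s e e'] val_cong[of t e e'] by auto
next
  case (Rel r ts)
  then have "map (val M e) ts = map (val M e') ts" by (auto intro!: val_cong)
  then show ?case by (simp only: sat.simps)
next
  case (Imp \<phi> \<psi>)
  show ?case using Imp.IH[of e e'] Imp.prems by auto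
next
  case (All x \<phi>)
  have "sat M (e(x := d)) \<phi> = sat M (e'(x := d)) \<phi>" for d
    using All.prems by (intro All.IH) auto
  then show ?case by simp
qed simp

lemma sat_closed_cong: "fv \<phi> = {} \<Longrightarrow> sat M e \<phi> = sat M e' \<phi>"
  by (rule sat_cong) simp

lemma val_upd_notin: "z \<notin> tvars t \<Longrightarrow> val M (e(z := d)) t = val M e t"
  by (rule val_cong) auto

lemma val_tsubst: "val M e (tsubst \<sigma> t) = val M (\<lambda>x. val M e (\<sigma> x)) t"
  by (induction t) (auto intro!: arg_cong[where f = "fint M _"])

lemma sat_ssubst: "sat M e (ssubst \<sigma> \<phi>) = sat M (\<lambda>x. val M e (\<sigma> x)) \<phi>"
proof (induction \<phi> arbitrary: e \<sigma>)
  case (All x \<phi>)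
  let ?z = "subst_var \<sigma> x \<phi>"
  have "sat M (\<lambda>y. val M (e(?z := d)) ((\<sigma>(x := Var ?z)) y)) \<phi>
      = sat M ((\<lambda>y. val M e (\<sigma> y))(x := d)) \<phi>" for d
    by (rule sat_cong) (auto intro!: val_upd_notin simp: subst_var_notin)
  then show ?case by (simp add: ssubst_All All.IH del: ssubst.simps(5) fun_upd_apply)
qed (simp_all add: val_tsubst comp_def)

lemma sat_ssubst_upd: "sat M e (ssubst (Var(x := t)) \<phi>) = sat M (e(x := val M e t)) \<phi>"
proof -
  have "(\<lambda>y. val M e ((Var(x := t)) y)) = e(x := val M e t)" by auto
  then show ?thesis by (simp add: sat_ssubst)
qed

definition model :: "'a struct \<Rightarrow> fm set \<Rightarrow> bool" where
  "model M T \<longleftrightarrow> univ M \<noteq> {} \<and> (\<forall>f xs. set xs \<subseteq> univ M \<longrightarrow> fint M f xs \<in> univ M) \<and>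
     (\<forall>\<tau>\<in>T. \<forall>e. range e \<subseteq> univ M \<longrightarrow> sat M e \<tau>)"

lemma model_fint_in_univ: "model M T \<Longrightarrow> set xs \<subseteq> univ M \<Longrightarrow> fint M f xs \<in> univ M"
  by (simp add: model_def)

lemma model_val_in_univ: "model M T \<Longrightarrow> range e \<subseteq> univ M \<Longrightarrow> val M e t \<in> univ M"
  by (induction t) (auto intro!: model_fint_in_univ)

lemma model_univ_nonempty:
  assumes "model M T"
  obtains d where "d \<in> univ M"
  using assms by (auto simp: model_def)

lemma model_sat_closed:
  assumes "model M T" "\<phi> \<in> T" "fv \<phi> = {}"
  shows "sat M e \<phi>"
proof -
  obtain d where "d \<in> univ M" by (rule model_univ_nonempty[OF assms(1)])
  then have "sat M (\<lambda>_. d) \<phi>" using assms(1,2) by (auto simp: model_def)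
  then show ?thesis using sat_closed_cong[OF assms(3)] by blast
qed

theorem soundness:
  assumes "prv T \<phi>" "model M T" "range e \<subseteq> univ M"
  shows "sat M e \<phi>"
  using assms
proof (induction arbitrary: e rule: prv.induct)
  case (prv_inst T x \<phi> t)
  then show ?case by (simp add: sat_ssubst_upd model_val_in_univ)
next
  case (prv_vac x \<phi> T)
  have "sat M (e(x := d)) \<phi> = sat M e \<phi>" for d
    by (rule sat_cong) (use prv_vac in auto)
  then show ?case by simp
next
  case (prv_Gen T \<phi> x)
  then show ?case by (auto intro!: prv_Gen.IH)
qed (auto simp: model_def sat_ssubst_upd)

section \<open>Derivability from hypotheses and renaming of bound variables\<close>

lemma prv_Imp_refl: "prv T (Imp \<phi> \<phi>)"
  by (meson prv_K prv_S prv_MP)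

lemma prv_Imp_trans: "prv T (Imp \<phi> \<psi>) \<Longrightarrow> prv T (Imp \<psi> \<chi>) \<Longrightarrow> prv T (Imp \<phi> \<chi>)"
  by (meson prv_K prv_S prv_MP)

text \<open>Generalization is not available over the hypotheses \<open>\<Gamma>\<close>, so that these may contain free
  variables, which will serve as Henkin witnesses.\<close>

inductive derives :: "fm set \<Rightarrow> fm set \<Rightarrow> fm \<Rightarrow> bool" for T \<Gamma> where
  derives_hyp: "\<phi> \<in> \<Gamma> \<Longrightarrow> derives T \<Gamma> \<phi>"
| derives_thm: "prv T \<phi> \<Longrightarrow> derives T \<Gamma> \<phi>"
| derives_MP: "derives T \<Gamma> (Imp \<phi> \<psi>) \<Longrightarrow> derives T \<Gamma> \<phi> \<Longrightarrow> derives T \<Gamma> \<psi>"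

lemma derives_empty: "derives T {} \<phi> \<Longrightarrow> prv T \<phi>"
  by (induction rule: derives.induct) (auto intro: prv_MP)

lemma derives_mono: "derives T \<Gamma> \<phi> \<Longrightarrow> \<Gamma> \<subseteq> \<Delta> \<Longrightarrow> derives T \<Delta> \<phi>"
  by (induction rule: derives.induct) (auto intro: derives.intros)

theorem deduction_theorem: "derives T (insert \<alpha> \<Gamma>) \<phi> \<Longrightarrow> derives T \<Gamma> (Imp \<alpha> \<phi>)"
proof (induction rule: derives.induct)
  case (derives_hyp \<phi>)
  then show ?case
    by (metis insertE derives.derives_hyp derives_MP derives_thm prv_K prv_Imp_refl)
next
  case (derives_thm \<phi>)
  then show ?case by (meson derives.derives_thm prv_K prv_MP)
next
  case (derives_MP \<phi> \<psi>)
  then show ?case by (meson derives.derives_thm derives.derives_MP prv_S)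
qed

lemma derives_contradiction: "derives T (insert (Neg \<phi>) \<Gamma>) Bot \<Longrightarrow> derives T \<Gamma> \<phi>"
  by (metis Neg_def derives_MP deduction_theorem derives_thm prv_DN)

lemma derives_Bot_elim: "derives T \<Gamma> Bot \<Longrightarrow> derives T \<Gamma> \<phi>"
  by (meson derives_contradiction derives_mono subset_insertI)

lemma derives_Gen:
  "derives T \<Gamma> \<phi> \<Longrightarrow> (\<And>\<gamma>. \<gamma> \<in> \<Gamma> \<Longrightarrow> z \<notin> fv \<gamma>) \<Longrightarrow> derives T \<Gamma> (All z \<phi>)"
proof (induction rule: derives.induct)
  case (derives_hyp \<phi>)
  then show ?case by (meson derives.derives_hyp derives_MP derives_thm prv_vac)
next
  case (derives_thm \<phi>)
  then show ?case by (meson derives.derives_thm prv_Gen)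
next
  case (derives_MP \<phi> \<psi>)
  then show ?case by (meson derives.derives_MP derives.derives_thm prv_dist)
qed

text \<open>In the normal form, a free variable \<open>x\<close> becomes \<open>2 x\<close> and a variable bound at depth \<open>d\<close>
  becomes \<open>2 d + 1\<close> (the binders keep the dummy name 0), so that two formulas are
  alpha-equivalent iff their normal forms under \<open>even_var\<close> coincide.\<close>

fun nf :: "nat \<Rightarrow> (nat \<Rightarrow> trm) \<Rightarrow> fm \<Rightarrow> fm" where
  "nf d \<sigma> Bot = Bot"
| "nf d \<sigma> (Eq s t) = Eq (tsubst \<sigma> s) (tsubst \<sigma> t)"
| "nf d \<sigma> (Rel r ts) = Rel r (map (tsubst \<sigma>) ts)"
| "nf d \<sigma> (Imp \<phi> \<psi>) = Imp (nf d \<sigma> \<phi>) (nf d \<sigma> \<psi>)"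
| "nf d \<sigma> (All x \<phi>) = All 0 (nf (Suc d) (\<sigma>(x := Var (2 * d + 1))) \<phi>)"

definition even_var :: "nat \<Rightarrow> trm" where
  "even_var x = Var (2 * x)"

lemma even_var_neq_odd: "even_var x \<noteq> Var (Suc 0)"
proof
  assume "even_var x = Var (Suc 0)"
  then have "2 * x = Suc 0" by (simp add: even_var_def)
  then show False by presburger
qed

lemma tsubst_even_var_inject: "tsubst even_var s = tsubst even_var t \<longleftrightarrow> s = t"
proof
  assume "tsubst even_var s = tsubst even_var t"
  then have "tsubst (\<lambda>k. Var (k div 2)) (tsubst even_var s) =
      tsubst (\<lambda>k. Var (k div 2)) (tsubst even_var t)" by simp
  then show "s = t" by (simp add: tsubst_tsubst even_var_def)
qed simp

lemma map_tsubst_even_var_inject: "map (tsubst even_var) ss = map (tsubst even_var) ts \<longleftrightarrow> ss = ts"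
  by (rule inj_map_eq_map) (simp add: inj_def tsubst_even_var_inject)

lemma size_nf [simp]: "size (nf d \<sigma> \<phi>) = size \<phi>"
  by (induction \<phi> arbitrary: d \<sigma>) simp_all

lemma nf_eq_iff: "nf d \<sigma> \<phi> = nf d \<tau> \<phi> \<longleftrightarrow> (\<forall>x\<in>fv \<phi>. \<sigma> x = \<tau> x)"
proof (induction \<phi> arbitrary: d \<sigma> \<tau>)
  case (All x \<phi>)
  then show ?case by auto
qed (auto simp: tsubst_eq_iff)

lemma nf_upd_eq_iff_notin_fv: "nf d even_var \<phi> = nf d (even_var(x := Var 1)) \<phi> \<longleftrightarrow> x \<notin> fv \<phi>"
  unfolding nf_eq_iff using even_var_neq_odd by auto

lemma nf_ssubst: "nf d \<sigma> (ssubst \<tau> \<phi>) = nf d (\<lambda>x. tsubst \<sigma> (\<tau> x)) \<phi>"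
proof (induction \<phi> arbitrary: d \<sigma> \<tau>)
  case (All x \<phi>)
  let ?z = "subst_var \<tau> x \<phi>"
  have "nf d' (\<lambda>y. tsubst (\<sigma>(?z := u)) ((\<tau>(x := Var ?z)) y)) \<phi>
      = nf d' ((\<lambda>y. tsubst \<sigma> (\<tau> y))(x := u)) \<phi>" for d' u
    unfolding nf_eq_iff by (auto intro!: tsubst_cong) (metis subst_var_notin)
  then show ?case by (simp add: ssubst_All All.IH del: ssubst.simps(5) fun_upd_apply)
qed (simp_all add: tsubst_tsubst comp_def)

lemma nf_ssubst_upd:
  "nf 0 even_var (ssubst (Var(x := t)) \<phi>) = nf 0 (even_var(x := tsubst even_var t)) \<phi>"
proof -
  have "(\<lambda>y. tsubst even_var ((Var(x := t)) y)) = even_var(x := tsubst even_var t)" by auto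
  then show ?thesis by (simp add: nf_ssubst)
qed

fun subst_terms :: "(nat \<Rightarrow> trm) \<Rightarrow> fm \<Rightarrow> fm" where
  "subst_terms \<rho> Bot = Bot"
| "subst_terms \<rho> (Eq s t) = Eq (tsubst \<rho> s) (tsubst \<rho> t)"
| "subst_terms \<rho> (Rel r ts) = Rel r (map (tsubst \<rho>) ts)"
| "subst_terms \<rho> (Imp \<phi> \<psi>) = Imp (subst_terms \<rho> \<phi>) (subst_terms \<rho> \<psi>)"
| "subst_terms \<rho> (All x \<phi>) = All x (subst_terms \<rho> \<phi>)"

lemma subst_terms_nf:
  "(\<And>k. \<rho> (2 * (k + m) + 1) = Var (2 * k + 1)) \<Longrightarrow>
    subst_terms \<rho> (nf (d + m) \<sigma> \<phi>) = nf d (\<lambda>x. tsubst \<rho> (\<sigma> x)) \<phi>"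
proof (induction \<phi> arbitrary: d \<sigma>)
  case (All x \<phi>)
  have "subst_terms \<rho> (nf (d + m) \<sigma> (All x \<phi>))
      = All 0 (nf (Suc d) (\<lambda>y. tsubst \<rho> ((\<sigma>(x := Var (2 * (d + m) + 1))) y)) \<phi>)"
    using All.IH[of "Suc d"] All.prems by (simp del: fun_upd_apply)
  also have "(\<lambda>y. tsubst \<rho> ((\<sigma>(x := Var (2 * (d + m) + 1))) y))
      = (\<lambda>y. tsubst \<rho> (\<sigma> y))(x := Var (2 * d + 1))"
    using All.prems by (auto simp: fun_eq_iff)
  finally show ?case by (simp only: nf.simps)
qed (simp_all add: tsubst_tsubst comp_def)

lemma nf_mark_var:
  "nf 0 (even_var(x := Var 1)) \<phi> = subst_terms (Var(2 * x := Var 1)) (nf 0 even_var \<phi>)"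
proof -
  have "(Var(2 * x := Var 1)) (2 * k + 1) = Var (2 * k + 1)" for k
    by (simp, presburger)
  moreover have "(\<lambda>y. tsubst (Var(2 * x := Var 1)) (even_var y)) = even_var(x := Var 1)"
    by (auto simp: even_var_def)
  ultimately show ?thesis
    using subst_terms_nf[of "Var(2 * x := Var 1)" 0 0 even_var \<phi>] by simp
qed

lemma nf_eq_imp_fv_eq:
  assumes "nf 0 even_var \<phi> = nf 0 even_var \<psi>"
  shows "fv \<phi> = fv \<psi>"
proof -
  have "x \<notin> fv \<phi> \<longleftrightarrow> x \<notin> fv \<psi>" for x
    unfolding nf_upd_eq_iff_notin_fv[symmetric, of _ _ 0] nf_mark_var assms ..
  then show ?thesis by blast
qed

lemma nf_open_eq:
  assumes "nf 1 (even_var(x := Var 1)) \<phi> = nf 1 (even_var(y := Var 1)) \<psi>"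
  shows "nf 0 even_var (ssubst (Var(x := Var y)) \<phi>) = nf 0 even_var \<psi>"
proof -
  define \<rho> :: "nat \<Rightarrow> trm" where
    "\<rho> k = (if k = 1 then Var (2 * y) else if even k then Var k else Var (k - 2))" for k
  have drop_depth: "subst_terms \<rho> (nf 1 \<sigma> \<chi>) = nf 0 (\<lambda>z. tsubst \<rho> (\<sigma> z)) \<chi>" for \<sigma> \<chi>
    using subst_terms_nf[of \<rho> 1 0] by (simp add: \<rho>_def)
  have "nf 0 even_var (ssubst (Var(x := Var y)) \<phi>) = nf 0 (even_var(x := Var (2 * y))) \<phi>"
    by (simp add: nf_ssubst_upd even_var_def)
  also have "even_var(x := Var (2 * y)) = (\<lambda>z. tsubst \<rho> ((even_var(x := Var 1)) z))"
    by (auto simp: even_var_def \<rho>_def)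
  also have "nf 0 \<dots> \<phi> = nf 0 (\<lambda>z. tsubst \<rho> ((even_var(y := Var 1)) z)) \<psi>"
    unfolding drop_depth[symmetric] assms ..
  also have "(\<lambda>z. tsubst \<rho> ((even_var(y := Var 1)) z)) = even_var"
    by (auto simp: even_var_def \<rho>_def)
  finally show ?thesis .
qed

theorem prv_Imp_alpha: "nf 0 even_var \<phi> = nf 0 even_var \<psi> \<Longrightarrow> prv T (Imp \<phi> \<psi>)"
proof (induction "size \<phi>" arbitrary: \<phi> \<psi> rule: less_induct)
  case less
  show ?case
  proof (cases \<phi>)
    case Bot
    with less.prems show ?thesis by (cases \<psi>) (auto intro: prv_Imp_refl)
  next
    case (Eq s t)
    with less.prems show ?thesis
      by (cases \<psi>) (auto intro: prv_Imp_refl simp: tsubst_even_var_inject)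
  next
    case (Rel r ts)
    with less.prems show ?thesis
      by (cases \<psi>) (auto intro: prv_Imp_refl simp: map_tsubst_even_var_inject)
  next
    case (Imp \<phi>\<^sub>1 \<phi>\<^sub>2)
    with less.prems obtain \<psi>\<^sub>1 \<psi>\<^sub>2 where \<psi>: "\<psi> = Imp \<psi>\<^sub>1 \<psi>\<^sub>2"
      "nf 0 even_var \<phi>\<^sub>1 = nf 0 even_var \<psi>\<^sub>1" "nf 0 even_var \<phi>\<^sub>2 = nf 0 even_var \<psi>\<^sub>2"
      by (cases \<psi>) auto
    then have "size \<psi>\<^sub>1 = size \<phi>\<^sub>1" by (metis size_nf)
    then have "prv T (Imp \<psi>\<^sub>1 \<phi>\<^sub>1)" "prv T (Imp \<phi>\<^sub>2 \<psi>\<^sub>2)"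
      using less.hyps \<psi> Imp by auto
    then have "derives T {\<psi>\<^sub>1, Imp \<phi>\<^sub>1 \<phi>\<^sub>2} \<psi>\<^sub>2"
      by (meson insertI1 insertI2 derives.intros)
    then show ?thesis using Imp \<psi>(1) deduction_theorem derives_empty by metis
  next
    case (All x \<phi>')
    with less.prems obtain y \<psi>' where \<psi>: "\<psi> = All y \<psi>'" by (cases \<psi>) auto
    have "nf 0 even_var (ssubst (Var(x := Var y)) \<phi>') = nf 0 even_var \<psi>'"
      using less.prems All \<psi> by (intro nf_open_eq) simp
    then have "prv T (Imp (ssubst (Var(x := Var y)) \<phi>') \<psi>')" using All by (intro less.hyps) auto
    then have "prv T (Imp (All x \<phi>') \<psi>')" using prv_inst prv_Imp_trans by blast
    then have "prv T (Imp (All y \<phi>) \<psi>)" unfolding All \<psi> by (meson prv_Gen prv_dist prv_MP)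
    moreover have "prv T (Imp \<phi> (All y \<phi>))"
      using nf_eq_imp_fv_eq[OF less.prems] \<psi> by (intro prv_vac) simp
    ultimately show ?thesis using prv_Imp_trans by blast
  qed
qed

lemma prv_rename_All:
  assumes "z \<notin> vars \<phi>"
  shows "prv T (Imp (All z (ssubst (Var(x := Var z)) \<phi>)) (All x \<phi>))"
proof (rule prv_Imp_alpha)
  have "nf 1 (even_var(z := Var 1)) (ssubst (Var(x := Var z)) \<phi>) = nf 1 (even_var(x := Var 1)) \<phi>"
    unfolding nf_ssubst nf_eq_iff using assms fv_subset_vars by auto
  then show "nf 0 even_var (All z (ssubst (Var(x := Var z)) \<phi>)) = nf 0 even_var (All x \<phi>)"
    by (simp del: fun_upd_apply)
qed

section \<open>The completeness theorem\<close>

instance trm :: countable by countable_datatype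
instance fm :: countable by countable_datatype

definition consistent_with :: "fm set \<Rightarrow> fm set \<Rightarrow> bool" where
  "consistent_with T \<Gamma> \<longleftrightarrow> \<not> derives T \<Gamma> Bot"

lemma refuted_Imp:
  assumes "derives T (insert (Imp \<phi> \<psi>) \<Gamma>) Bot"
  shows "derives T \<Gamma> \<phi>" and "derives T (insert \<psi> \<Gamma>) Bot"
proof -
  have refuted: "derives T \<Gamma> (Imp (Imp \<phi> \<psi>) Bot)" using assms by (rule deduction_theorem)
  have "derives T (insert \<phi> (insert (Neg \<phi>) \<Gamma>)) Bot"
    unfolding Neg_def by (meson insertI1 insertI2 derives_MP derives_hyp)
  then have "derives T (insert (Neg \<phi>) \<Gamma>) (Imp \<phi> \<psi>)"
    using derives_Bot_elim deduction_theorem by blast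
  then have "derives T (insert (Neg \<phi>) \<Gamma>) Bot"
    using refuted by (meson derives_MP derives_mono subset_insertI)
  then show "derives T \<Gamma> \<phi>" by (rule derives_contradiction)
  have "derives T (insert \<psi> \<Gamma>) (Imp \<phi> \<psi>)"
    by (meson insertI1 derives_MP derives_hyp derives_thm prv_K)
  then show "derives T (insert \<psi> \<Gamma>) Bot"
    using refuted by (meson derives_MP derives_mono subset_insertI)
qed

fun henkin_axiom :: "fm set \<Rightarrow> fm \<Rightarrow> fm" where
  "henkin_axiom \<Gamma> (All x \<phi>) =
     Imp (ssubst (Var(x := Var (fresh (insert x (vars \<phi> \<union> \<Union>(vars ` \<Gamma>)))))) \<phi>) (All x \<phi>)"
| "henkin_axiom \<Gamma> \<phi> = Top"

lemma consistent_with_henkin_axiom: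
  assumes "consistent_with T \<Gamma>" "finite \<Gamma>"
  shows "consistent_with T (insert (henkin_axiom \<Gamma> \<phi>) \<Gamma>)"
  unfolding consistent_with_def
proof
  assume inconsistent: "derives T (insert (henkin_axiom \<Gamma> \<phi>) \<Gamma>) Bot"
  have "derives T \<Gamma> Bot"
  proof (cases "\<exists>x \<psi>. \<phi> = All x \<psi>")
    case False
    then have "henkin_axiom \<Gamma> \<phi> = Top" by (cases \<phi>) auto
    then show ?thesis
      using inconsistent unfolding Top_def
      by (metis derives_MP deduction_theorem derives_thm prv_Imp_refl)
  next
    case True
    then obtain x \<psi> where \<phi>: "\<phi> = All x \<psi>" by blast
    define z where "z = fresh (insert x (vars \<psi> \<union> \<Union>(vars ` \<Gamma>)))"
    have z: "z \<notin> insert x (vars \<psi> \<union> \<Union>(vars ` \<Gamma>))"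
      unfolding z_def by (rule fresh_notin) (use assms(2) in auto)
    have refuted: "derives T (insert (Imp (ssubst (Var(x := Var z)) \<psi>) (All x \<psi>)) \<Gamma>) Bot"
      using inconsistent by (simp add: \<phi> z_def)
    have "derives T \<Gamma> (All z (ssubst (Var(x := Var z)) \<psi>))"
      by (rule derives_Gen[OF refuted_Imp(1)[OF refuted]]) (use z fv_subset_vars in auto)
    then have "derives T \<Gamma> (All x \<psi>)"
      using prv_rename_All[of z \<psi>] z by (meson UnI1 insertI2 derives_MP derives_thm)
    then show ?thesis
      using refuted_Imp(2)[OF refuted] by (meson deduction_theorem derives_MP)
  qed
  with assms(1) show False by (simp add: consistent_with_def)
qed

primrec henkin_chain :: "fm set \<Rightarrow> fm \<Rightarrow> nat \<Rightarrow> fm set" where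
  "henkin_chain T \<phi> 0 = {\<phi>}"
| "henkin_chain T \<phi> (Suc n) =
     (let \<Gamma> = insert (henkin_axiom (henkin_chain T \<phi> n) (from_nat n)) (henkin_chain T \<phi> n)
      in if consistent_with T (insert (from_nat n) \<Gamma>) then insert (from_nat n) \<Gamma> else \<Gamma>)"

lemma finite_henkin_chain: "finite (henkin_chain T \<phi> n)"
  by (induction n) (auto simp: Let_def)

lemma consistent_with_henkin_chain:
  "consistent_with T {\<phi>} \<Longrightarrow> consistent_with T (henkin_chain T \<phi> n)"
  by (induction n) (auto simp: Let_def consistent_with_henkin_axiom finite_henkin_chain)

lemma henkin_chain_mono: "m \<le> n \<Longrightarrow> henkin_chain T \<phi> m \<subseteq> henkin_chain T \<phi> n"
  by (rule lift_Suc_mono_le[of "henkin_chain T \<phi>"]) (auto simp: Let_def)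

lemma derives_Union_henkin_chain:
  "derives T (\<Union>n. henkin_chain T \<phi> n) \<psi> \<Longrightarrow> \<exists>n. derives T (henkin_chain T \<phi> n) \<psi>"
proof (induction rule: derives.induct)
  case (derives_MP \<psi> \<chi>)
  then obtain m n where
    "derives T (henkin_chain T \<phi> m) (Imp \<psi> \<chi>)" "derives T (henkin_chain T \<phi> n) \<psi>" by blast
  then have "derives T (henkin_chain T \<phi> (max m n)) (Imp \<psi> \<chi>)"
    "derives T (henkin_chain T \<phi> (max m n)) \<psi>"
    by (meson derives_mono henkin_chain_mono max.cobounded1 max.cobounded2)+
  then show ?case by (meson derives.derives_MP)
qed (auto intro: derives.intros)

lemma Union_henkin_chain_maximal:
  assumes "\<psi> \<notin> (\<Union>n. henkin_chain T \<phi> n)"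
  shows "derives T (insert \<psi> (\<Union>n. henkin_chain T \<phi> n)) Bot"
proof -
  let ?\<Gamma> = "henkin_chain T \<phi> (to_nat \<psi>)"
  have "\<psi> \<notin> henkin_chain T \<phi> (Suc (to_nat \<psi>))" using assms by blast
  then have "derives T (insert \<psi> (insert (henkin_axiom ?\<Gamma> \<psi>) ?\<Gamma>)) Bot"
    by (auto simp: Let_def consistent_with_def split: if_splits)
  moreover have "henkin_axiom ?\<Gamma> \<psi> \<in> henkin_chain T \<phi> (Suc (to_nat \<psi>))" by (simp add: Let_def)
  ultimately show ?thesis by (elim derives_mono) blast
qed

lemma Union_henkin_chain_witness:
  "\<exists>z. Imp (ssubst (Var(x := Var z)) \<psi>) (All x \<psi>) \<in> (\<Union>n. henkin_chain T \<phi> n)"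
proof -
  have "henkin_axiom (henkin_chain T \<phi> (to_nat (All x \<psi>))) (All x \<psi>)
      \<in> henkin_chain T \<phi> (Suc (to_nat (All x \<psi>)))"
    by (simp add: Let_def)
  then show ?thesis by (auto simp del: henkin_chain.simps)
qed

locale henkin_theory =
  fixes T H :: "fm set"
  assumes consistent: "\<not> derives T H Bot"
    and maximal: "\<psi> \<notin> H \<Longrightarrow> derives T (insert \<psi> H) Bot"
    and witness: "\<exists>z. Imp (ssubst (Var(x := Var z)) \<psi>) (All x \<psi>) \<in> H"

lemma henkin_theory_exists:
  assumes "consistent_with T {\<phi>}"
  obtains H where "henkin_theory T H" "\<phi> \<in> H"
proof
  show "henkin_theory T (\<Union>n. henkin_chain T \<phi> n)"
  proof
    show "\<not> derives T (\<Union>n. henkin_chain T \<phi> n) Bot"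
      using derives_Union_henkin_chain consistent_with_henkin_chain[OF assms]
      unfolding consistent_with_def by blast
  qed (rule Union_henkin_chain_maximal Union_henkin_chain_witness, assumption?)+
  show "\<phi> \<in> (\<Union>n. henkin_chain T \<phi> n)" by (rule UN_I[of 0]) auto
qed

context henkin_theory
begin

lemma derives_closed: "derives T H \<psi> \<Longrightarrow> \<psi> \<in> H"
  using maximal consistent by (meson deduction_theorem derives_MP)

lemma prv_mem: "prv T \<psi> \<Longrightarrow> \<psi> \<in> H"
  using derives_closed derives_thm by blast

lemma mem_MP: "Imp \<psi> \<chi> \<in> H \<Longrightarrow> \<psi> \<in> H \<Longrightarrow> \<chi> \<in> H"
  using derives_closed by (meson derives_hyp derives_MP)

lemma Bot_notin: "Bot \<notin> H"
  using consistent derives_hyp by blast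

lemma Imp_mem_iff: "Imp \<psi> \<chi> \<in> H \<longleftrightarrow> (\<psi> \<in> H \<longrightarrow> \<chi> \<in> H)"
proof
  assume mem: "\<psi> \<in> H \<longrightarrow> \<chi> \<in> H"
  show "Imp \<psi> \<chi> \<in> H"
  proof (cases "\<psi> \<in> H")
    case True
    with mem show ?thesis using mem_MP prv_mem prv_K by blast
  next
    case False
    then have "derives T (insert \<psi> H) \<chi>" by (rule derives_Bot_elim[OF maximal])
    then show ?thesis using deduction_theorem derives_closed by blast
  qed
qed (use mem_MP in blast)

lemma Neg_mem_iff: "Neg \<psi> \<in> H \<longleftrightarrow> \<psi> \<notin> H"
  unfolding Neg_def Imp_mem_iff using Bot_notin by blast

lemma All_mem_iff: "All x \<psi> \<in> H \<longleftrightarrow> (\<forall>t. ssubst (Var(x := t)) \<psi> \<in> H)"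
proof
  assume "\<forall>t. ssubst (Var(x := t)) \<psi> \<in> H"
  then show "All x \<psi> \<in> H" using witness mem_MP by blast
next
  assume "All x \<psi> \<in> H"
  then show "\<forall>t. ssubst (Var(x := t)) \<psi> \<in> H" using mem_MP prv_mem[OF prv_inst] by blast
qed

lemma Eq_mem_replace:
  assumes "Eq s t \<in> H" "ssubst (Var(x := s)) \<psi> \<in> H"
  shows "ssubst (Var(x := t)) \<psi> \<in> H"
  using mem_MP[OF mem_MP[OF prv_mem[OF prv_leib] assms(1)] assms(2)] .

lemma Eq_mem_refl: "Eq t t \<in> H"
  using prv_mem prv_refl by blast

lemma Eq_mem_sym:
  assumes "Eq s t \<in> H"
  shows "Eq t s \<in> H"
proof -
  define x where "x = fresh (tvars s)"
  have "x \<notin> tvars s" unfolding x_def by (rule fresh_notin) simp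
  with Eq_mem_replace[OF assms, of x "Eq (Var x) s"] Eq_mem_refl show ?thesis
    by (simp add: tsubst_upd_notin)
qed

lemma Eq_mem_trans:
  assumes "Eq s t \<in> H" "Eq t u \<in> H"
  shows "Eq s u \<in> H"
proof -
  define x where "x = fresh (tvars s)"
  have "x \<notin> tvars s" unfolding x_def by (rule fresh_notin) simp
  with Eq_mem_replace[OF assms(2), of x "Eq s (Var x)"] assms(1) show ?thesis
    by (simp add: tsubst_upd_notin)
qed

lemma Eq_mem_replace_args:
  assumes "list_all2 (\<lambda>s t. Eq s t \<in> H) ss ts"
    and subst_arg: "\<And>x us vs s. x \<notin> (\<Union>u\<in>set (us @ vs) \<union> V. tvars u) \<Longrightarrow>
      ssubst (Var(x := s)) (\<psi> (us @ Var x # vs)) = \<psi> (us @ s # vs)"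
    and "finite V"
  shows "\<psi> (us @ ss) \<in> H \<Longrightarrow> \<psi> (us @ ts) \<in> H"
  using assms(1)
proof (induction ss ts arbitrary: us rule: list_all2_induct)
  case (Cons s ss t ts)
  define x where "x = fresh (\<Union>u\<in>set (us @ ss) \<union> V. tvars u)"
  have "x \<notin> (\<Union>u\<in>set (us @ ss) \<union> V. tvars u)"
    unfolding x_def by (rule fresh_notin) (use \<open>finite V\<close> in auto)
  then have "\<psi> (us @ t # ss) \<in> H"
    using Eq_mem_replace[OF Cons.hyps(1), of x "\<psi> (us @ Var x # ss)"] Cons.prems
    by (simp add: subst_arg)
  then show ?case using Cons.IH[of "us @ [t]"] by simp
qed

lemma Rel_mem_cong:
  assumes "list_all2 (\<lambda>s t. Eq s t \<in> H) ss ts" "Rel r ss \<in> H"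
  shows "Rel r ts \<in> H"
  using Eq_mem_replace_args[OF assms(1), of "{}" "Rel r" "[]"] assms(2)
  by (simp add: map_tsubst_upd_notin)

lemma Fn_mem_cong:
  assumes "list_all2 (\<lambda>s t. Eq s t \<in> H) ss ts"
  shows "Eq (Fn f ss) (Fn f ts) \<in> H"
  using Eq_mem_replace_args[OF assms, of "set ss" "\<lambda>us. Eq (Fn f ss) (Fn f us)" "[]"] Eq_mem_refl
  by (simp add: map_tsubst_upd_notin)

definition rep :: "trm \<Rightarrow> trm" where
  "rep t = (SOME s. Eq t s \<in> H)"

lemma Eq_mem_rep: "Eq t (rep t) \<in> H"
  unfolding rep_def using Eq_mem_refl by (rule someI)

lemma rep_eq_iff: "rep s = rep t \<longleftrightarrow> Eq s t \<in> H"
proof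
  assume "rep s = rep t"
  then show "Eq s t \<in> H" using Eq_mem_rep Eq_mem_sym Eq_mem_trans by metis
next
  assume "Eq s t \<in> H"
  then have "(\<lambda>u. Eq s u \<in> H) = (\<lambda>u. Eq t u \<in> H)" using Eq_mem_sym Eq_mem_trans by blast
  then show "rep s = rep t" unfolding rep_def by simp
qed

lemma list_all2_rep:
  "list_all2 (\<lambda>s t. Eq s t \<in> H) ts (map rep ts)" "list_all2 (\<lambda>s t. Eq s t \<in> H) (map rep ts) ts"
  by (simp_all add: list_all2_conv_all_nth Eq_mem_rep Eq_mem_sym)

definition term_struct :: "trm struct" where
  "term_struct = \<lparr>univ = range rep, fint = \<lambda>f ts. rep (Fn f ts), rint = \<lambda>r ts. Rel r ts \<in> H\<rparr>"

lemma term_struct_sel [simp]: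
  "univ term_struct = range rep" "fint term_struct f ts = rep (Fn f ts)"
  "rint term_struct r ts \<longleftrightarrow> Rel r ts \<in> H"
  by (simp_all add: term_struct_def)

definition term_assignment :: "nat \<Rightarrow> trm" where
  "term_assignment x = rep (Var x)"

lemma val_term_struct: "val term_struct term_assignment t = rep t"
proof (induction t)
  case (Fn f ts)
  have "map (val term_struct term_assignment) ts = map rep ts" using Fn by simp
  then have "val term_struct term_assignment (Fn f ts) = rep (Fn f (map rep ts))"
    by (simp only: val.simps term_struct_sel)
  also have "\<dots> = rep (Fn f ts)" unfolding rep_eq_iff by (rule Fn_mem_cong[OF list_all2_rep(2)])
  finally show ?case .
qed (simp add: term_assignment_def)

lemma sat_term_struct_iff: "sat term_struct term_assignment \<psi> \<longleftrightarrow> \<psi> \<in> H"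
proof (induction "size \<psi>" arbitrary: \<psi> rule: less_induct)
  case less
  show ?case
  proof (cases \<psi>)
    case Bot
    then show ?thesis using Bot_notin by simp
  next
    case (Eq s t)
    then show ?thesis by (simp add: val_term_struct rep_eq_iff)
  next
    case (Rel r ts)
    have "map (val term_struct term_assignment) ts = map rep ts" by (simp add: val_term_struct)
    then have "sat term_struct term_assignment \<psi> \<longleftrightarrow> Rel r (map rep ts) \<in> H"
      by (simp only: Rel sat.simps term_struct_sel)
    then show ?thesis unfolding Rel using Rel_mem_cong list_all2_rep by blast
  next
    case (Imp \<psi>\<^sub>1 \<psi>\<^sub>2)
    then show ?thesis using less.hyps Imp_mem_iff by simp
  next
    case (All x \<chi>)
    have "univ term_struct = range (val term_struct term_assignment)"
      by (simp add: val_term_struct)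
    then have "sat term_struct term_assignment \<psi>
        \<longleftrightarrow> (\<forall>t. sat term_struct (term_assignment(x := val term_struct term_assignment t)) \<chi>)"
      by (simp add: All)
    also have "\<dots> \<longleftrightarrow> (\<forall>t. ssubst (Var(x := t)) \<chi> \<in> H)"
      using less.hyps All by (simp add: sat_ssubst_upd[symmetric])
    finally show ?thesis unfolding All All_mem_iff .
  qed
qed

lemma range_term_assignment: "range term_assignment \<subseteq> univ term_struct"
  by (auto simp: term_assignment_def)

lemma model_term_struct:
  assumes "\<And>\<tau>. \<tau> \<in> T \<Longrightarrow> fv \<tau> = {}"
  shows "model term_struct T"
  unfolding model_def
proof (intro conjI allI ballI impI)
  show "univ term_struct \<noteq> {}" "fint term_struct f ts \<in> univ term_struct" for f ts
    by simp_all
  fix \<tau> and e :: "nat \<Rightarrow> trm"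
  assume "\<tau> \<in> T"
  then have "sat term_struct term_assignment \<tau>" using sat_term_struct_iff prv_mem prv_ax by blast
  then show "sat term_struct e \<tau>" using sat_closed_cong[OF assms[OF \<open>\<tau> \<in> T\<close>]] by blast
qed

end

theorem completeness:
  assumes "\<And>\<tau>. \<tau> \<in> T \<Longrightarrow> fv \<tau> = {}"
    and valid: "\<And>(M :: trm struct) e. model M T \<Longrightarrow> range e \<subseteq> univ M \<Longrightarrow> sat M e \<phi>"
  shows "prv T \<phi>"
proof (rule ccontr)
  assume "\<not> prv T \<phi>"
  then have "consistent_with T {Neg \<phi>}"
    unfolding consistent_with_def using derives_contradiction derives_empty by blast
  then obtain H where "henkin_theory T H" and "Neg \<phi> \<in> H" by (rule henkin_theory_exists)
  interpret henkin_theory T H by fact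
  have "sat term_struct term_assignment \<phi>"
    using model_term_struct[OF assms(1)] range_term_assignment by (intro valid) auto
  with \<open>Neg \<phi> \<in> H\<close> show False by (simp add: sat_term_struct_iff Neg_mem_iff)
qed

lemma wf_thy_completeness:
  assumes "wf_thy S" "\<And>(M :: trm struct) e. model M (snd S) \<Longrightarrow> range e \<subseteq> univ M \<Longrightarrow> sat M e \<phi>"
  shows "prv (snd S) \<phi>"
  by (rule completeness[OF _ assms(2)]) (use assms(1) in \<open>auto simp: wf_thy_def sentences_def\<close>)

section \<open>Interpretations\<close>

definition env :: "'a list \<Rightarrow> nat \<Rightarrow> 'a" where
  "env xs i = (if i < length xs then xs ! i else undefined)"

lemma env_Cons: "env (x # xs) = case_nat x (env xs)"
  by (auto simp: env_def fun_eq_iff split: nat.splits)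

definition upd_block :: "(nat \<Rightarrow> 'a) \<Rightarrow> nat \<Rightarrow> 'a list \<Rightarrow> nat \<Rightarrow> 'a" where
  "upd_block e b ds i = (if b \<le> i \<and> i < b + length ds then ds ! (i - b) else e i)"

lemma upd_block_Cons: "upd_block e b (d # ds) = upd_block (e(b := d)) (Suc b) ds"
  by (auto simp: upd_block_def fun_eq_iff nth_Cons' Suc_le_eq)

lemma upd_block_Nil [simp]: "upd_block e b [] = e"
  by (auto simp: upd_block_def fun_eq_iff)

lemma upd_block_nth: "i < length ds \<Longrightarrow> upd_block e b ds (b + i) = ds ! i"
  by (simp add: upd_block_def)

lemma upd_block_below: "x < b \<Longrightarrow> upd_block e b ds x = e x"
  by (simp add: upd_block_def)

lemma map_upd_block: "map (upd_block e b ds) [b..<b + length ds] = ds"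
  by (rule nth_equalityI) (auto simp: upd_block_def)

lemma range_upd_block: "range e \<subseteq> D \<Longrightarrow> set ds \<subseteq> D \<Longrightarrow> range (upd_block e b ds) \<subseteq> D"
  by (auto simp: upd_block_def)

lemma sat_alls_block:
  "sat M e (alls [b..<b + n] \<phi>) \<longleftrightarrow>
    (\<forall>ds. length ds = n \<longrightarrow> set ds \<subseteq> univ M \<longrightarrow> sat M (upd_block e b ds) \<phi>)"
proof (induction n arbitrary: b e)
  case (Suc n)
  have "[b..<b + Suc n] = b # [Suc b..<Suc b + n]" by (simp add: upt_rec)
  then have "sat M e (alls [b..<b + Suc n] \<phi>)
      \<longleftrightarrow> (\<forall>d\<in>univ M. sat M (e(b := d)) (alls [Suc b..<Suc b + n] \<phi>))"
    by (simp add: alls_def)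
  also have "\<dots> \<longleftrightarrow> (\<forall>d\<in>univ M. \<forall>ds. length ds = n \<longrightarrow> set ds \<subseteq> univ M \<longrightarrow>
      sat M (upd_block e b (d # ds)) \<phi>)"
    by (simp only: Suc.IH upd_block_Cons)
  also have "\<dots> \<longleftrightarrow> (\<forall>ds. length ds = Suc n \<longrightarrow> set ds \<subseteq> univ M \<longrightarrow> sat M (upd_block e b ds) \<phi>)"
    unfolding length_Suc_conv by (auto; metis insert_subset list.simps(15))
  finally show ?case .
qed (simp add: alls_def)

lemma sat_exs_iff_alls: "sat M e (exs xs \<phi>) \<longleftrightarrow> \<not> sat M e (alls xs (Neg \<phi>))"
  by (induction xs arbitrary: e) (simp_all add: exs_def alls_def)

lemma sat_exs_block:
  "sat M e (exs [b..<b + n] \<phi>) \<longleftrightarrow>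
    (\<exists>ds. length ds = n \<and> set ds \<subseteq> univ M \<and> sat M (upd_block e b ds) \<phi>)"
  unfolding sat_exs_iff_alls sat_alls_block by auto

lemma sat_env_cong:
  "fv \<phi> \<subseteq> {..<length xs} \<Longrightarrow> (\<And>i. i < length xs \<Longrightarrow> e i = xs ! i) \<Longrightarrow>
    sat M e \<phi> = sat M (env xs) \<phi>"
  by (rule sat_cong) (auto simp: env_def)

lemma sat_inst:
  "fv \<phi> \<subseteq> {..<length vs} \<Longrightarrow> sat M e (inst \<phi> vs) = sat M (env (map e vs)) \<phi>"
  unfolding inst_def sat_ssubst by (rule sat_cong) (auto simp: env_def)

definition interpreted_univ :: "'a struct \<Rightarrow> interp \<Rightarrow> 'a set" where
  "interpreted_univ M I = {d \<in> univ M. sat M (env [d]) (idom I)}"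

definition interpreted :: "'a struct \<Rightarrow> interp \<Rightarrow> 'a struct" where
  "interpreted M I =
     \<lparr>univ = interpreted_univ M I,
      fint = \<lambda>f xs. THE y. y \<in> interpreted_univ M I \<and> sat M (env (xs @ [y])) (ifun I (f, length xs)),
      rint = \<lambda>r xs. sat M (env xs) (irel I (r, length xs))\<rparr>"

lemma univ_interpreted: "univ (interpreted M I) = interpreted_univ M I"
  by (simp add: interpreted_def)

lemma univ_interpreted_subset: "univ (interpreted M I) \<subseteq> univ M"
  by (auto simp: interpreted_def interpreted_univ_def)

lemma rint_interpreted: "rint (interpreted M I) r xs \<longleftrightarrow> sat M (env xs) (irel I (r, length xs))"
  by (simp add: interpreted_def)

definition wf_interp :: "interp \<Rightarrow> lang \<Rightarrow> lang \<Rightarrow> bool" where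
  "wf_interp I L L' \<longleftrightarrow> fm_in L' (idom I) \<and> fv (idom I) \<subseteq> {0} \<and>
     (\<forall>(r, n)\<in>rsyms L. fm_in L' (irel I (r, n)) \<and> fv (irel I (r, n)) \<subseteq> {..<n}) \<and>
     (\<forall>(f, n)\<in>fsyms L. fm_in L' (ifun I (f, n)) \<and> fv (ifun I (f, n)) \<subseteq> {..n})"

lemma is_interpretation_iff_wf_interp:
  "is_interpretation I T S \<longleftrightarrow> wf_interp I (fst T) (fst S) \<and> prv (snd S) (Ex 0 (idom I)) \<and>
     (\<forall>fn\<in>fsyms (fst T). prv (snd S) (fun_ok I fn)) \<and> (\<forall>\<phi>\<in>snd T. prv (snd S) (tr I \<phi>))"
  by (auto simp: is_interpretation_def wf_interp_def)

lemma
  assumes "wf_interp I L L'"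
  shows wf_interp_fv_dom: "fv (idom I) \<subseteq> {..<Suc 0}"
    and wf_interp_fv_rel: "(r, n) \<in> rsyms L \<Longrightarrow> fv (irel I (r, n)) \<subseteq> {..<n}"
    and wf_interp_fv_fun: "(f, n) \<in> fsyms L \<Longrightarrow> fv (ifun I (f, n)) \<subseteq> {..<Suc n}"
  using assms by (auto simp: wf_interp_def lessThan_Suc_atMost)

lemma sat_idom_iff:
  assumes "wf_interp I L L'" "e 0 \<in> univ M"
  shows "sat M e (idom I) \<longleftrightarrow> e 0 \<in> univ (interpreted M I)"
proof -
  have "sat M e (idom I) \<longleftrightarrow> sat M (env [e 0]) (idom I)"
    by (rule sat_env_cong) (use wf_interp_fv_dom[OF assms(1)] in auto)
  with assms(2) show ?thesis by (simp add: univ_interpreted interpreted_univ_def)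
qed

lemma sat_inst_idom_iff:
  assumes "wf_interp I L L'" "e x \<in> univ M"
  shows "sat M e (inst (idom I) [x]) \<longleftrightarrow> e x \<in> univ (interpreted M I)"
  using sat_inst[of "idom I" "[x]" M e] wf_interp_fv_dom[OF assms(1)] assms(2)
  by (simp add: univ_interpreted interpreted_univ_def)

lemma sat_fun_ok_iff:
  assumes wf: "wf_interp I L L'" and "(f, n) \<in> fsyms L"
  shows "sat M e (fun_ok I (f, n)) \<longleftrightarrow>
    (\<forall>xs. length xs = n \<longrightarrow> set xs \<subseteq> univ (interpreted M I) \<longrightarrow>
      (\<exists>!y. y \<in> univ (interpreted M I) \<and> sat M (env (xs @ [y])) (ifun I (f, n))))"
    (is "_ \<longleftrightarrow> (\<forall>xs. _ \<longrightarrow> _ \<longrightarrow> (\<exists>!y. ?graph xs y))")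
proof -
  let ?D = "univ (interpreted M I)"
  let ?body = "Ex n (And (inst (idom I) [n]) (And (inst (ifun I (f, n)) [0..<Suc n])
    (All (Suc n) (Imp (And (inst (idom I) [Suc n]) (inst (ifun I (f, n)) ([0..<n] @ [Suc n])))
      (Eq (Var (Suc n)) (Var n))))))"
  have args_in_dom: "sat M (upd_block e 0 xs) (conjs (map (\<lambda>i. inst (idom I) [i]) [0..<n]))
      \<longleftrightarrow> set xs \<subseteq> ?D" if "length xs = n" "set xs \<subseteq> univ M" for xs
  proof -
    have "upd_block e 0 xs i = xs ! i" "xs ! i \<in> univ M" if "i < n" for i
      using that \<open>length xs = n\<close> \<open>set xs \<subseteq> univ M\<close> nth_mem[of i xs] by (auto simp: upd_block_def)
    then have "sat M (upd_block e 0 xs) (conjs (map (\<lambda>i. inst (idom I) [i]) [0..<n]))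
        \<longleftrightarrow> (\<forall>i<n. xs ! i \<in> ?D)"
      using sat_inst_idom_iff[OF wf, of "upd_block e 0 xs" _ M] by (auto simp: sat_conjs)
    then show ?thesis using \<open>length xs = n\<close> by (metis in_set_conv_nth nth_mem subset_code(1))
  qed
  have body: "sat M (upd_block e 0 xs) ?body \<longleftrightarrow> (\<exists>!y. ?graph xs y)"
    if "length xs = n" "set xs \<subseteq> univ M" for xs
  proof -
    have "map (upd_block e 0 xs) [0..<n] = xs" using map_upd_block[of e 0 xs] that by simp
    then have "sat M (upd_block e 0 xs) ?body \<longleftrightarrow>
        (\<exists>y\<in>univ M. ?graph xs y \<and> (\<forall>z\<in>univ M. ?graph xs z \<longrightarrow> z = y))"
      using wf_interp_fv_fun[OF wf assms(2)]
      by (simp add: sat_inst_idom_iff[OF wf] sat_inst[of "ifun I (f, n)"])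
    also have "\<dots> \<longleftrightarrow> (\<exists>!y. ?graph xs y)" using univ_interpreted_subset[of M I] by blast
    finally show ?thesis .
  qed
  have "sat M e (fun_ok I (f, n)) \<longleftrightarrow>
      (\<forall>xs. length xs = n \<longrightarrow> set xs \<subseteq> univ M \<longrightarrow> set xs \<subseteq> ?D \<longrightarrow> (\<exists>!y. ?graph xs y))"
    unfolding fun_ok_def Let_def snd_conv sat_alls_block[of M e 0 n, unfolded add_0] sat.simps
    using args_in_dom body by blast
  then show ?thesis using univ_interpreted_subset[of M I] by blast
qed

locale interpretation_in =
  fixes M :: "'a struct" and I :: interp and L L' :: lang
  assumes wf: "wf_interp I L L'"
    and univ_nonempty: "univ (interpreted M I) \<noteq> {}"
    and fun_total: "\<lbrakk>(f, length xs) \<in> fsyms L; set xs \<subseteq> univ (interpreted M I)\<rbrakk> \<Longrightarrow>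
      \<exists>!y. y \<in> univ (interpreted M I) \<and> sat M (env (xs @ [y])) (ifun I (f, length xs))"
begin

abbreviation "N \<equiv> interpreted M I"

lemma fint_in_univ: "(f, length xs) \<in> fsyms L \<Longrightarrow> set xs \<subseteq> univ N \<Longrightarrow> fint N f xs \<in> univ N"
  and sat_ifun_iff: "\<lbrakk>(f, length xs) \<in> fsyms L; set xs \<subseteq> univ N; y \<in> univ N\<rbrakk> \<Longrightarrow>
    sat M (env (xs @ [y])) (ifun I (f, length xs)) \<longleftrightarrow> y = fint N f xs"
proof -
  have fint: "fint N f xs = (THE y. y \<in> univ N \<and> sat M (env (xs @ [y])) (ifun I (f, length xs)))"
    by (simp add: interpreted_def)
  assume total: "(f, length xs) \<in> fsyms L" "set xs \<subseteq> univ N"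
  note fint_graph = theI'[OF fun_total[OF total], folded fint]
  then show "fint N f xs \<in> univ N" by blast
  show "sat M (env (xs @ [y])) (ifun I (f, length xs)) \<longleftrightarrow> y = fint N f xs" if "y \<in> univ N"
    using that fint_graph fun_total[OF total] by blast
qed

lemma val_in_univ: "trm_in L t \<Longrightarrow> e ` tvars t \<subseteq> univ N \<Longrightarrow> val N e t \<in> univ N"
proof (induction t)
  case (Fn f ts)
  then have "set (map (val N e) ts) \<subseteq> univ N" by fastforce
  then show ?case using fint_in_univ[of f "map (val N e) ts"] Fn.prems by simp
qed auto

lemma val_args_in_univ:
  assumes "\<forall>t\<in>set ts. trm_in L t" "e ` (\<Union>t\<in>set ts. tvars t) \<subseteq> univ N"
  shows "set (map (val N e) ts) \<subseteq> univ N"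
proof -
  have "val N e t \<in> univ N" if "t \<in> set ts" for t
    by (rule val_in_univ) (use assms that in blast)+
  then show ?thesis by auto
qed

definition denotes_args :: "(nat \<Rightarrow> 'a) \<Rightarrow> trm list \<Rightarrow> nat \<Rightarrow> bool" where
  "denotes_args e ts b \<longleftrightarrow> (\<forall>i<length ts. e (b + i) \<in> univ N \<and> e (b + i) = val N e (ts ! i))"

definition tr_trm_correct :: "trm \<Rightarrow> bool" where
  "tr_trm_correct t \<longleftrightarrow> (\<forall>e y. range e \<subseteq> univ M \<longrightarrow> e ` tvars t \<subseteq> univ N \<longrightarrow> e y \<in> univ N \<longrightarrow>
     (sat M e (tr_trm I t y) \<longleftrightarrow> e y = val N e t))"

lemma sat_tr_args_iff:
  "\<lbrakk>\<forall>t\<in>set ts. tr_trm_correct t; range e \<subseteq> univ M; e ` (\<Union>t\<in>set ts. tvars t) \<subseteq> univ N\<rbrakk> \<Longrightarrow>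
    sat M e (tr_args I ts b) \<longleftrightarrow> denotes_args e ts b"
proof (induction ts arbitrary: b)
  case (Cons t ts)
  have "e b \<in> univ M" using Cons.prems(2) by blast
  then have "sat M e (inst (idom I) [b]) \<longleftrightarrow> e b \<in> univ N" by (rule sat_inst_idom_iff[OF wf])
  moreover have "sat M e (tr_trm I t b) \<longleftrightarrow> e b = val N e t" if "e b \<in> univ N"
    using Cons.prems that by (simp add: tr_trm_correct_def image_Un)
  ultimately have "sat M e (tr_args I (t # ts) b) \<longleftrightarrow>
      (e b \<in> univ N \<and> e b = val N e t) \<and> denotes_args e ts (Suc b)"
    using Cons.IH[of "Suc b"] Cons.prems by (auto simp: image_Un)
  also have "\<dots> \<longleftrightarrow> denotes_args e (t # ts) b"
    by (simp add: denotes_args_def All_less_Suc2)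
  finally show ?case .
qed (simp add: denotes_args_def)

lemma sat_exs_args:
  assumes correct: "\<forall>t\<in>set ts. tr_trm_correct t"
    and assignment: "range e \<subseteq> univ M" "e ` (\<Union>t\<in>set ts. tvars t) \<subseteq> univ N"
    and below: "\<And>x. x \<in> (\<Union>t\<in>set ts. tvars t) \<Longrightarrow> x < b"
    and terms: "\<forall>t\<in>set ts. trm_in L t"
  shows "sat M e (exs [b..<b + length ts] (And (tr_args I ts b) \<phi>))
    \<longleftrightarrow> sat M (upd_block e b (map (val N e) ts)) \<phi>"
proof -
  let ?vs = "map (val N e) ts"
  have vals_in_univ: "set ?vs \<subseteq> univ N" by (rule val_args_in_univ[OF terms assignment(2)])
  have args_block: "sat M (upd_block e b ds) (tr_args I ts b) \<longleftrightarrow> ds = ?vs"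
    if "length ds = length ts" "set ds \<subseteq> univ M" for ds
  proof -
    have "val N (upd_block e b ds) t = val N e t" if "t \<in> set ts" for t
      using below that by (intro val_cong upd_block_below) auto
    then have "denotes_args (upd_block e b ds) ts b \<longleftrightarrow>
        (\<forall>i<length ts. ds ! i \<in> univ N \<and> ds ! i = val N e (ts ! i))"
      using that(1) by (simp add: denotes_args_def upd_block_nth)
    also have "\<dots> \<longleftrightarrow> ds = ?vs" using that vals_in_univ by (auto simp: list_eq_iff_nth_eq)
    finally have denotes: "denotes_args (upd_block e b ds) ts b \<longleftrightarrow> ds = ?vs" .
    have "upd_block e b ds x = e x" if "x \<in> (\<Union>t\<in>set ts. tvars t)" for x
      using below[OF that] by (rule upd_block_below)
    then have "upd_block e b ds ` (\<Union>t\<in>set ts. tvars t) \<subseteq> univ N" using assignment(2) by fastforce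
    from sat_tr_args_iff[OF correct range_upd_block[OF assignment(1) that(2)] this] denotes
    show ?thesis by blast
  qed
  have "set ?vs \<subseteq> univ M" by (rule subset_trans[OF vals_in_univ univ_interpreted_subset])
  then show ?thesis unfolding sat_exs_block sat_connectives using args_block by (metis length_map)
qed

lemma trm_in_tr_trm_correct: "trm_in L t \<Longrightarrow> tr_trm_correct t"
proof (induction t)
  case (Var x)
  show ?case by (simp add: tr_trm_correct_def)
next
  case (Fn f ts)
  have "sat M e (tr_trm I (Fn f ts) y) \<longleftrightarrow> e y = val N e (Fn f ts)"
    if assignment: "range e \<subseteq> univ M" "e ` tvars (Fn f ts) \<subseteq> univ N" "e y \<in> univ N" for e y
  proof -
    let ?vs = "map (val N e) ts"
    define b where "b = fresh (insert y (\<Union>t\<in>set ts. tvars t))"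
    have below: "x < b" if "x \<in> insert y (\<Union>t\<in>set ts. tvars t)" for x
      unfolding b_def by (rule less_fresh) (use that in auto)
    have symbol: "(f, length ?vs) \<in> fsyms L"
      and args: "\<forall>t\<in>set ts. trm_in L t" "e ` (\<Union>t\<in>set ts. tvars t) \<subseteq> univ N"
      using Fn.prems assignment(2) by auto
    have "sat M e (tr_trm I (Fn f ts) y) \<longleftrightarrow>
        sat M (upd_block e b ?vs) (inst (ifun I (f, length ts)) ([b..<b + length ts] @ [y]))"
      unfolding tr_trm.simps Let_def b_def[symmetric]
      using Fn.IH args assignment(1) below by (intro sat_exs_args) auto
    also have "\<dots> \<longleftrightarrow> sat M (env (?vs @ [e y])) (ifun I (f, length ?vs))"
      using wf_interp_fv_fun[OF wf symbol] map_upd_block[of e b ?vs] below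
      by (subst sat_inst) (auto simp: upd_block_below)
    also have "\<dots> \<longleftrightarrow> e y = fint N f ?vs"
      by (rule sat_ifun_iff[OF symbol val_args_in_univ[OF args] assignment(3)])
    finally show ?thesis by simp
  qed
  then show ?case by (simp add: tr_trm_correct_def)
qed

theorem sat_tr_iff:
  "\<lbrakk>fm_in L \<phi>; range e \<subseteq> univ M; e ` fv \<phi> \<subseteq> univ N\<rbrakk> \<Longrightarrow> sat M e (tr I \<phi>) \<longleftrightarrow> sat N e \<phi>"
proof (induction \<phi> arbitrary: e)
  case (Eq s t)
  define b where "b = fresh (tvars s \<union> tvars t)"
  have below: "x < b" if "x \<in> tvars s \<union> tvars t" for x
    unfolding b_def by (rule less_fresh) (use that in auto)
  have pair: "[b, Suc b] = [b..<b + length [s, t]]" by (simp add: upt_rec)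
  have "sat M e (tr I (Eq s t)) \<longleftrightarrow>
      sat M (upd_block e b (map (val N e) [s, t])) (Eq (Var b) (Var (Suc b)))"
    unfolding tr.simps Let_def b_def[symmetric] pair
    by (rule sat_exs_args) (use Eq.prems below trm_in_tr_trm_correct in auto)
  then show ?case by (simp add: upd_block_def)
next
  case (Rel r ts)
  let ?vs = "map (val N e) ts"
  define b where "b = fresh (\<Union>t\<in>set ts. tvars t)"
  have below: "x < b" if "x \<in> (\<Union>t\<in>set ts. tvars t)" for x
    unfolding b_def by (rule less_fresh) (use that in auto)
  have "sat M e (tr I (Rel r ts)) \<longleftrightarrow>
      sat M (upd_block e b ?vs) (inst (irel I (r, length ts)) [b..<b + length ts])"
    unfolding tr.simps Let_def b_def[symmetric]
    by (rule sat_exs_args) (use Rel.prems below trm_in_tr_trm_correct in auto)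
  also have "\<dots> \<longleftrightarrow> sat M (env ?vs) (irel I (r, length ?vs))"
    using wf_interp_fv_rel[OF wf, of r "length ts"] Rel.prems(1) map_upd_block[of e b ?vs]
    by (subst sat_inst) auto
  finally show ?case by (simp add: rint_interpreted)
next
  case (All x \<phi>)
  have "sat M (e(x := d)) (Imp (inst (idom I) [x]) (tr I \<phi>)) \<longleftrightarrow> (d \<in> univ N \<longrightarrow> sat N (e(x := d)) \<phi>)"
    if "d \<in> univ M" for d
  proof -
    have "sat M (e(x := d)) (inst (idom I) [x]) \<longleftrightarrow> d \<in> univ N"
      using sat_inst_idom_iff[OF wf, of "e(x := d)" x] that by simp
    moreover have "sat M (e(x := d)) (tr I \<phi>) \<longleftrightarrow> sat N (e(x := d)) \<phi>" if "d \<in> univ N"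
      using All.prems that \<open>d \<in> univ M\<close> by (intro All.IH) auto
    ultimately show ?thesis by auto
  qed
  then show ?case using univ_interpreted_subset[of M I] by auto
qed (auto simp: image_Un)

end

lemma is_interpretation_interpretation_in:
  assumes interp: "is_interpretation I T S" and model: "model M (snd S)"
  shows "interpretation_in M I (fst T) (fst S)"
proof
  note interp = interp[unfolded is_interpretation_iff_wf_interp]
  show wf: "wf_interp I (fst T) (fst S)" using interp by blast
  obtain d where d_in_univ: "d \<in> univ M" by (rule model_univ_nonempty[OF model])
  have "sat M (\<lambda>_. d) (Ex 0 (idom I))" using d_in_univ interp by (intro soundness[OF _ model]) auto
  then obtain a where "a \<in> univ M" "sat M ((\<lambda>_. d)(0 := a)) (idom I)" by auto
  then show "univ (interpreted M I) \<noteq> {}"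
    using sat_idom_iff[OF wf, of "(\<lambda>_. d)(0 := a)" M] by auto
  fix f xs
  assume symbol: "(f, length xs) \<in> fsyms (fst T)" and args: "set xs \<subseteq> univ (interpreted M I)"
  have "sat M (\<lambda>_. d) (fun_ok I (f, length xs))"
    using d_in_univ symbol interp by (intro soundness[OF _ model]) auto
  then show "\<exists>!y. y \<in> univ (interpreted M I) \<and> sat M (env (xs @ [y])) (ifun I (f, length xs))"
    using args by (simp add: sat_fun_ok_iff[OF wf symbol])
qed

lemma is_interpretation_sat:
  assumes interp: "is_interpretation I T S" and model: "model M (snd S)" and "wf_thy T" "\<phi> \<in> snd T"
  shows "sat (interpreted M I) e \<phi>"
proof -
  interpret interpretation_in M I "fst T" "fst S"
    by (rule is_interpretation_interpretation_in[OF interp model])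
  have sentence: "fm_in (fst T) \<phi>" "fv \<phi> = {}" using assms(3,4) by (auto simp: wf_thy_def sentences_def)
  obtain d where d_in_univ: "d \<in> univ M" by (rule model_univ_nonempty[OF model])
  have "sat M (\<lambda>_. d) (tr I \<phi>)"
    using interp \<open>\<phi> \<in> snd T\<close> d_in_univ
    by (intro soundness[OF _ model]) (auto simp: is_interpretation_def)
  then have "sat N (\<lambda>_. d) \<phi>" using sat_tr_iff[OF sentence(1), of "\<lambda>_. d"] d_in_univ sentence(2) by auto
  then show ?thesis using sat_closed_cong[OF sentence(2)] by blast
qed

lemma is_interpretationI:
  assumes "wf_thy T" "wf_thy S" and wf: "wf_interp I (fst T) (fst S)"
    and models: "\<And>M :: trm struct. model M (snd S) \<Longrightarrow> interpretation_in M I (fst T) (fst S)"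
      "\<And>(M :: trm struct) e \<phi>. model M (snd S) \<Longrightarrow> \<phi> \<in> snd T \<Longrightarrow> sat (interpreted M I) e \<phi>"
  shows "is_interpretation I T S"
  unfolding is_interpretation_iff_wf_interp
proof (intro conjI ballI)
  show "wf_interp I (fst T) (fst S)" by (rule wf)
  show "prv (snd S) (Ex 0 (idom I))"
  proof (rule wf_thy_completeness[OF \<open>wf_thy S\<close>])
    fix M :: "trm struct" and e assume "model M (snd S)"
    then have "univ (interpreted M I) \<noteq> {}" by (rule interpretation_in.univ_nonempty[OF models(1)])
    then obtain d where "d \<in> univ (interpreted M I)" "d \<in> univ M"
      using univ_interpreted_subset[of M I] by blast
    then show "sat M e (Ex 0 (idom I))" using sat_idom_iff[OF wf, of "e(0 := d)"] by auto
  qed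
  show "prv (snd S) (fun_ok I fn)" if "fn \<in> fsyms (fst T)" for fn
  proof (rule wf_thy_completeness[OF \<open>wf_thy S\<close>])
    fix M :: "trm struct" and e assume model: "model M (snd S)"
    obtain f n where fn: "fn = (f, n)" by (cases fn)
    show "sat M e (fun_ok I fn)"
      unfolding fn sat_fun_ok_iff[OF wf that[unfolded fn]]
      using interpretation_in.fun_total[OF models(1)[OF model], of f] that fn by blast
  qed
  show "prv (snd S) (tr I \<phi>)" if "\<phi> \<in> snd T" for \<phi>
  proof (rule wf_thy_completeness[OF \<open>wf_thy S\<close>])
    fix M :: "trm struct" and e :: "nat \<Rightarrow> trm"
    assume model: "model M (snd S)" and "range e \<subseteq> univ M"
    interpret interpretation_in M I "fst T" "fst S" by (rule models(1)[OF model])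
    show "sat M e (tr I \<phi>)"
      using sat_tr_iff[of \<phi> e] models(2)[OF model that] that \<open>wf_thy T\<close> \<open>range e \<subseteq> univ M\<close>
      by (auto simp: wf_thy_def sentences_def)
  qed
qed

section \<open>\<open>R\<close> is not interpretable in \<open>U\<close>\<close>

datatype point = Point (colouring: "int \<Rightarrow> bool") (copy: nat) (pos: int)

definition shift :: "int \<Rightarrow> point \<Rightarrow> point" where
  "shift d a = Point (colouring a) (copy a) (pos a + d)"

definition marked :: "point \<Rightarrow> bool" where
  "marked a \<longleftrightarrow> colouring a (pos a)"

lemma shift_shift [simp]: "shift d (shift d' a) = shift (d + d') a"
  by (simp add: shift_def)

lemma shift_0 [simp]: "shift 0 a = a"
  by (simp add: shift_def)

lemma shift_eq_shift_iff: "shift d a = shift d' b \<longleftrightarrow> a = shift (d' - d) b"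
  by (cases a; cases b; auto simp: shift_def)

lemma eq_shift_iff: "a = shift d b \<longleftrightarrow> b = shift (- d) a"
  by (cases a; cases b; auto simp: shift_def)

lemma eq_shift_self_iff: "a = shift d a \<longleftrightarrow> d = 0"
  by (cases a) (simp add: shift_def)

text \<open>Disjoint lines of type \<open>int\<close>, one (in infinitely many copies) for each colouring. Every local
  pattern thus occurs on a line not used so far, so that truth is determined by colours and
  distances up to a bounded radius.\<close>

definition line_struct :: "point \<Rightarrow> point struct" where
  "line_struct z = \<lparr>univ = UNIV, fint = \<lambda>f xs. if xs = [] then z else shift 1 (hd xs),
     rint = \<lambda>r xs. marked (hd xs)\<rparr>"

lemma line_struct_sel [simp]:
  "univ (line_struct z) = UNIV"
  "fint (line_struct z) f [] = z" "fint (line_struct z) f (x # xs) = shift 1 x"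
  "rint (line_struct z) r (x # xs) = marked x"
  by (simp_all add: line_struct_def)

definition local_iso :: "int \<Rightarrow> (point \<times> point) set \<Rightarrow> bool" where
  "local_iso r Z \<longleftrightarrow> (\<forall>a a' b b' d. (a, a') \<in> Z \<longrightarrow> (b, b') \<in> Z \<longrightarrow> \<bar>d\<bar> \<le> r \<longrightarrow>
     (a = shift d b \<longleftrightarrow> a' = shift d b') \<and> (marked (shift d a) \<longleftrightarrow> marked (shift d a')))"

lemma local_iso_converse: "local_iso r (Z\<inverse>) = local_iso r Z"
  unfolding local_iso_def by fast

lemma local_iso_mono: "local_iso r Z \<Longrightarrow> Z' \<subseteq> Z \<Longrightarrow> s \<le> r \<Longrightarrow> local_iso s Z'"
  unfolding local_iso_def by (blast intro: order_trans)

lemma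
  assumes "local_iso r Z" "(a, a') \<in> Z" "\<bar>d\<bar> \<le> r"
  shows local_iso_shiftD: "(b, b') \<in> Z \<Longrightarrow> a = shift d b \<longleftrightarrow> a' = shift d b'"
    and local_iso_markedD: "marked (shift d a) \<longleftrightarrow> marked (shift d a')"
  using assms unfolding local_iso_def by blast+

lemma local_iso_insertI:
  assumes "local_iso r Z"
    and shift: "\<And>b b' d. (b, b') \<in> Z \<Longrightarrow> \<bar>d\<bar> \<le> r \<Longrightarrow> a = shift d b \<longleftrightarrow> a' = shift d b'"
    and marked: "\<And>d. \<bar>d\<bar> \<le> r \<Longrightarrow> marked (shift d a) \<longleftrightarrow> marked (shift d a')"
  shows "local_iso r (insert (a, a') Z)"
proof -
  have "b = shift d a \<longleftrightarrow> b' = shift d a'" if "(b, b') \<in> Z" "\<bar>d\<bar> \<le> r" for b b' d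
    using shift[of b b' "- d"] that eq_shift_iff by (metis abs_minus_cancel)
  then show ?thesis
    using assms unfolding local_iso_def by (auto simp: eq_shift_self_iff)
qed

lemma local_iso_extend_near:
  assumes iso: "local_iso (2 * r) Z" and "0 \<le> r" and near: "(c, c') \<in> Z" "\<bar>d\<bar> \<le> r"
  shows "local_iso r (insert (shift d c, shift d c') Z)"
proof (rule local_iso_insertI)
  show "local_iso r Z" using local_iso_mono[OF iso subset_refl] \<open>0 \<le> r\<close> by simp
  show "shift d c = shift d' b \<longleftrightarrow> shift d c' = shift d' b'" if "(b, b') \<in> Z" "\<bar>d'\<bar> \<le> r" for b b' d'
    using local_iso_shiftD[OF iso near(1) _ that(1), of "d' - d"] that(2) near(2)
    by (simp add: shift_eq_shift_iff)
  show "marked (shift d' (shift d c)) = marked (shift d' (shift d c'))" if "\<bar>d'\<bar> \<le> r" for d'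
    using local_iso_markedD[OF iso near(1), of "d' + d"] that near(2) by simp
qed

lemma local_iso_extend_far:
  assumes "local_iso r Z" "finite Z"
    and far: "\<And>b b' d. (b, b') \<in> Z \<Longrightarrow> \<bar>d\<bar> \<le> r \<Longrightarrow> a \<noteq> shift d b"
  shows "\<exists>a'. local_iso r (insert (a, a') Z)"
proof -
  obtain k where unused_copy: "k \<notin> (\<lambda>(b, b'). copy b') ` Z"
    using ex_new_if_finite[OF infinite_UNIV_nat, of "(\<lambda>(b, b'). copy b') ` Z"] assms(2) by auto
  let ?a' = "Point (\<lambda>i. marked (shift i a)) k 0"
  have "?a' \<noteq> shift d b'" if "(b, b') \<in> Z" for b b' d
  proof
    assume "?a' = shift d b'"
    then have "k = copy b'" by (simp add: shift_def)
    with unused_copy that show False by force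
  qed
  then have "local_iso r (insert (a, ?a') Z)"
    using far by (intro local_iso_insertI[OF assms(1)]) (auto simp: marked_def shift_def)
  then show ?thesis ..
qed

lemma local_iso_extend:
  assumes "local_iso (2 * r) Z" "finite Z" "0 \<le> r"
  shows "\<exists>a'. local_iso r (insert (a, a') Z)"
proof (cases "\<exists>b b' d. (b, b') \<in> Z \<and> \<bar>d\<bar> \<le> r \<and> a = shift d b")
  case True
  then show ?thesis using local_iso_extend_near[OF assms(1,3)] by blast
next
  case False
  moreover have "local_iso r Z" using local_iso_mono[OF assms(1) subset_refl] assms(3) by simp
  ultimately show ?thesis using assms(2) by (intro local_iso_extend_far) auto
qed

lemma val_line_struct:
  "trm_in L_U t \<Longrightarrow> \<exists>k\<ge>0. (\<exists>x\<in>tvars t. \<forall>e. val (line_struct z) e t = shift k (e x)) \<or>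
     (\<forall>e. val (line_struct z) e t = shift k z)"
proof (induction t)
  case (Var x)
  show ?case by (rule exI[of _ 0]) simp
next
  case (Fn f ts)
  then consider (nullary) "ts = []" | (unary) u where "ts = [u]"
    by (cases ts) (auto simp: L_U_def)
  then show ?case
  proof cases
    case nullary
    then show ?thesis by (intro exI[of _ 0]) simp
  next
    case (unary u)
    with Fn obtain k where "0 \<le> k" "(\<exists>x\<in>tvars u. \<forall>e. val (line_struct z) e u = shift k (e x)) \<or>
      (\<forall>e. val (line_struct z) e u = shift k z)" by auto
    then show ?thesis using unary by (intro exI[of _ "1 + k"]) auto
  qed
qed

definition linked :: "point \<Rightarrow> (nat \<Rightarrow> point) \<Rightarrow> (nat \<Rightarrow> point) \<Rightarrow> nat set \<Rightarrow> (point \<times> point) set" where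
  "linked z e e' V = insert (z, z) ((\<lambda>x. (e x, e' x)) ` V)"

lemma finite_linked: "finite V \<Longrightarrow> finite (linked z e e' V)"
  by (simp add: linked_def)

lemma converse_linked: "(linked z e e' V)\<inverse> = linked z e' e V"
  by (auto simp: linked_def)

lemma val_line_struct_linked:
  assumes "trm_in L_U t"
  obtains k where "0 \<le> k"
    "\<And>e e' V. tvars t \<subseteq> V \<Longrightarrow> \<exists>a a'. (a, a') \<in> linked z e e' V \<and>
       val (line_struct z) e t = shift k a \<and> val (line_struct z) e' t = shift k a'"
proof -
  obtain k where val_shift: "0 \<le> k" "(\<exists>x\<in>tvars t. \<forall>e. val (line_struct z) e t = shift k (e x)) \<or>
    (\<forall>e. val (line_struct z) e t = shift k z)" using val_line_struct[OF assms] by blast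
  then show thesis by (intro that[of k]) (auto simp: linked_def)
qed

definition local_within :: "point \<Rightarrow> int \<Rightarrow> fm \<Rightarrow> bool" where
  "local_within z r \<phi> \<longleftrightarrow> (\<forall>e e'. local_iso r (linked z e e' (fv \<phi>)) \<longrightarrow>
     sat (line_struct z) e \<phi> = sat (line_struct z) e' \<phi>)"

lemma local_within_Eq:
  assumes "trm_in L_U s" "trm_in L_U t"
  shows "\<exists>r\<ge>0. local_within z r (Eq s t)"
proof -
  let ?val = "val (line_struct z)" and ?Z = "\<lambda>e e'. linked z e e' (fv (Eq s t))"
  obtain k where "0 \<le> k" and val_s: "\<And>e e'. \<exists>a a'. (a, a') \<in> ?Z e e' \<and>
      ?val e s = shift k a \<and> ?val e' s = shift k a'"
    using val_line_struct_linked[OF assms(1), of z] by (metis fv.simps(2) sup_ge1)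
  obtain l where "0 \<le> l" and val_t: "\<And>e e'. \<exists>b b'. (b, b') \<in> ?Z e e' \<and>
      ?val e t = shift l b \<and> ?val e' t = shift l b'"
    using val_line_struct_linked[OF assms(2), of z] by (metis fv.simps(2) sup_ge2)
  have "?val e s = ?val e t \<longleftrightarrow> ?val e' s = ?val e' t" if iso: "local_iso (k + l) (?Z e e')" for e e'
  proof -
    obtain a a' where linked_s: "(a, a') \<in> ?Z e e'" "?val e s = shift k a" "?val e' s = shift k a'"
      using val_s by blast
    obtain b b' where linked_t: "(b, b') \<in> ?Z e e'" "?val e t = shift l b" "?val e' t = shift l b'"
      using val_t by blast
    show ?thesis
      using local_iso_shiftD[OF iso linked_s(1) _ linked_t(1), of "l - k"] \<open>0 \<le> k\<close> \<open>0 \<le> l\<close>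
      by (simp add: linked_s linked_t shift_eq_shift_iff)
  qed
  then show ?thesis
    using \<open>0 \<le> k\<close> \<open>0 \<le> l\<close> by (intro exI[of _ "k + l"]) (simp add: local_within_def)
qed

lemma local_within_Rel:
  assumes "fm_in L_U (Rel r ts)"
  shows "\<exists>r'\<ge>0. local_within z r' (Rel r ts)"
proof -
  obtain t where unary: "ts = [t]" "trm_in L_U t"
    using assms by (auto simp: L_U_def length_Suc_conv)
  let ?val = "val (line_struct z)" and ?Z = "\<lambda>e e'. linked z e e' (tvars t)"
  obtain k where "0 \<le> k" and val: "\<And>e e'. \<exists>a a'. (a, a') \<in> ?Z e e' \<and>
      ?val e t = shift k a \<and> ?val e' t = shift k a'"
    using val_line_struct_linked[OF unary(2), of z] by (metis subset_refl)
  have "marked (?val e t) \<longleftrightarrow> marked (?val e' t)" if "local_iso k (?Z e e')" for e e'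
    using val[of e e'] local_iso_markedD[OF that, of _ _ k] \<open>0 \<le> k\<close> by auto
  then show ?thesis
    using \<open>0 \<le> k\<close> by (intro exI[of _ k]) (simp add: local_within_def unary(1))
qed

lemma local_within_Imp:
  assumes "local_within z r \<phi>" "local_within z s \<psi>"
  shows "local_within z (max r s) (Imp \<phi> \<psi>)"
  unfolding local_within_def
proof (intro allI impI)
  fix e e' assume iso: "local_iso (max r s) (linked z e e' (fv (Imp \<phi> \<psi>)))"
  have "local_iso r (linked z e e' (fv \<phi>))" "local_iso s (linked z e e' (fv \<psi>))"
    by (rule local_iso_mono[OF iso]; auto simp: linked_def)+
  then show "sat (line_struct z) e (Imp \<phi> \<psi>) = sat (line_struct z) e' (Imp \<phi> \<psi>)"
    using assms by (simp add: local_within_def)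
qed

lemma local_within_All:
  assumes local: "local_within z r \<phi>" and "0 \<le> r"
  shows "local_within z (2 * r) (All x \<phi>)"
proof -
  let ?M = "line_struct z"
  have transfer: "sat ?M e' (All x \<phi>)"
    if iso: "local_iso (2 * r) (linked z e' e (fv (All x \<phi>)))" and "sat ?M e (All x \<phi>)" for e e'
    unfolding sat.simps
  proof
    fix b
    obtain a where "local_iso r (insert (b, a) (linked z e' e (fv (All x \<phi>))))"
      using local_iso_extend[OF iso finite_linked[OF finite_fv] \<open>0 \<le> r\<close>] by blast
    then have "local_iso r (linked z (e'(x := b)) (e(x := a)) (fv \<phi>))"
      by (rule local_iso_mono) (auto simp: linked_def)
    then have "sat ?M (e'(x := b)) \<phi> = sat ?M (e(x := a)) \<phi>" using local by (simp add: local_within_def)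
    then show "sat ?M (e'(x := b)) \<phi>" using \<open>sat ?M e (All x \<phi>)\<close> by simp
  qed
  show ?thesis
    unfolding local_within_def
    using transfer local_iso_converse converse_linked by metis
qed

theorem locality: "fm_in L_U \<phi> \<Longrightarrow> \<exists>r\<ge>0. local_within z r \<phi>"
proof (induction \<phi>)
  case Bot
  show ?case by (auto simp: local_within_def)
next
  case (Eq s t)
  then show ?case by (simp add: local_within_Eq)
next
  case (Rel r ts)
  then show ?case by (rule local_within_Rel)
next
  case (Imp \<phi> \<psi>)
  then obtain r s where "0 \<le> r" "local_within z r \<phi>" "0 \<le> s" "local_within z s \<psi>" by auto
  then show ?case using local_within_Imp by (intro exI[of _ "max r s"]) auto
next
  case (All x \<phi>)
  then obtain r where "0 \<le> r" "local_within z r \<phi>" by auto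
  then show ?case using local_within_All by (intro exI[of _ "2 * r"]) auto
qed

definition nearby :: "int \<Rightarrow> point \<Rightarrow> point set" where
  "nearby r a = (\<lambda>d. shift d a) ` {- r..r}"

lemma notin_nearbyD: "a \<notin> nearby r b \<Longrightarrow> \<bar>d\<bar> \<le> r \<Longrightarrow> a \<noteq> shift d b \<and> b \<noteq> shift d a"
  unfolding nearby_def
  by (metis abs_le_iff abs_minus_cancel atLeastAtMost_iff eq_shift_iff image_eqI minus_le_iff)

lemma finite_vimage_nearby: "inj c \<Longrightarrow> finite {n. c n \<in> nearby r a}"
  using finite_vimageI[of "nearby r a" c] by (simp add: nearby_def vimage_def)

lemma exchangeable_pair_exists:
  assumes "inj (c :: nat \<Rightarrow> point)" "0 \<le> r"
  obtains m n where "m \<noteq> n" "local_iso r {(z, z), (c m, c n), (c n, c m)}"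
proof -
  define far where "far = - {n. c n \<in> nearby r z}"
  define pattern where "pattern n = {d \<in> {-r..r}. marked (shift d (c n))}" for n
  have "infinite far"
    using finite_vimage_nearby[OF assms(1)] infinite_UNIV_nat 
    by (simp add: far_def Compl_eq_Diff_UNIV Diff_infinite_finite)
  moreover have "finite (pattern ` far)"
    by (rule finite_subset[of _ "Pow {-r..r}"]) (auto simp: pattern_def)
  ultimately obtain m where m_far: "m \<in> far" "infinite {n \<in> far. pattern n = pattern m}"
    using pigeonhole_infinite by blast
  then have "infinite ({n \<in> far. pattern n = pattern m} - {n. c n \<in> nearby r (c m)})"
    using finite_vimage_nearby[OF assms(1)] by (simp add: Diff_infinite_finite)
  then have "{n \<in> far. pattern n = pattern m} - {n. c n \<in> nearby r (c m)} \<noteq> {}"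
    using finite.emptyI by metis
  then obtain n where n_far: "n \<in> far" "pattern n = pattern m" "c n \<notin> nearby r (c m)" by blast
  have marked_iff: "marked (shift d (c m)) \<longleftrightarrow> marked (shift d (c n))" if "\<bar>d\<bar> \<le> r" for d
  proof -
    have "d \<in> pattern m \<longleftrightarrow> d \<in> pattern n" using n_far(2) by simp
    then show ?thesis using that by (auto simp: pattern_def abs_le_iff)
  qed
  show thesis
  proof (rule that)
    show "m \<noteq> n" using n_far(3) assms(2) by (auto simp: nearby_def intro!: image_eqI[of _ _ 0])
    show "local_iso r {(z, z), (c m, c n), (c n, c m)}"
      unfolding local_iso_def
      using marked_iff notin_nearbyD[OF n_far(3)] notin_nearbyD[of "c m" r z]
        notin_nearbyD[of "c n" r z] m_far(1) n_far(1)
      by (auto simp: far_def eq_shift_self_iff)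
  qed
qed

theorem no_definable_chain:
  assumes formula: "fm_in L_U \<psi>" "fv \<psi> \<subseteq> {..<2}" and "inj (c :: nat \<Rightarrow> point)"
  shows "\<exists>m n. sat (line_struct z) (env [c m, c n]) \<psi> \<noteq> (m \<le> n)"
proof (rule ccontr)
  assume "\<nexists>m n. sat (line_struct z) (env [c m, c n]) \<psi> \<noteq> (m \<le> n)"
  then have chain: "sat (line_struct z) (env [c m, c n]) \<psi> \<longleftrightarrow> m \<le> n" for m n by blast
  obtain r where "0 \<le> r" and local: "local_within z r \<psi>" using locality[OF formula(1)] by blast
  obtain m n where "m \<noteq> n" and iso: "local_iso r {(z, z), (c m, c n), (c n, c m)}"
    by (rule exchangeable_pair_exists[OF assms(3) \<open>0 \<le> r\<close>])
  have "local_iso r (linked z (env [c m, c n]) (env [c n, c m]) (fv \<psi>))"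
    by (rule local_iso_mono[OF iso])
      (use formula(2) in \<open>auto simp: linked_def env_def nth_Cons split: nat.splits\<close>)
  then have "m \<le> n \<longleftrightarrow> n \<le> m" using local chain unfolding local_within_def by blast
  with \<open>m \<noteq> n\<close> show False by presburger
qed

definition num_val :: "'a struct \<Rightarrow> nat \<Rightarrow> 'a" where
  "num_val M n = val M undefined (num n)"

lemma tvars_num [simp]: "tvars (num n) = {}"
  by (induction n) auto

lemma val_num: "val M e (num n) = num_val M n"
  unfolding num_val_def by (rule val_cong) simp

lemma trm_in_num: "(0, 0) \<in> fsyms L \<Longrightarrow> (1, 1) \<in> fsyms L \<Longrightarrow> trm_in L (num n)"
  by (induction n) auto

lemma wf_thy_U: "wf_thy (U_thy A B)"
proof -
  have "trm_in L_U (num n)" for n by (rule trm_in_num) (simp_all add: L_U_def)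
  then show ?thesis by (auto simp: wf_thy_def U_thy_def sentences_def) (simp_all add: L_U_def)
qed

lemma wf_thy_R: "wf_thy R_thy"
proof -
  have num: "trm_in L_R (num n)" for n by (rule trm_in_num) (simp_all add: L_R_def)
  have disjs: "fm_in L_R (disjs \<phi>s) \<longleftrightarrow> (\<forall>\<phi>\<in>set \<phi>s. fm_in L_R \<phi>)"
    "fv (disjs \<phi>s) = (\<Union>\<phi>\<in>set \<phi>s. fv \<phi>)" for \<phi>s
    by (induction \<phi>s) (auto simp: disjs_def)
  show ?thesis
    by (auto simp: wf_thy_def R_thy_def sentences_def plus_def times_def leq_def num disjs
        simp del: upt_Suc) (simp_all add: L_R_def)
qed

locale R_structure =
  fixes M :: "'a struct"
  assumes R_axiom: "\<phi> \<in> snd R_thy \<Longrightarrow> sat M e \<phi>"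
    and num_val_in_univ: "num_val M n \<in> univ M"
begin

lemma num_val_inject: "num_val M m = num_val M n \<longleftrightarrow> m = n"
proof
  assume "num_val M m = num_val M n"
  then have "\<not> sat M e (Neg (Eq (num m) (num n)))" for e by (simp add: val_num)
  moreover have "sat M e (Neg (Eq (num m) (num n)))" if "m \<noteq> n" for e
    using that by (intro R_axiom) (auto simp: R_thy_def)
  ultimately show "m = n" by blast
qed simp

lemma leq_num_valD:
  assumes "rint M 1 [d, num_val M n]" "d \<in> univ M"
  obtains i where "i \<le> n" "d = num_val M i"
proof -
  have "sat M undefined (All 0 (Imp (leq (Var 0) (num n))
      (disjs (map (\<lambda>i. Eq (Var 0) (num i)) [0..<Suc n]))))"
    by (intro R_axiom) (auto simp: R_thy_def)
  then have "\<exists>\<phi>\<in>set (map (\<lambda>i. Eq (Var 0) (num i)) [0..<Suc n]). sat M (undefined(0 := d)) \<phi>"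
    using assms unfolding sat.simps sat_disjs by (auto simp: leq_def val_num simp del: upt_Suc)
  then show thesis using that by (auto simp: val_num less_Suc_eq_le simp del: upt_Suc)
qed

lemma leq_num_val_total:
  assumes "d \<in> univ M"
  shows "rint M 1 [d, num_val M n] \<or> rint M 1 [num_val M n, d]"
proof -
  have "sat M undefined (All 0 (Or (leq (Var 0) (num n)) (leq (num n) (Var 0))))"
    by (intro R_axiom) (auto simp: R_thy_def)
  then show ?thesis using assms by (simp add: leq_def val_num)
qed

lemma leq_num_val_iff: "rint M 1 [num_val M m, num_val M n] \<longleftrightarrow> m \<le> n"
proof -
  have imp_le: "m \<le> n" if "rint M 1 [num_val M m, num_val M n]" for m n
    using leq_num_valD[OF that num_val_in_univ] num_val_inject by metis
  moreover have "rint M 1 [num_val M n, num_val M n]" for n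
    using leq_num_val_total[OF num_val_in_univ] by blast
  ultimately show ?thesis
    using leq_num_val_total[OF num_val_in_univ, of m n] by (metis le_antisym)
qed

lemma fint_num_val:
  "fint M 0 [] = num_val M 0"
  "fint M 1 [num_val M n] = num_val M (Suc n)"
  "fint M 2 [num_val M m, num_val M n] = num_val M (m + n)"
  "fint M 3 [num_val M m, num_val M n] = num_val M (m * n)"
proof -
  show "fint M 0 [] = num_val M 0" "fint M 1 [num_val M n] = num_val M (Suc n)"
    by (simp_all add: num_val_def)
  have "sat M undefined (Eq (plus (num m) (num n)) (num (m + n)))"
    "sat M undefined (Eq (times (num m) (num n)) (num (m * n)))"
    by (rule R_axiom, force simp: R_thy_def)+
  then show "fint M 2 [num_val M m, num_val M n] = num_val M (m + n)"
    "fint M 3 [num_val M m, num_val M n] = num_val M (m * n)"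
    by (simp_all add: plus_def times_def val_num)
qed

end

lemma (in interpretation_in) num_val_interpreted_in_univ:
  assumes "(0, 0) \<in> fsyms L" "(1, 1) \<in> fsyms L"
  shows "num_val N n \<in> univ N"
  unfolding num_val_def by (intro val_in_univ trm_in_num assms) simp

lemma R_structure_interpreted:
  assumes interp: "is_interpretation I R_thy S" and model: "model M (snd S)"
  shows "R_structure (interpreted M I)"
proof -
  interpret interpretation_in M I L_R "fst S"
    using is_interpretation_interpretation_in[OF interp model] by (simp add: R_thy_def)
  show ?thesis
  proof
    show "sat N e \<phi>" if "\<phi> \<in> snd R_thy" for e \<phi>
      by (rule is_interpretation_sat[OF interp model wf_thy_R that])
    show "num_val N n \<in> univ N" for n
      by (rule num_val_interpreted_in_univ) (simp_all add: L_R_def)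
  qed
qed

lemma model_line_struct:
  assumes "A \<inter> B = {}"
  shows "model (line_struct (Point (\<lambda>i. 0 \<le> i \<and> nat i \<in> A) 0 0)) (snd (U_thy A B))"
proof -
  define z where "z = Point (\<lambda>i. 0 \<le> i \<and> nat i \<in> A) 0 0"
  have val: "val (line_struct z) e (num n) = shift (int n) z" for e n
    by (induction n) simp_all
  have "shift (int m) z = shift (int n) z \<longleftrightarrow> m = n" "marked (shift (int n) z) \<longleftrightarrow> n \<in> A" for m n
    by (simp_all add: shift_def marked_def z_def)
  then have "model (line_struct z) (snd (U_thy A B))"
    using assms by (auto simp: model_def U_thy_def val)
  then show ?thesis unfolding z_def .
qed

theorem R_not_interpretable_in_U:
  assumes "A \<inter> B = {}"
  shows "\<not> interpretable R_thy (U_thy A B)"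
proof
  assume "interpretable R_thy (U_thy A B)"
  then obtain I where interp: "is_interpretation I R_thy (U_thy A B)" by (auto simp: interpretable_def)
  obtain z where model: "model (line_struct z) (snd (U_thy A B))" using model_line_struct[OF assms] ..
  interpret R_structure "interpreted (line_struct z) I"
    by (rule R_structure_interpreted[OF interp model])
  let ?c = "num_val (interpreted (line_struct z) I)"
  have "fm_in L_U (irel I (1, 2))" "fv (irel I (1, 2)) \<subseteq> {..<2}"
    using interp by (auto simp: is_interpretation_def R_thy_def L_R_def U_thy_def)
  moreover have "inj ?c" by (rule injI) (simp add: num_val_inject)
  ultimately obtain m n where "sat (line_struct z) (env [?c m, ?c n]) (irel I (1, 2)) \<noteq> (m \<le> n)"
    using no_definable_chain by blast
  then show False using leq_num_val_iff[of m n] by (simp add: rint_interpreted numeral_2_eq_2)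
qed

section \<open>Predicates definable by existentially quantified bounded formulas\<close>

text \<open>Predicates on assignments, with de Bruijn indexing: a quantifier binds index 0 of
  the extended assignment \<open>case_nat v e\<close>.\<close>

inductive delta0 :: "((nat \<Rightarrow> nat) \<Rightarrow> bool) \<Rightarrow> bool" where
  delta0_eq: "delta0 (\<lambda>e. e i = e j)"
| delta0_zero: "delta0 (\<lambda>e. e i = 0)"
| delta0_Suc: "delta0 (\<lambda>e. e i = Suc (e j))"
| delta0_add: "delta0 (\<lambda>e. e i = e j + e k)"
| delta0_mult: "delta0 (\<lambda>e. e i = e j * e k)"
| delta0_False: "delta0 (\<lambda>e. False)"
| delta0_imp: "delta0 P \<Longrightarrow> delta0 Q \<Longrightarrow> delta0 (\<lambda>e. P e \<longrightarrow> Q e)"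
| delta0_ball: "delta0 P \<Longrightarrow> delta0 (\<lambda>e. \<forall>v\<le>e i. P (case_nat v e))"

lemma delta0_not: "delta0 P \<Longrightarrow> delta0 (\<lambda>e. \<not> P e)"
  using delta0_imp[OF _ delta0_False] by simp

lemma delta0_disj: "delta0 P \<Longrightarrow> delta0 Q \<Longrightarrow> delta0 (\<lambda>e. P e \<or> Q e)"
  unfolding disj_imp by (rule delta0_imp[OF delta0_not])

lemma delta0_conj: "delta0 P \<Longrightarrow> delta0 Q \<Longrightarrow> delta0 (\<lambda>e. P e \<and> Q e)"
  using delta0_not[OF delta0_imp[OF _ delta0_not, of P Q]] by simp

lemma fun_case_nat: "(\<lambda>i. f (case_nat a g i)) = case_nat (f a) (\<lambda>i. f (g i))"
  by (auto simp: fun_eq_iff split: nat.splits)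

lemma delta0_reindex: "delta0 P \<Longrightarrow> delta0 (\<lambda>e. P (\<lambda>i. e (\<rho> i)))"
proof (induction arbitrary: \<rho> rule: delta0.induct)
  case (delta0_ball P i)
  then show ?case
    using delta0.delta0_ball[OF delta0_ball.IH[of "case_nat 0 (\<lambda>i. Suc (\<rho> i))"], of "\<rho> i"]
    by (simp add: fun_case_nat[of "case_nat _ _"])
qed (auto intro: delta0.intros)

lemma delta0_bex_reindex:
  "delta0 P \<Longrightarrow> delta0 (\<lambda>e. \<exists>v\<le>e i. P (\<lambda>j. case_nat v e (\<rho> j)))"
  using delta0_not[OF delta0_ball[OF delta0_not[OF delta0_reindex[of P \<rho>]]]] by simp

definition sigma1 :: "((nat \<Rightarrow> nat) \<Rightarrow> bool) \<Rightarrow> bool" where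
  "sigma1 P \<longleftrightarrow> (\<exists>Q. delta0 Q \<and> (\<forall>e. P e \<longleftrightarrow> (\<exists>v. Q (case_nat v e))))"

lemma sigma1I: "delta0 Q \<Longrightarrow> (\<And>e. P e \<longleftrightarrow> (\<exists>v. Q (case_nat v e))) \<Longrightarrow> sigma1 P"
  by (auto simp: sigma1_def)

lemma sigma1_delta0: "delta0 P \<Longrightarrow> sigma1 P"
  by (rule sigma1I[OF delta0_reindex[where \<rho> = Suc]]) auto

lemma sigma1_reindex:
  assumes "sigma1 P"
  shows "sigma1 (\<lambda>e. P (\<lambda>i. e (\<rho> i)))"
proof -
  obtain Q where delta0_Q: "delta0 Q" and P_iff: "\<And>e. P e \<longleftrightarrow> (\<exists>v. Q (case_nat v e))"
    using assms by (auto simp: sigma1_def)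
  show ?thesis
    by (rule sigma1I[OF delta0_reindex[OF delta0_Q, of "case_nat 0 (\<lambda>i. Suc (\<rho> i))"]])
      (simp add: P_iff fun_case_nat[of "case_nat _ _"])
qed

lemma sigma1_conj:
  assumes "sigma1 P" "sigma1 P'"
  shows "sigma1 (\<lambda>e. P e \<and> P' e)"
proof -
  obtain Q where delta0_Q: "delta0 Q" and P_iff: "\<And>e. P e \<longleftrightarrow> (\<exists>v. Q (case_nat v e))"
    using assms(1) by (auto simp: sigma1_def)
  obtain Q' where delta0_Q': "delta0 Q'" and P'_iff: "\<And>e. P' e \<longleftrightarrow> (\<exists>v. Q' (case_nat v e))"
    using assms(2) by (auto simp: sigma1_def)
  let ?\<rho> = "case_nat 0 (\<lambda>i. Suc (Suc i))"
  have common_bound: "(\<exists>v. A v) \<and> (\<exists>v. B v) \<longleftrightarrow> (\<exists>u. (\<exists>v\<le>u. A v) \<and> (\<exists>v\<le>u. B v))" for A B :: "nat \<Rightarrow> bool"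
    by (metis max.cobounded1 max.cobounded2)
  have "delta0 (\<lambda>e. (\<exists>v\<le>e 0. Q (\<lambda>j. case_nat v e (?\<rho> j))) \<and> (\<exists>v\<le>e 0. Q' (\<lambda>j. case_nat v e (?\<rho> j))))"
    by (intro delta0_conj delta0_bex_reindex delta0_Q delta0_Q')
  then show ?thesis
    by (rule sigma1I) (simp add: P_iff P'_iff fun_case_nat[of "case_nat _ _"], rule common_bound)
qed

lemma sigma1_disj:
  assumes "sigma1 P" "sigma1 P'"
  shows "sigma1 (\<lambda>e. P e \<or> P' e)"
proof -
  obtain Q where delta0_Q: "delta0 Q" and P_iff: "\<And>e. P e \<longleftrightarrow> (\<exists>v. Q (case_nat v e))"
    using assms(1) by (auto simp: sigma1_def)
  obtain Q' where delta0_Q': "delta0 Q'" and P'_iff: "\<And>e. P' e \<longleftrightarrow> (\<exists>v. Q' (case_nat v e))"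
    using assms(2) by (auto simp: sigma1_def)
  show ?thesis
    by (rule sigma1I[OF delta0_disj[OF delta0_Q delta0_Q']]) (auto simp: P_iff P'_iff)
qed

lemma sigma1_ex:
  assumes "sigma1 (\<lambda>e. P (e 0) (\<lambda>i. e (Suc i)))"
  shows "sigma1 (\<lambda>e. \<exists>v. P v e)"
proof -
  obtain Q where delta0_Q: "delta0 Q"
    and body_iff: "\<And>e. P (e 0) (\<lambda>i. e (Suc i)) \<longleftrightarrow> (\<exists>w. Q (case_nat w e))"
    using assms by (auto simp: sigma1_def)
  have P_iff: "P v e \<longleftrightarrow> (\<exists>w. Q (case_nat w (case_nat v e)))" for v e
    using body_iff[of "case_nat v e"] by simp
  have common_bound: "(\<exists>v w. A v w) \<longleftrightarrow> (\<exists>u. \<exists>v\<le>u. \<exists>w\<le>u. A v w)" for A :: "nat \<Rightarrow> nat \<Rightarrow> bool"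
    by (metis max.cobounded1 max.cobounded2)
  have "delta0 (\<lambda>e. \<exists>v\<le>e 0. \<exists>w\<le>e 0. Q (case_nat w (case_nat v (\<lambda>i. e (Suc i)))))"
    using delta0_bex_reindex[OF delta0_bex_reindex[OF delta0_Q, of 1
        "case_nat 0 (case_nat 1 (\<lambda>i. Suc (Suc (Suc i))))"], of 0 id]
    by (simp add: fun_case_nat[of "case_nat _ _"])
  then show ?thesis
    by (rule sigma1I) (simp add: P_iff, rule common_bound)
qed

lemma bounded_collection:
  "(\<forall>v<n. \<exists>w. A v w) \<longleftrightarrow> (\<exists>u :: nat. \<forall>v<n :: nat. \<exists>w\<le>u. A v w)"
proof
  assume "\<forall>v<n. \<exists>w. A v w"
  then obtain f where f_witness: "\<And>v. v < n \<Longrightarrow> A v (f v)" by metis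
  have "f v \<le> (\<Sum>v<n. f v)" if "v < n" for v using that by (intro member_le_sum) auto
  with f_witness show "\<exists>u. \<forall>v<n. \<exists>w\<le>u. A v w" by blast
qed blast

lemma sigma1_ball_var:
  assumes "sigma1 (\<lambda>e. P (e 0) (\<lambda>i. e (Suc i)))"
  shows "sigma1 (\<lambda>e. \<forall>v<e j. P v e)"
proof -
  obtain Q where delta0_Q: "delta0 Q"
    and body_iff: "\<And>e. P (e 0) (\<lambda>i. e (Suc i)) \<longleftrightarrow> (\<exists>w. Q (case_nat w e))"
    using assms by (auto simp: sigma1_def)
  have P_iff: "P v e \<longleftrightarrow> (\<exists>w. Q (case_nat w (case_nat v e)))" for v e
    using body_iff[of "case_nat v e"] by simp
  have bounded: "delta0 (\<lambda>e. \<forall>v\<le>e (Suc j). v = e (Suc j) \<or>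
      (\<exists>w\<le>e 0. Q (case_nat w (case_nat v (\<lambda>i. e (Suc i))))))"
    using delta0_ball[OF delta0_disj[OF delta0_eq[of 0 "Suc (Suc j)"] delta0_bex_reindex[OF delta0_Q,
        of 1 "case_nat 0 (case_nat 1 (\<lambda>i. Suc (Suc (Suc i))))"]], of "Suc j"]
    by (simp add: fun_case_nat[of "case_nat _ _"])
  have "(\<forall>v<n. P v e) \<longleftrightarrow> (\<exists>u. \<forall>v\<le>n. v = n \<or> (\<exists>w\<le>u. Q (case_nat w (case_nat v e))))" for n e
    using bounded_collection[of n "\<lambda>v w. Q (case_nat w (case_nat v e))"] by (simp add: P_iff le_less)
  then show ?thesis by (intro sigma1I[OF bounded]) simp
qed

definition sigma1_fun :: "((nat \<Rightarrow> nat) \<Rightarrow> nat) \<Rightarrow> bool" where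
  "sigma1_fun t \<longleftrightarrow> sigma1 (\<lambda>e. e 0 = t (\<lambda>i. e (Suc i)))"

lemma sigma1_fun_reindex: "sigma1_fun t \<Longrightarrow> sigma1_fun (\<lambda>e. t (\<lambda>i. e (\<rho> i)))"
  unfolding sigma1_fun_def by (drule sigma1_reindex[where \<rho> = "case_nat 0 (\<lambda>i. Suc (\<rho> i))"]) simp

lemma sigma1_fun_var: "sigma1_fun (\<lambda>e. e i)"
  unfolding sigma1_fun_def by (rule sigma1_delta0[OF delta0_eq])

lemma sigma1_subst:
  assumes "sigma1_fun t" "sigma1 (\<lambda>e. P (e 0) (\<lambda>i. e (Suc i)))"
  shows "sigma1 (\<lambda>e. P (t e) e)"
proof -
  have "sigma1 (\<lambda>e. \<exists>v. v = t e \<and> P v e)"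
    by (intro sigma1_ex sigma1_conj assms(2) assms(1)[unfolded sigma1_fun_def])
  then show ?thesis by simp
qed

lemma foldr_case_nat:
  "foldr case_nat xs e i = (if i < length xs then xs ! i else e (i - length xs))"
  by (induction xs arbitrary: i) (auto split: nat.splits)

lemma case_nat_eta: "case_nat (e 0) (\<lambda>i. e (Suc i)) = e"
  by (auto simp: fun_eq_iff split: nat.splits)

lemma sigma1_substs:
  "sigma1 P \<Longrightarrow> \<forall>t\<in>set ts. sigma1_fun t \<Longrightarrow> sigma1 (\<lambda>e. P (foldr case_nat (map (\<lambda>t. t e) ts) e))"
proof (induction ts arbitrary: P)
  case (Cons t ts)
  have "sigma1_fun (\<lambda>e. t (\<lambda>i. e (i + length ts)))"
    by (rule sigma1_fun_reindex) (use Cons.prems(2) in simp)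
  then have "sigma1 (\<lambda>e. P (case_nat (t (\<lambda>i. e (i + length ts))) e))"
    using sigma1_subst[of _ "\<lambda>v e. P (case_nat v e)"] Cons.prems(1) by (simp add: case_nat_eta)
  then have "sigma1 (\<lambda>e. P (case_nat (t (\<lambda>i. foldr case_nat (map (\<lambda>t. t e) ts) e (i + length ts)))
      (foldr case_nat (map (\<lambda>t. t e) ts) e)))"
    using Cons.IH Cons.prems(2) by simp
  then show ?case by (simp add: foldr_case_nat)
qed simp

lemma sigma1_subst1:
  "sigma1 (\<lambda>e. P (e 0)) \<Longrightarrow> sigma1_fun t \<Longrightarrow> sigma1 (\<lambda>e. P (t e))"
  using sigma1_substs[of "\<lambda>e. P (e 0)" "[t]"] by simp

lemma sigma1_subst2:
  "sigma1 (\<lambda>e. P (e 0) (e 1)) \<Longrightarrow> sigma1_fun t \<Longrightarrow> sigma1_fun u \<Longrightarrow> sigma1 (\<lambda>e. P (t e) (u e))"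
  using sigma1_substs[of "\<lambda>e. P (e 0) (e 1)" "[t, u]"] by simp

lemma sigma1_subst3:
  "sigma1 (\<lambda>e. P (e 0) (e 1) (e 2)) \<Longrightarrow> sigma1_fun t \<Longrightarrow> sigma1_fun u \<Longrightarrow> sigma1_fun s \<Longrightarrow>
    sigma1 (\<lambda>e. P (t e) (u e) (s e))"
  using sigma1_substs[of "\<lambda>e. P (e 0) (e 1) (e 2)" "[t, u, s]"] by (simp add: numeral_2_eq_2)

lemma sigma1_fun_comp1:
  assumes "sigma1 (\<lambda>e. e 0 = f (e 1))" "sigma1_fun t"
  shows "sigma1_fun (\<lambda>e. f (t e))"
  unfolding sigma1_fun_def
  by (rule sigma1_subst2[OF assms(1) sigma1_fun_var sigma1_fun_reindex[OF assms(2)]])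

lemma sigma1_fun_comp2:
  assumes "sigma1 (\<lambda>e. e 0 = f (e 1) (e 2))" "sigma1_fun t" "sigma1_fun u"
  shows "sigma1_fun (\<lambda>e. f (t e) (u e))"
  unfolding sigma1_fun_def
  by (rule sigma1_subst3[OF assms(1) sigma1_fun_var assms(2,3)[THEN sigma1_fun_reindex]])

lemma sigma1_fun_Suc: "sigma1_fun t \<Longrightarrow> sigma1_fun (\<lambda>e. Suc (t e))"
  by (rule sigma1_fun_comp1[OF sigma1_delta0[OF delta0_Suc]])

lemma sigma1_fun_add: "sigma1_fun t \<Longrightarrow> sigma1_fun u \<Longrightarrow> sigma1_fun (\<lambda>e. t e + u e)"
  by (rule sigma1_fun_comp2[where f = "(+)", OF sigma1_delta0[OF delta0_add]])

lemma sigma1_fun_mult: "sigma1_fun t \<Longrightarrow> sigma1_fun u \<Longrightarrow> sigma1_fun (\<lambda>e. t e * u e)"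
  by (rule sigma1_fun_comp2[where f = "(*)", OF sigma1_delta0[OF delta0_mult]])

lemma sigma1_fun_const: "sigma1_fun (\<lambda>e. c)"
proof (induction c)
  case 0
  show ?case unfolding sigma1_fun_def by (rule sigma1_delta0[OF delta0_zero])
qed (rule sigma1_fun_Suc)

lemma sigma1_eq: "sigma1_fun t \<Longrightarrow> sigma1_fun u \<Longrightarrow> sigma1 (\<lambda>e. t e = u e)"
  by (rule sigma1_subst2[where P = "(=)", OF sigma1_delta0[OF delta0_eq]])

lemma sigma1_le:
  assumes "sigma1_fun t" "sigma1_fun u"
  shows "sigma1 (\<lambda>e. t e \<le> u e)"
proof -
  have "sigma1 (\<lambda>e. \<exists>k. u e = t e + k)"
    by (intro sigma1_ex sigma1_eq sigma1_fun_add sigma1_fun_var assms[THEN sigma1_fun_reindex])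
  then show ?thesis by (simp add: le_iff_add)
qed

lemma sigma1_less: "sigma1_fun t \<Longrightarrow> sigma1_fun u \<Longrightarrow> sigma1 (\<lambda>e. t e < u e)"
  using sigma1_le[OF sigma1_fun_Suc, of t u] by (simp add: Suc_le_eq)

lemma sigma1_neq: "sigma1_fun t \<Longrightarrow> sigma1_fun u \<Longrightarrow> sigma1 (\<lambda>e. t e \<noteq> u e)"
  using sigma1_disj[OF sigma1_less sigma1_less, of t u u t] by (simp add: neq_iff)

lemma sigma1_ball:
  assumes "sigma1_fun t" "sigma1 (\<lambda>e. P (e 0) (\<lambda>i. e (Suc i)))"
  shows "sigma1 (\<lambda>e. \<forall>v<t e. P v e)"
proof (rule sigma1_subst[OF assms(1), of "\<lambda>b e. \<forall>v<b. P v e"])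
  have "sigma1 (\<lambda>e. P (e 0) (\<lambda>i. e (Suc (Suc i))))"
    using sigma1_reindex[OF assms(2), of "case_nat 0 (\<lambda>i. Suc (Suc i))"] by simp
  then show "sigma1 (\<lambda>e. \<forall>v<e 0. P v (\<lambda>i. e (Suc i)))"
    by (rule sigma1_ball_var[of "\<lambda>v e. P v (\<lambda>i. e (Suc i))"])
qed

lemma sigma1_fun_prod_encode:
  assumes "sigma1_fun t" "sigma1_fun u"
  shows "sigma1_fun (\<lambda>e. prod_encode (t e, u e))"
proof (rule sigma1_fun_comp2[OF _ assms])
  have double_triangle: "2 * triangle s = s * Suc s" for s by (simp add: triangle_def)
  have "p = prod_encode (a, b) \<longleftrightarrow> p + p = (a + b) * Suc (a + b) + (a + a)" for p a b
    unfolding prod_encode_def using double_triangle[of "a + b"] by auto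
  then show "sigma1 (\<lambda>e. e 0 = prod_encode (e 1, e 2))"
    by (simp only:)
      (intro sigma1_eq sigma1_fun_add sigma1_fun_mult sigma1_fun_Suc sigma1_fun_var)
qed

lemmas sigma1_intros =
  sigma1_ex sigma1_conj sigma1_disj sigma1_ball sigma1_eq sigma1_neq sigma1_less sigma1_le
  sigma1_fun_Suc sigma1_fun_add sigma1_fun_mult sigma1_fun_prod_encode sigma1_fun_const sigma1_fun_var

subsection \<open>Coding of sequences and inductive definitions\<close>

definition beta :: "nat \<Rightarrow> nat \<Rightarrow> nat \<Rightarrow> nat" where
  "beta c d i = c mod Suc (Suc i * d)"

lemma sigma1_fun_beta:
  assumes "sigma1_fun t" "sigma1_fun u" "sigma1_fun s"
  shows "sigma1_fun (\<lambda>e. beta (t e) (u e) (s e))"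
proof -
  have "v = c mod m \<longleftrightarrow> v < m \<and> (\<exists>q. c = q * m + v)" if "0 < m" for v c m :: nat
    using that by (metis div_mult_mod_eq mod_less mod_less_divisor mod_mult_self3)
  then have "v = beta c d i \<longleftrightarrow> v < Suc (Suc i * d) \<and> (\<exists>q. c = q * Suc (Suc i * d) + v)" for v c d i
    unfolding beta_def by blast
  then show ?thesis unfolding sigma1_fun_def
    by (simp only:) (intro sigma1_intros assms[THEN sigma1_fun_reindex])
qed

lemma coprime_beta_moduli:
  assumes "i < j" and "j - i dvd d"
  shows "coprime (Suc (Suc i * d)) (Suc (Suc j * d))"
proof (rule ccontr)
  assume "\<not> coprime (Suc (Suc i * d)) (Suc (Suc j * d))"
  then obtain p where common_factor: "prime p" "p dvd Suc (Suc i * d)" "p dvd Suc (Suc j * d)"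
    by (meson coprime_iff_gcd_eq_1 gcd_greatest_iff prime_factor_nat)
  then have "p dvd Suc j * Suc (Suc i * d) - Suc i * Suc (Suc j * d)"
    by (intro dvd_diff_nat dvd_mult)
  also have "Suc j * Suc (Suc i * d) - Suc i * Suc (Suc j * d) = j - i"
    by (simp add: algebra_simps)
  finally have "p dvd Suc i * d" using assms(2) by (meson dvd_mult dvd_trans)
  then have "p dvd 1" using common_factor(2) by (metis Suc_eq_plus1 dvd_add_right_iff)
  then show False using common_factor(1) by (simp add: not_prime_1)
qed

theorem beta_sequence: "\<exists>c d. \<forall>i\<le>n. beta c d i = s i"
proof -
  define M where "M = (\<Sum>i\<le>n. s i) + n + 1"
  define d where "d = (fact M :: nat)"
  have "coprime (Suc (Suc i * d)) (Suc (Suc j * d))" if "i < j" "j \<le> n" for i j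
  proof (rule coprime_beta_moduli[OF that(1)])
    show "j - i dvd d" unfolding d_def M_def using that by (intro dvd_fact) auto
  qed
  then have "\<forall>i\<in>{..n}. \<forall>j\<in>{..n}. i \<noteq> j \<longrightarrow> coprime (Suc (Suc i * d)) (Suc (Suc j * d))"
    by (metis atMost_iff coprime_commute linorder_neqE_nat)
  then obtain c where congruent: "\<forall>i\<in>{..n}. [c = s i] (mod Suc (Suc i * d))"
    using chinese_remainder_nat[of "{..n}" "\<lambda>i. Suc (Suc i * d)" s] by blast
  have "beta c d i = s i" if "i \<le> n" for i
  proof -
    have "s i \<le> (\<Sum>i\<le>n. s i)" using that by (intro member_le_sum) auto
    also have "\<dots> \<le> M" by (simp add: M_def)
    also have "M \<le> d" unfolding d_def by (rule fact_ge_self)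
    finally have "s i < Suc (Suc i * d)" by simp
    moreover have "c mod Suc (Suc i * d) = s i mod Suc (Suc i * d)"
      using congruent that by (auto simp: cong_def)
    ultimately show ?thesis unfolding beta_def by (simp only: mod_less)
  qed
  then show ?thesis by blast
qed

lemma ex_beta_iff:
  assumes "\<And>s s'. (\<And>i. i \<le> n \<Longrightarrow> s i = s' i) \<Longrightarrow> P s = P s'"
  shows "(\<exists>s. P s) \<longleftrightarrow> (\<exists>c d. P (beta c d))"
proof
  assume "\<exists>s. P s"
  then obtain s where P_s: "P s" ..
  obtain c d where "\<And>i. i \<le> n \<Longrightarrow> beta c d i = s i" using beta_sequence by blast
  then have "P (beta c d) = P s" by (rule assms)
  with P_s show "\<exists>c d. P (beta c d)" by blast
qed blast

lemma sigma1_recursion_sequence: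
  assumes start: "sigma1 (\<lambda>e. A (e 0) (\<lambda>i. e (Suc i)))"
    and step: "sigma1 (\<lambda>e. R (e 0) (e 1) (e 2) (\<lambda>i. e (i + 3)))"
    and "sigma1_fun n" "sigma1_fun y"
  shows "sigma1 (\<lambda>e. \<exists>s. A (s 0) e \<and> (\<forall>i<n e. R i (s i) (s (Suc i)) e) \<and> y e = s (n e))"
proof -
  have start_subst: "sigma1 (\<lambda>e. A (t e) (\<lambda>i. e (Suc (Suc i))))" if "sigma1_fun t" for t
    using sigma1_subst[OF that, of "\<lambda>v e. A v (\<lambda>i. e (Suc (Suc i)))"]
      sigma1_reindex[OF start, of "case_nat 0 (\<lambda>i. Suc (Suc (Suc i)))"] by simp
  have step_subst: "sigma1 (\<lambda>e. R (t e) (u e) (v e) (\<lambda>i. e (Suc (Suc (Suc i)))))"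
    if "sigma1_fun t" "sigma1_fun u" "sigma1_fun v" for t u v
    using sigma1_substs[OF sigma1_reindex[OF step, of "\<lambda>i. if i < 3 then i else i + 3"],
        of "[t, u, v]"] that
    by (simp add: numeral_2_eq_2 numeral_3_eq_3)
  have "(\<exists>s. A (s 0) e \<and> (\<forall>i<n e. R i (s i) (s (Suc i)) e) \<and> y e = s (n e)) \<longleftrightarrow>
      (\<exists>c d. A (beta c d 0) e \<and> (\<forall>i<n e. R i (beta c d i) (beta c d (Suc i)) e) \<and>
        y e = beta c d (n e))" for e
    by (rule ex_beta_iff[of "n e"]) simp
  moreover have "sigma1 (\<lambda>e. \<exists>c d. A (beta c d 0) e \<and>
      (\<forall>i<n e. R i (beta c d i) (beta c d (Suc i)) e) \<and> y e = beta c d (n e))"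
    by (intro sigma1_ex sigma1_conj sigma1_ball sigma1_eq start_subst step_subst sigma1_fun_beta
        sigma1_fun_Suc sigma1_fun_const sigma1_fun_var assms(3,4)[THEN sigma1_fun_reindex])
  ultimately show ?thesis by simp
qed

lemma sigma1_fun_funpow:
  assumes iterand: "sigma1_fun (\<lambda>e. g (e 0))" and count: "sigma1_fun t"
  shows "sigma1_fun (\<lambda>e. (g ^^ t e) c)"
proof -
  have "y = (g ^^ n) c \<longleftrightarrow> (\<exists>s. s 0 = c \<and> (\<forall>i<n. s (Suc i) = g (s i)) \<and> y = s n)" for y n
  proof
    assume "y = (g ^^ n) c"
    then show "\<exists>s. s 0 = c \<and> (\<forall>i<n. s (Suc i) = g (s i)) \<and> y = s n"
      by (intro exI[of _ "\<lambda>i. (g ^^ i) c"]) simp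
  next
    assume "\<exists>s. s 0 = c \<and> (\<forall>i<n. s (Suc i) = g (s i)) \<and> y = s n"
    then obtain s where orbit: "s 0 = c" "\<And>i. i < n \<Longrightarrow> s (Suc i) = g (s i)" "y = s n" by blast
    have "i \<le> n \<Longrightarrow> s i = (g ^^ i) c" for i by (induction i) (use orbit in auto)
    then show "y = (g ^^ n) c" using orbit(3) by simp
  qed
  moreover have "sigma1 (\<lambda>e. \<exists>s. s 0 = c \<and> (\<forall>i<t (\<lambda>i. e (Suc i)). s (Suc i) = g (s i)) \<and>
      e 0 = s (t (\<lambda>i. e (Suc i))))"
    using iterand
    by (intro sigma1_recursion_sequence[where A = "\<lambda>v e. v = c" and R = "\<lambda>i u v e. v = g u"])
      (auto intro!: sigma1_intros count[THEN sigma1_fun_reindex]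
        dest: sigma1_fun_reindex[where \<rho> = "\<lambda>_. 1"])
  ultimately show ?thesis unfolding sigma1_fun_def by simp
qed

inductive generated :: "(nat \<Rightarrow> bool) \<Rightarrow> (nat \<Rightarrow> nat \<Rightarrow> nat \<Rightarrow> bool) \<Rightarrow> nat \<Rightarrow> bool" for base step where
  generated_base: "base x \<Longrightarrow> generated base step x"
| generated_step: "step x y z \<Longrightarrow> generated base step y \<Longrightarrow> generated base step z \<Longrightarrow>
    generated base step x"

context
  fixes base :: "nat \<Rightarrow> bool" and step :: "nat \<Rightarrow> nat \<Rightarrow> nat \<Rightarrow> bool"
begin

definition justified :: "(nat \<Rightarrow> nat) \<Rightarrow> nat \<Rightarrow> bool" where
  "justified s i \<longleftrightarrow> base (s i) \<or> (\<exists>j k. j < i \<and> k < i \<and> step (s i) (s j) (s k))"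

lemma justified_cong: "(\<And>j. j \<le> i \<Longrightarrow> s j = s' j) \<Longrightarrow> justified s i = justified s' i"
  unfolding justified_def by (metis less_or_eq_imp_le order_refl)

lemma justified_append:
  assumes "\<forall>i<length xs. justified ((!) xs) i" "\<forall>i<length ys. justified ((!) ys) i"
    and "i < length (xs @ ys)"
  shows "justified ((!) (xs @ ys)) i"
proof (cases "i < length xs")
  case True
  then show ?thesis
    using assms(1) justified_cong[of i "(!) (xs @ ys)" "(!) xs"] by (simp add: nth_append)
next
  case False
  define i' where "i' = i - length xs"
  have index: "i = length xs + i'" "i' < length ys" using False assms(3) by (auto simp: i'_def)
  have shift: "(xs @ ys) ! (length xs + j) = ys ! j" for j by simp
  have "base (ys ! i') \<or> (\<exists>j k. j < i' \<and> k < i' \<and> step (ys ! i') (ys ! j) (ys ! k))"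
    using assms(2) index(2) by (simp add: justified_def)
  then show ?thesis unfolding justified_def index(1) shift by (metis shift nat_add_left_cancel_less)
qed

lemma generated_imp_sequence:
  "generated base step x \<Longrightarrow> \<exists>xs. \<forall>i<length (xs @ [x]). justified ((!) (xs @ [x])) i"
proof (induction rule: generated.induct)
  case (generated_base x)
  then show ?case by (intro exI[of _ "[]"]) (simp add: justified_def)
next
  case (generated_step x y z)
  then obtain us vs where justified_us: "\<forall>i<length (us @ [y]). justified ((!) (us @ [y])) i"
    and justified_vs: "\<forall>i<length (vs @ [z]). justified ((!) (vs @ [z])) i" by blast
  define xs where "xs = (us @ [y]) @ (vs @ [z])"
  have "justified ((!) (xs @ [x])) i" if "i < length (xs @ [x])" for i
  proof (cases "i < length xs")
    case True
    then have "justified ((!) xs) i"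
      using justified_append[OF justified_us justified_vs] unfolding xs_def by blast
    moreover have "(xs @ [x]) ! j = xs ! j" if "j \<le> i" for j
      using True that by (simp add: nth_append)
    ultimately show ?thesis using justified_cong by metis
  next
    case False
    obtain j k where "j < length xs" "xs ! j = y" "k < length xs" "xs ! k = z"
      by (metis UnCI in_set_conv_nth list.set_intros(1) set_append xs_def)
    then show ?thesis
      using False that generated_step.hyps(1) unfolding justified_def
      by (intro disjI2 exI[of _ j] exI[of _ k]) (simp add: nth_append)
  qed
  then show ?case by blast
qed

lemma generated_iff_sequence:
  "generated base step x \<longleftrightarrow> (\<exists>n s. (\<forall>i<Suc n. justified s i) \<and> x = s n)"
proof
  assume "generated base step x"
  then obtain xs where "\<forall>i<length (xs @ [x]). justified ((!) (xs @ [x])) i"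
    using generated_imp_sequence by blast
  then show "\<exists>n s. (\<forall>i<Suc n. justified s i) \<and> x = s n"
    by (intro exI[of _ "length xs"] exI[of _ "(!) (xs @ [x])"]) simp
next
  assume "\<exists>n s. (\<forall>i<Suc n. justified s i) \<and> x = s n"
  then obtain n s where sequence: "\<forall>i<Suc n. justified s i" "x = s n" by blast
  have "i < Suc n \<Longrightarrow> generated base step (s i)" for i
  proof (induction i rule: less_induct)
    case (less i)
    then have "justified s i" using sequence(1) by blast
    then show ?case using less unfolding justified_def by (meson generated.intros less_trans)
  qed
  then show "generated base step x" using sequence(2) by simp
qed

theorem sigma1_generated:
  assumes "sigma1 (\<lambda>e. base (e 0))" "sigma1 (\<lambda>e. step (e 0) (e 1) (e 2))" "sigma1_fun t"
  shows "sigma1 (\<lambda>e. generated base step (t e))"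
proof (rule sigma1_subst1[OF _ assms(3)])
  have "generated base step x \<longleftrightarrow> (\<exists>n c d. (\<forall>i<Suc n. justified (beta c d) i) \<and> x = beta c d n)" for x
    unfolding generated_iff_sequence
  proof (intro arg_cong[where f = HOL.Ex] ext ex_beta_iff)
    fix n :: nat and s s' :: "nat \<Rightarrow> nat"
    assume agree: "\<And>i. i \<le> n \<Longrightarrow> s i = s' i"
    then have "justified s i = justified s' i" if "i < Suc n" for i
      using that by (intro justified_cong) simp
    then show "((\<forall>i<Suc n. justified s i) \<and> x = s n) = ((\<forall>i<Suc n. justified s' i) \<and> x = s' n)"
      using agree by simp
  qed
  then show "sigma1 (\<lambda>e. generated base step (e 0))"
    unfolding justified_def
    by (simp only:)
      (intro sigma1_intros sigma1_fun_beta sigma1_subst1[OF assms(1)] sigma1_subst3[OF assms(2)])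
qed

end

section \<open>Partial recursive functions\<close>

inductive_simps eval_iffs:
  "eval Zr xs y"
  "eval Sc xs y"
  "eval (Id i) xs y"
  "eval (Cn f gs) xs y"
  "eval (Pr f g) [] y"
  "eval (Pr f g) (0 # xs) y"
  "eval (Pr f g) (Suc n # xs) y"
  "eval (Mn f) xs y"

lemma eval_Pr_iff:
  "eval (Pr f g) (n # xs) y \<longleftrightarrow>
    (\<exists>s. eval f xs (s 0) \<and> (\<forall>i<n. eval g (s i # i # xs) (s (Suc i))) \<and> y = s n)"
proof (induction n arbitrary: y)
  case 0
  show ?case by (auto simp: eval_iffs intro: exI[of _ "\<lambda>_. y"])
next
  case (Suc n)
  show ?case
  proof
    assume "eval (Pr f g) (Suc n # xs) y"
    then obtain s where trace: "eval f xs (s 0)" "\<forall>i<n. eval g (s i # i # xs) (s (Suc i))"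
      and "eval g (s n # n # xs) y"
      using Suc.IH by (auto simp: eval_iffs)
    then show "\<exists>s. eval f xs (s 0) \<and> (\<forall>i<Suc n. eval g (s i # i # xs) (s (Suc i))) \<and> y = s (Suc n)"
      by (intro exI[of _ "s(Suc n := y)"]) (auto simp: less_Suc_eq)
  next
    assume "\<exists>s. eval f xs (s 0) \<and> (\<forall>i<Suc n. eval g (s i # i # xs) (s (Suc i))) \<and> y = s (Suc n)"
    then obtain s where trace: "eval f xs (s 0)"
      "\<forall>i<Suc n. eval g (s i # i # xs) (s (Suc i))" "y = s (Suc n)" by blast
    then have "eval (Pr f g) (n # xs) (s n)" using Suc.IH by auto
    with trace show "eval (Pr f g) (Suc n # xs) y" by (auto simp: eval_iffs)
  qed
qed

lemma eval_deterministic: "eval f xs y \<Longrightarrow> eval f xs z \<Longrightarrow> y = z"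
proof (induction arbitrary: z rule: eval.induct)
  case (ev_Cn xs gs ys f y)
  then obtain zs where args_eval: "list_all2 (\<lambda>g. eval g xs) gs zs" "eval f zs z"
    by (auto simp: eval_iffs)
  have "ys = zs" using ev_Cn.hyps(1) ev_Cn.IH(1) args_eval(1)
    by (intro nth_equalityI) (auto simp: list_all2_conv_all_nth)
  then show ?case using ev_Cn.IH args_eval(2) by blast
next
  case (ev_Mn f n xs)
  then have least_zero: "eval f (z # xs) 0" "\<forall>m<z. \<exists>v. eval f (m # xs) v \<and> v \<noteq> 0"
    by (auto simp: eval_iffs)
  show ?case
  proof (rule linorder_cases[of n z])
    assume "n < z"
    then show ?thesis using least_zero(2) ev_Mn.IH(1) by blast
  next
    assume "z < n"
    then show ?thesis using ev_Mn.IH(2) least_zero(1) by blast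
  qed
next
  case (ev_PrS f g n xs y w)
  from ev_PrS.prems obtain u where "eval (Pr f g) (n # xs) u" "eval g (u # n # xs) z"
    by (auto simp: eval_iffs)
  then show ?case using ev_PrS.IH by blast
qed (simp_all add: eval_iffs)

definition sigma1_graph :: "(nat list \<Rightarrow> nat \<Rightarrow> bool) \<Rightarrow> bool" where
  "sigma1_graph G \<longleftrightarrow> (\<forall>ts t. (\<forall>u\<in>set ts. sigma1_fun u) \<longrightarrow> sigma1_fun t \<longrightarrow>
     sigma1 (\<lambda>e. G (map (\<lambda>u. u e) ts) (t e)))"

lemma sigma1_graphD:
  "sigma1_graph G \<Longrightarrow> \<forall>u\<in>set ts. sigma1_fun u \<Longrightarrow> sigma1_fun t \<Longrightarrow>
    sigma1 (\<lambda>e. G (map (\<lambda>u. u e) ts) (t e))"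
  by (simp add: sigma1_graph_def)

lemma sigma1_graph_reindexD:
  assumes "sigma1_graph G" "\<forall>v\<in>set vs. sigma1_fun v" "\<forall>u\<in>set ts. sigma1_fun u" "sigma1_fun t"
  shows "sigma1 (\<lambda>e. G (map (\<lambda>v. v e) vs @ map (\<lambda>u. u (\<lambda>i. e (\<rho> i))) ts) (t e))"
proof -
  have "\<forall>u\<in>set (vs @ map (\<lambda>u e. u (\<lambda>i. e (\<rho> i))) ts). sigma1_fun u"
    using assms(2,3) by (auto intro: sigma1_fun_reindex)
  from sigma1_graphD[OF assms(1) this assms(4)] show ?thesis by (simp add: comp_def)
qed

lemma sigma1_graph_composition:
  assumes graph: "sigma1_graph G" and "\<forall>H\<in>set Hs. sigma1_graph H"
  shows "sigma1_graph (\<lambda>xs y. \<exists>ys. list_all2 (\<lambda>H. H xs) Hs ys \<and> G ys y)"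
proof -
  have "sigma1 (\<lambda>e. \<exists>ys. list_all2 (\<lambda>H. H (map (\<lambda>u. u e) ts)) Hs ys \<and> G (map (\<lambda>v. v e) vs @ ys) (t e))"
    if "\<forall>u\<in>set ts. sigma1_fun u" "\<forall>v\<in>set vs. sigma1_fun v" "sigma1_fun t" for ts vs t
    using assms(2) that
  proof (induction Hs arbitrary: ts vs t)
    case Nil
    then show ?case using sigma1_graphD[OF graph] by simp
  next
    case (Cons H Hs)
    let ?S = "\<lambda>u e. u (\<lambda>i. e (Suc i)) :: nat"
    have "sigma1 (\<lambda>e. H (map (\<lambda>u. u (\<lambda>i. e (Suc i))) ts) (e 0))"
      using sigma1_graph_reindexD[of H "[]" ts "\<lambda>e. e 0" Suc] Cons.prems sigma1_fun_var by simp
    moreover have "sigma1 (\<lambda>e. \<exists>ys. list_all2 (\<lambda>H. H (map (\<lambda>u. u (\<lambda>i. e (Suc i))) ts)) Hs ys \<and>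
        G ((map (\<lambda>v. v (\<lambda>i. e (Suc i))) vs @ [e 0]) @ ys) (t (\<lambda>i. e (Suc i))))"
      using Cons.IH[of "map ?S ts" "map ?S vs @ [\<lambda>e. e 0]" "?S t"] Cons.prems
        sigma1_fun_reindex[of _ Suc] sigma1_fun_var by (auto simp: comp_def)
    ultimately have "sigma1 (\<lambda>e. \<exists>v. H (map (\<lambda>u. u e) ts) v \<and>
        (\<exists>ys. list_all2 (\<lambda>H. H (map (\<lambda>u. u e) ts)) Hs ys \<and> G ((map (\<lambda>v. v e) vs @ [v]) @ ys) (t e)))"
      by (intro sigma1_ex sigma1_conj)
    moreover have
      "(\<exists>ys. list_all2 (\<lambda>H. H (map (\<lambda>u. u e) ts)) (H # Hs) ys \<and> G (map (\<lambda>v. v e) vs @ ys) (t e)) \<longleftrightarrow>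
       (\<exists>v. H (map (\<lambda>u. u e) ts) v \<and>
        (\<exists>ys. list_all2 (\<lambda>H. H (map (\<lambda>u. u e) ts)) Hs ys \<and> G ((map (\<lambda>v. v e) vs @ [v]) @ ys) (t e)))"
      for e
      by (auto simp: list_all2_Cons1)
    ultimately show ?case by simp
  qed
  from this[of _ "[]"] show ?thesis unfolding sigma1_graph_def by simp
qed

lemma sigma1_graph_primitive_recursion:
  assumes "sigma1_graph G" "sigma1_graph H"
  shows "sigma1_graph (\<lambda>xs y. xs \<noteq> [] \<and> (\<exists>s. G (tl xs) (s 0) \<and>
    (\<forall>i<hd xs. H (s i # i # tl xs) (s (Suc i))) \<and> y = s (hd xs)))"
  unfolding sigma1_graph_def
proof (intro allI impI)
  fix ts t assume args: "\<forall>u\<in>set ts. sigma1_fun u" and result: "sigma1_fun t"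
  show "sigma1 (\<lambda>e. map (\<lambda>u. u e) ts \<noteq> [] \<and> (\<exists>s. G (tl (map (\<lambda>u. u e) ts)) (s 0) \<and>
    (\<forall>i<hd (map (\<lambda>u. u e) ts). H (s i # i # tl (map (\<lambda>u. u e) ts)) (s (Suc i))) \<and>
    t e = s (hd (map (\<lambda>u. u e) ts))))"
  proof (cases ts)
    case Nil
    then show ?thesis using sigma1_delta0[OF delta0_False] by simp
  next
    case (Cons n us)
    have params: "\<forall>u\<in>set us. sigma1_fun u" and counter: "sigma1_fun n" using args Cons by auto
    have "sigma1 (\<lambda>e. G (map (\<lambda>u. u (\<lambda>i. e (Suc i))) us) (e 0))"
      using sigma1_graph_reindexD[OF assms(1) _ params, of "[]" "\<lambda>e. e 0" Suc] sigma1_fun_var by simp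
    moreover have "sigma1 (\<lambda>e. H (e 1 # e 0 # map (\<lambda>u. u (\<lambda>i. e (i + 3))) us) (e 2))"
      using sigma1_graph_reindexD[OF assms(2) _ params, of "[\<lambda>e. e 1, \<lambda>e. e 0]" "\<lambda>e. e 2" "\<lambda>i. i + 3"]
        sigma1_fun_var by simp
    ultimately have "sigma1 (\<lambda>e. \<exists>s. G (map (\<lambda>u. u e) us) (s 0) \<and>
        (\<forall>i<n e. H (s i # i # map (\<lambda>u. u e) us) (s (Suc i))) \<and> t e = s (n e))"
      by (rule sigma1_recursion_sequence[OF _ _ counter result])
    then show ?thesis using Cons by simp
  qed
qed

lemma sigma1_graph_minimization:
  assumes graph: "sigma1_graph G"
  shows "sigma1_graph (\<lambda>xs y. G (y # xs) 0 \<and> (\<forall>m<y. \<exists>v. G (m # xs) v \<and> v \<noteq> 0))"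
  unfolding sigma1_graph_def
proof (intro allI impI)
  fix ts t assume args: "\<forall>u\<in>set ts. sigma1_fun u" and result: "sigma1_fun t"
  have "sigma1 (\<lambda>e. G (t e # map (\<lambda>u. u e) ts) 0)"
    using sigma1_graphD[OF graph, of "t # ts" "\<lambda>e. 0"] args result sigma1_fun_const by simp
  moreover have "sigma1 (\<lambda>e. G (e (Suc 0) # map (\<lambda>u. u (\<lambda>i. e (Suc (Suc i)))) ts) (e 0))"
    using sigma1_graph_reindexD[OF graph _ args, of "[\<lambda>e. e (Suc 0)]" "\<lambda>e. e 0" "\<lambda>i. Suc (Suc i)"]
      sigma1_fun_var by simp
  ultimately show "sigma1 (\<lambda>e. G (t e # map (\<lambda>u. u e) ts) 0 \<and>
      (\<forall>m<t e. \<exists>v. G (m # map (\<lambda>u. u e) ts) v \<and> v \<noteq> 0))"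
    by (intro sigma1_ex sigma1_conj sigma1_ball sigma1_neq sigma1_fun_var sigma1_fun_const result)
qed

theorem sigma1_graph_eval: "sigma1_graph (eval f)"
proof (induction f)
  case Zr
  show ?case by (auto simp: sigma1_graph_def eval_iffs intro: sigma1_eq sigma1_fun_const)
next
  case Sc
  have "sigma1 (\<lambda>e. eval Sc (map (\<lambda>u. u e) ts) (t e))"
    if "\<forall>u\<in>set ts. sigma1_fun u" "sigma1_fun t" for ts t
    using that sigma1_delta0[OF delta0_False]
    by (cases ts) (auto simp: eval_iffs intro!: sigma1_eq sigma1_fun_Suc)
  then show ?case by (simp add: sigma1_graph_def)
next
  case (Id i)
  have "sigma1 (\<lambda>e. eval (Id i) (map (\<lambda>u. u e) ts) (t e))"
    if "\<forall>u\<in>set ts. sigma1_fun u" "sigma1_fun t" for ts t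
    using that sigma1_delta0[OF delta0_False]
    by (cases "i < length ts") (auto simp: eval_iffs intro!: sigma1_eq)
  then show ?case by (simp add: sigma1_graph_def)
next
  case (Cn f gs)
  then have "sigma1_graph (\<lambda>xs y. \<exists>ys. list_all2 (\<lambda>H. H xs) (map eval gs) ys \<and> eval f ys y)"
    by (intro sigma1_graph_composition) auto
  moreover have "eval (Cn f gs) = (\<lambda>xs y. \<exists>ys. list_all2 (\<lambda>H. H xs) (map eval gs) ys \<and> eval f ys y)"
    by (auto simp: fun_eq_iff eval_iffs list_all2_map1)
  ultimately show ?case by (simp only:)
next
  case (Pr f g)
  have "eval (Pr f g) xs y \<longleftrightarrow> xs \<noteq> [] \<and> (\<exists>s. eval f (tl xs) (s 0) \<and>
      (\<forall>i<hd xs. eval g (s i # i # tl xs) (s (Suc i))) \<and> y = s (hd xs))" for xs y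
    by (cases xs) (simp_all add: eval_Pr_iff eval_iffs)
  then show ?case using sigma1_graph_primitive_recursion[OF Pr] by presburger
next
  case (Mn f)
  then show ?case using sigma1_graph_minimization by (simp add: eval_iffs)
qed

lemma re_set_sigma1:
  assumes "re_set A" "sigma1_fun t"
  shows "sigma1 (\<lambda>e. t e \<in> A)"
proof (rule sigma1_subst1[OF _ assms(2)])
  obtain f where A_iff: "\<And>n. n \<in> A \<longleftrightarrow> (\<exists>v. eval f [n] v)" using assms(1) by (auto simp: re_set_def)
  have "sigma1 (\<lambda>e. eval f [e (Suc 0)] (e 0))"
    using sigma1_graphD[OF sigma1_graph_eval, of "[\<lambda>e. e (Suc 0)]" "\<lambda>e. e 0"] sigma1_fun_var by simp
  then show "sigma1 (\<lambda>e. e 0 \<in> A)" unfolding A_iff by (rule sigma1_ex)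
qed

definition computable :: "nat \<Rightarrow> (nat list \<Rightarrow> nat) \<Rightarrow> bool" where
  "computable n g \<longleftrightarrow> (\<exists>f. \<forall>xs. length xs = n \<longrightarrow> eval f xs (g xs))"

lemma computable_cong:
  "(\<And>xs. length xs = n \<Longrightarrow> g xs = h xs) \<Longrightarrow> computable n g = computable n h"
  by (simp add: computable_def)

lemma computable_nth: "i < n \<Longrightarrow> computable n (\<lambda>xs. xs ! i)"
  unfolding computable_def by (auto intro: exI[of _ "Id i"] ev_Id)

lemma computable_comp:
  assumes "computable (length gs) h" "\<forall>g\<in>set gs. computable n g"
  shows "computable n (\<lambda>xs. h (map (\<lambda>g. g xs) gs))"
proof -
  obtain f where h_eval: "\<And>xs. length xs = length gs \<Longrightarrow> eval f xs (h xs)"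
    using assms(1) by (auto simp: computable_def)
  obtain F where gs_eval: "\<And>g xs. g \<in> set gs \<Longrightarrow> length xs = n \<Longrightarrow> eval (F g) xs (g xs)"
    using assms(2) unfolding computable_def by metis
  have "eval (Cn f (map F gs)) xs (h (map (\<lambda>g. g xs) gs))" if "length xs = n" for xs
    using gs_eval that h_eval
    by (intro ev_Cn[where ys = "map (\<lambda>g. g xs) gs"]) (auto simp: list_all2_conv_all_nth)
  then show ?thesis by (auto simp: computable_def)
qed

lemma computable_comp1:
  "computable 1 (\<lambda>xs. h (xs ! 0)) \<Longrightarrow> computable n g \<Longrightarrow> computable n (\<lambda>xs. h (g xs))"
  using computable_comp[of "[g]" "\<lambda>xs. h (xs ! 0)"] by simp

lemma computable_comp2:
  "computable 2 (\<lambda>xs. h (xs ! 0) (xs ! 1)) \<Longrightarrow> computable n g \<Longrightarrow> computable n g' \<Longrightarrow>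
    computable n (\<lambda>xs. h (g xs) (g' xs))"
  using computable_comp[of "[g, g']" "\<lambda>xs. h (xs ! 0) (xs ! 1)"] by (simp add: numeral_2_eq_2)

lemma computable_Cons:
  assumes "computable (Suc n) h" "computable n g"
  shows "computable n (\<lambda>xs. h (g xs # xs))"
proof -
  have "computable n (\<lambda>xs. h (map (\<lambda>g. g xs) (g # map (\<lambda>i xs. xs ! i) [0..<n])))"
    using assms computable_nth by (intro computable_comp) auto
  moreover have "map (\<lambda>g. g xs) (g # map (\<lambda>i xs. xs ! i) [0..<n]) = g xs # xs" if "length xs = n" for xs
    using that map_nth[of xs] by (simp add: comp_def)
  ultimately show ?thesis by (simp cong: computable_cong)
qed

lemma computable_tl:
  assumes "computable n h"
  shows "computable (Suc n) (\<lambda>xs. h (tl xs))"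
proof (rule iffD1[OF computable_cong])
  show "computable (Suc n) (\<lambda>xs. h (map (\<lambda>g. g xs) (map (\<lambda>i xs. xs ! Suc i) [0..<n])))"
    using assms computable_nth by (intro computable_comp) auto
  show "h (map (\<lambda>g. g xs) (map (\<lambda>i xs. xs ! Suc i) [0..<n])) = h (tl xs)"
    if "length xs = Suc n" for xs
    using that by (intro arg_cong[where f = h] nth_equalityI) (auto simp: nth_tl)
qed

lemma computable_Suc:
  assumes "computable n g"
  shows "computable n (\<lambda>xs. Suc (g xs))"
proof (rule computable_comp1[OF _ assms])
  have "eval Sc xs (Suc (xs ! 0))" if "length xs = 1" for xs
    using that by (cases xs) (auto intro: ev_Sc)
  then show "computable 1 (\<lambda>xs. Suc (xs ! 0))" by (auto simp: computable_def)
qed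

lemma computable_const: "computable n (\<lambda>xs. c)"
proof (induction c)
  case 0
  show ?case unfolding computable_def by (auto intro: ev_Zr)
qed (rule computable_Suc)

lemma computable_rec:
  assumes "computable n g" "computable (Suc (Suc n)) h"
  shows "computable (Suc n) (\<lambda>xs. rec_nat (g (tl xs)) (\<lambda>k y. h (y # k # tl xs)) (hd xs))"
proof -
  obtain f where g_eval: "\<And>xs. length xs = n \<Longrightarrow> eval f xs (g xs)"
    using assms(1) by (auto simp: computable_def)
  obtain f' where h_eval: "\<And>xs. length xs = Suc (Suc n) \<Longrightarrow> eval f' xs (h xs)"
    using assms(2) by (auto simp: computable_def)
  have "eval (Pr f f') (m # xs) (rec_nat (g xs) (\<lambda>k y. h (y # k # xs)) m)" if "length xs = n" for m xs
    using that by (induction m) (auto intro!: ev_Pr0 ev_PrS g_eval h_eval)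
  then have "eval (Pr f f') xs (rec_nat (g (tl xs)) (\<lambda>k y. h (y # k # tl xs)) (hd xs))"
    if "length xs = Suc n" for xs
    using that by (cases xs) auto
  then show ?thesis by (auto simp: computable_def)
qed

lemma computable_rec_nat:
  assumes "computable 1 (\<lambda>xs. g (xs ! 0))" "computable 3 (\<lambda>xs. h (xs ! 0) (xs ! 1) (xs ! 2))"
    and "computable n t" "computable n u"
  shows "computable n (\<lambda>xs. rec_nat (g (u xs)) (\<lambda>k y. h y k (u xs)) (t xs))"
proof (rule computable_comp2[OF _ assms(3,4)])
  have "computable (Suc 1) (\<lambda>xs. rec_nat (g (tl xs ! 0)) (\<lambda>k y. h y k (tl xs ! 0)) (hd xs))"
    using computable_rec[OF assms(1), of "\<lambda>xs. h (xs ! 0) (xs ! 1) (xs ! 2)"] assms(2)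
    by (simp add: numeral_3_eq_3 numeral_2_eq_2)
  moreover have "tl xs ! 0 = xs ! 1" "hd xs = xs ! 0" if "length xs = Suc 1" for xs :: "nat list"
    using that by (cases xs; simp add: nth_tl)+
  ultimately show "computable 2 (\<lambda>xs. rec_nat (g (xs ! 1)) (\<lambda>k y. h y k (xs ! 1)) (xs ! 0))"
    unfolding Suc_1 by (simp cong: computable_cong)
qed

lemma computable_add:
  assumes "computable n t" "computable n u"
  shows "computable n (\<lambda>xs. t xs + u xs)"
proof -
  have "a + b = rec_nat b (\<lambda>k y. Suc y) a" for a b by (induction a) auto
  then show ?thesis
    using computable_rec_nat[of "\<lambda>x. x" "\<lambda>y k x. Suc y", OF _ _ assms] computable_Suc computable_nth
    by simp
qed

lemma computable_mult:
  assumes "computable n t" "computable n u"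
  shows "computable n (\<lambda>xs. t xs * u xs)"
proof -
  have "a * b = rec_nat 0 (\<lambda>k y. y + b) a" for a b :: nat by (induction a) auto
  then show ?thesis
    using computable_rec_nat[of "\<lambda>x. 0" "\<lambda>y k x. y + x", OF _ _ assms] computable_add computable_nth
      computable_const by simp
qed

lemma computable_pred:
  assumes "computable n t"
  shows "computable n (\<lambda>xs. t xs - 1)"
proof -
  have "a - 1 = rec_nat 0 (\<lambda>k y. k) a" for a :: nat by (induction a) auto
  then show ?thesis
    using computable_rec_nat[of "\<lambda>x. 0" "\<lambda>y k x. k", OF _ _ assms computable_const] computable_nth
      computable_const by simp
qed

lemma computable_diff:
  assumes "computable n t" "computable n u"
  shows "computable n (\<lambda>xs. t xs - u xs)"
proof -
  have "rec_nat a (\<lambda>k y. y - 1) b = a - b" for a b :: nat by (induction b) auto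
  moreover have "computable n (\<lambda>xs. rec_nat (t xs) (\<lambda>k y. y - 1) (u xs))"
    using computable_rec_nat[of "\<lambda>x. x" "\<lambda>y k x. y - 1", OF _ _ assms(2,1)]
      computable_pred computable_nth by simp
  ultimately show ?thesis by (simp only:)
qed

lemma computable_of_bool_imp:
  assumes "computable n (\<lambda>xs. of_bool (P xs))" "computable n (\<lambda>xs. of_bool (Q xs))"
  shows "computable n (\<lambda>xs. of_bool (P xs \<longrightarrow> Q xs))"
proof -
  have "of_bool (p \<longrightarrow> q) = 1 - (of_bool p * (1 - of_bool q) :: nat)" for p q by auto
  then show ?thesis by (simp only:) (intro computable_diff computable_mult computable_const assms)
qed

lemma computable_of_bool_eq:
  assumes "computable n t" "computable n u"
  shows "computable n (\<lambda>xs. of_bool (t xs = u xs))"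
proof -
  have "of_bool (a = b) = 1 - ((a - b) + (b - a))" for a b :: nat by auto
  then show ?thesis by (simp only:) (intro computable_diff computable_add computable_const assms)
qed

lemma computable_of_bool_bounded_all:
  assumes predicate: "computable (Suc n) (\<lambda>xs. of_bool (P xs))" and bound: "computable n t"
  shows "computable n (\<lambda>xs. of_bool (\<forall>v\<le>t xs. P (v # xs)))"
proof -
  have "computable (Suc (Suc n)) (\<lambda>xs. xs ! 0 * of_bool (P (tl xs)))"
    by (intro computable_mult computable_nth computable_tl predicate) simp
  from computable_rec[OF computable_const[of n 1] this]
  have "computable (Suc n) (\<lambda>xs. rec_nat 1 (\<lambda>k y. y * of_bool (P (k # tl xs))) (hd xs))" by simp
  from computable_Cons[OF this computable_Suc[OF bound]]
  have "computable n (\<lambda>xs. rec_nat 1 (\<lambda>k y. y * of_bool (P (k # xs))) (Suc (t xs)))"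
    by (simp only: list.sel)
  moreover have "rec_nat 1 (\<lambda>k y. y * of_bool (P (k # xs))) m = (of_bool (\<forall>v<m. P (v # xs)) :: nat)"
    for m xs
    by (induction m) (auto simp: less_Suc_eq)
  ultimately show ?thesis by (simp only: less_Suc_eq_le)
qed

lemma computable_env: "computable n (\<lambda>xs. env xs i)"
proof (cases "i < n")
  case True
  then show ?thesis using computable_nth[OF True] by (simp add: env_def cong: computable_cong)
next
  case False
  then show ?thesis using computable_const by (simp add: env_def cong: computable_cong)
qed

lemma computable_delta0: "delta0 P \<Longrightarrow> computable n (\<lambda>xs. of_bool (P (env xs)))"
proof (induction arbitrary: n rule: delta0.induct)
  case (delta0_imp P Q)
  then show ?case by (intro computable_of_bool_imp)
next
  case (delta0_ball P i)
  then show ?case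
    using computable_of_bool_bounded_all[OF delta0_ball.IH[of "Suc n"] computable_env[of n i]]
    by (simp only: env_Cons)
next
  case delta0_False
  show ?case by (rule computable_const)
qed (intro computable_of_bool_eq computable_env computable_const computable_Suc computable_add
    computable_mult)+

lemma sigma1_set_witness:
  assumes "sigma1 (\<lambda>e. e 0 \<in> A)"
  obtains Q where "delta0 Q" "\<And>n. n \<in> A \<longleftrightarrow> (\<exists>v. Q (env [v, n]))"
proof -
  obtain Q where "delta0 Q" and A_iff: "\<And>e. e 0 \<in> A \<longleftrightarrow> (\<exists>v. Q (case_nat v e))"
    using assms by (auto simp: sigma1_def)
  show thesis
  proof (rule that[OF \<open>delta0 Q\<close>])
    show "n \<in> A \<longleftrightarrow> (\<exists>v. Q (env [v, n]))" for n using A_iff[of "env [n]"] by (simp add: env_Cons)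
  qed
qed

lemma delta0_least_witness:
  assumes "delta0 Q"
  obtains f where "\<And>n v. eval f [n] v \<longleftrightarrow> Q (env [v, n]) \<and> (\<forall>m<v. \<not> Q (env [m, n]))"
proof -
  obtain g where "\<And>xs. length xs = 2 \<Longrightarrow> eval g xs (of_bool (\<not> Q (env xs)))"
    using computable_delta0[OF delta0_not[OF assms], of 2] by (auto simp: computable_def)
  then have "eval g [v, n] (of_bool (\<not> Q (env [v, n])))" for v n by simp
  then have "eval g [v, n] u \<longleftrightarrow> u = of_bool (\<not> Q (env [v, n]))" for v n u
    using eval_deterministic by blast
  then show thesis by (intro that[of "Mn g"]) (auto simp: eval_iffs)
qed

theorem sigma1_imp_re_set:
  assumes "sigma1 (\<lambda>e. e 0 \<in> A)"
  shows "re_set A"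
proof -
  obtain Q where "delta0 Q" and A_iff: "\<And>n. n \<in> A \<longleftrightarrow> (\<exists>v. Q (env [v, n]))"
    using sigma1_set_witness[OF assms] by blast
  then obtain f where "\<And>n v. eval f [n] v \<longleftrightarrow> Q (env [v, n]) \<and> (\<forall>m<v. \<not> Q (env [m, n]))"
    using delta0_least_witness by blast
  then have "n \<in> A \<longleftrightarrow> (\<exists>v. eval f [n] v)" for n
    unfolding A_iff using exists_least_iff[of "\<lambda>v. Q (env [v, n])"] by simp
  then show ?thesis by (auto simp: re_set_def)
qed

theorem sigma1_imp_recursive_set:
  assumes "sigma1 (\<lambda>e. e 0 \<in> A)" "sigma1 (\<lambda>e. e 0 \<in> - A)"
  shows "recursive_set A"
proof -
  obtain Q where delta0_Q: "delta0 Q" and A_iff: "\<And>n. n \<in> A \<longleftrightarrow> (\<exists>v. Q (env [v, n]))"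
    using sigma1_set_witness[OF assms(1)] by blast
  obtain Q' where delta0_Q': "delta0 Q'" and not_A_iff: "\<And>n. n \<in> - A \<longleftrightarrow> (\<exists>v. Q' (env [v, n]))"
    using sigma1_set_witness[OF assms(2)] by blast
  obtain h where h_iff: "\<And>n v. eval h [n] v \<longleftrightarrow>
      (Q (env [v, n]) \<or> Q' (env [v, n])) \<and> (\<forall>m<v. \<not> (Q (env [m, n]) \<or> Q' (env [m, n])))"
    using delta0_least_witness[OF delta0_disj[OF delta0_Q delta0_Q']] by blast
  obtain f where f_eval: "\<And>xs. length xs = 2 \<Longrightarrow> eval f xs (of_bool (Q (env xs)))"
    using computable_delta0[OF delta0_Q, of 2] unfolding computable_def by blast
  have "eval (Cn f [h, Id 0]) [n] (if n \<in> A then 1 else 0)" for n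
  proof -
    have "\<exists>v. Q (env [v, n]) \<or> Q' (env [v, n])" using A_iff not_A_iff by blast
    then obtain v where least_v: "eval h [n] v"
      unfolding h_iff using exists_least_iff[of "\<lambda>v. Q (env [v, n]) \<or> Q' (env [v, n])"] by blast
    then have "Q (env [v, n]) \<longleftrightarrow> n \<in> A" unfolding h_iff using A_iff not_A_iff by blast
    then have "eval f [v, n] (if n \<in> A then 1 else 0)"
      using f_eval[of "[v, n]"] by (simp add: of_bool_def)
    moreover have "eval (Id 0) [n] n" by (simp add: eval_iffs)
    ultimately show ?thesis using least_v by (intro ev_Cn[where ys = "[v, n]"]) simp_all
  qed
  then show ?thesis unfolding recursive_set_def by blast
qed

lemma recursive_set_imp_re_set:
  assumes "recursive_set X"
  shows "re_set X"
proof (rule sigma1_imp_re_set)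
  obtain f where "\<And>n. eval f [n] (if n \<in> X then 1 else 0)"
    using assms unfolding recursive_set_def by blast
  then have "n \<in> X \<longleftrightarrow> eval f [n] 1" for n
    using eval_deterministic by (metis zero_neq_one)
  moreover have "sigma1 (\<lambda>e. eval f [e 0] 1)"
    using sigma1_graphD[OF sigma1_graph_eval, of "[\<lambda>e. e 0]" "\<lambda>e. 1"] sigma1_fun_var sigma1_fun_const
    by simp
  ultimately show "sigma1 (\<lambda>e. e 0 \<in> X)" by simp
qed

section \<open>\<open>U\<close> is interpretable in \<open>R\<close>\<close>

lemma model_R_structure:
  assumes model: "model M (snd R_thy)"
  shows "R_structure M"
proof
  show "sat M e \<phi>" if "\<phi> \<in> snd R_thy" for e \<phi>
    using that wf_thy_R by (intro model_sat_closed[OF model]) (auto simp: wf_thy_def sentences_def)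
  obtain d where "d \<in> univ M" by (rule model_univ_nonempty[OF model])
  then have "val M (\<lambda>_. d) (num n) \<in> univ M" for n by (intro model_val_in_univ[OF model]) auto
  then show "num_val M n \<in> univ M" for n by (simp add: val_num)
qed

lemma (in R_structure) sat_bounded_All_iff:
  assumes "e y = num_val M n" "y \<noteq> z"
  shows "sat M e (All z (Imp (leq (Var z) (Var y)) \<phi>)) \<longleftrightarrow> (\<forall>v\<le>n. sat M (e(z := num_val M v)) \<phi>)"
proof -
  have "sat M e (All z (Imp (leq (Var z) (Var y)) \<phi>)) \<longleftrightarrow>
      (\<forall>d\<in>univ M. rint M 1 [d, num_val M n] \<longrightarrow> sat M (e(z := d)) \<phi>)"
    using assms by (simp add: leq_def)
  also have "\<dots> \<longleftrightarrow> (\<forall>v\<le>n. sat M (e(z := num_val M v)) \<phi>)"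
    using leq_num_valD leq_num_val_iff num_val_in_univ by metis
  finally show ?thesis .
qed

text \<open>The variable \<open>\<rho> i\<close> of \<open>\<phi>\<close> plays the role of the argument \<open>i\<close> of \<open>P\<close>. By the completeness theorem
  it suffices to consider structures on a countable type.\<close>

definition represents :: "fm \<Rightarrow> (nat \<Rightarrow> nat) \<Rightarrow> ((nat \<Rightarrow> nat) \<Rightarrow> bool) \<Rightarrow> bool" where
  "represents \<phi> \<rho> P \<longleftrightarrow> fm_in L_R \<phi> \<and> fv \<phi> \<subseteq> range \<rho> \<and>
     (\<forall>(M :: trm struct) e f. R_structure M \<longrightarrow> (\<forall>i. e (\<rho> i) = num_val M (f i)) \<longrightarrow>
       (sat M e \<phi> \<longleftrightarrow> P f))"

lemma representsI:
  assumes "fm_in L_R \<phi>" "fv \<phi> \<subseteq> range \<rho>"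
    and "\<And>(M :: trm struct) e f. R_structure M \<Longrightarrow> (\<And>i. e (\<rho> i) = num_val M (f i)) \<Longrightarrow> sat M e \<phi> \<longleftrightarrow> P f"
  shows "represents \<phi> \<rho> P"
  using assms by (simp add: represents_def)

lemma representsD:
  "represents \<phi> \<rho> P \<Longrightarrow> R_structure (M :: trm struct) \<Longrightarrow> (\<And>i. e (\<rho> i) = num_val M (f i)) \<Longrightarrow>
    sat M e \<phi> \<longleftrightarrow> P f"
  by (simp add: represents_def)

lemma range_case_nat: "range (case_nat a f) = insert a (range f)"
proof
  show "range (case_nat a f) \<subseteq> insert a (range f)" by (auto split: nat.splits)
  show "insert a (range f) \<subseteq> range (case_nat a f)"
    using rangeI[of "case_nat a f" 0] rangeI[of "case_nat a f" "Suc _"] by auto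
qed

lemma represents_atomic:
  "represents (Eq (Var (\<rho> i)) (Var (\<rho> j))) \<rho> (\<lambda>e. e i = e j)"
  "represents (Eq (Var (\<rho> i)) (num 0)) \<rho> (\<lambda>e. e i = 0)"
  "represents (Eq (Var (\<rho> i)) (Fn 1 [Var (\<rho> j)])) \<rho> (\<lambda>e. e i = Suc (e j))"
  "represents (Eq (Var (\<rho> i)) (plus (Var (\<rho> j)) (Var (\<rho> k)))) \<rho> (\<lambda>e. e i = e j + e k)"
  "represents (Eq (Var (\<rho> i)) (times (Var (\<rho> j)) (Var (\<rho> k)))) \<rho> (\<lambda>e. e i = e j * e k)"
  by (intro representsI;
      auto simp: L_R_def plus_def times_def R_structure.num_val_inject R_structure.fint_num_val
        R_structure.fint_num_val(2)[unfolded One_nat_def])+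

lemma represents_imp:
  assumes rep_\<phi>: "represents \<phi> \<rho> P" and rep_\<psi>: "represents \<psi> \<rho> Q"
  shows "represents (Imp \<phi> \<psi>) \<rho> (\<lambda>e. P e \<longrightarrow> Q e)"
proof (rule representsI)
  show "fm_in L_R (Imp \<phi> \<psi>)" "fv (Imp \<phi> \<psi>) \<subseteq> range \<rho>"
    using rep_\<phi> rep_\<psi> by (simp_all add: represents_def)
  show "sat M e (Imp \<phi> \<psi>) \<longleftrightarrow> (P f \<longrightarrow> Q f)"
    if "R_structure M" "\<And>i. e (\<rho> i) = num_val M (f i)" for M :: "trm struct" and e f
    using representsD[OF rep_\<phi>, of M e f, OF that] representsD[OF rep_\<psi>, of M e f, OF that] by simp
qed

lemma represents_ball:
  assumes rep_\<phi>: "represents \<phi> (case_nat z \<rho>) P" and z_notin: "z \<notin> range \<rho>"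
  shows "represents (All z (Imp (leq (Var z) (Var (\<rho> i))) \<phi>)) \<rho> (\<lambda>e. \<forall>v\<le>e i. P (case_nat v e))"
proof (rule representsI)
  show "fm_in L_R (All z (Imp (leq (Var z) (Var (\<rho> i))) \<phi>))"
    using rep_\<phi> by (simp add: represents_def leq_def L_R_def)
  have "fv \<phi> \<subseteq> insert z (range \<rho>)" using rep_\<phi> by (simp add: represents_def range_case_nat)
  then show "fv (All z (Imp (leq (Var z) (Var (\<rho> i))) \<phi>)) \<subseteq> range \<rho>" by (auto simp: leq_def)
next
  fix M :: "trm struct" and e f
  assume R_struct: "R_structure M" and assignment: "\<And>i. e (\<rho> i) = num_val M (f i)"
  have z_fresh: "\<rho> j \<noteq> z" for j using z_notin by blast
  have "(e(z := num_val M v)) (case_nat z \<rho> j) = num_val M (case_nat v f j)" for v j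
    using assignment z_fresh by (cases j) simp_all
  then have "sat M (e(z := num_val M v)) \<phi> \<longleftrightarrow> P (case_nat v f)" for v
    by (rule representsD[OF rep_\<phi> R_struct])
  then show "sat M e (All z (Imp (leq (Var z) (Var (\<rho> i))) \<phi>)) \<longleftrightarrow> (\<forall>v\<le>f i. P (case_nat v f))"
    using R_structure.sat_bounded_All_iff[OF R_struct, of e "\<rho> i" "f i" z \<phi>] assignment z_fresh by simp
qed

theorem delta0_representable:
  "delta0 P \<Longrightarrow> finite (range \<rho>) \<Longrightarrow> \<exists>\<phi>. represents \<phi> \<rho> P"
proof (induction arbitrary: \<rho> rule: delta0.induct)
  case (delta0_ball P i)
  have "finite (range (case_nat (fresh (range \<rho>)) \<rho>))"
    using delta0_ball.prems by (simp add: range_case_nat)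
  then obtain \<phi> where "represents \<phi> (case_nat (fresh (range \<rho>)) \<rho>) P" using delta0_ball.IH by blast
  then show ?case using represents_ball[OF _ fresh_notin[OF delta0_ball.prems]] by blast
next
  case delta0_False
  have "represents Bot \<rho> (\<lambda>e. False)" by (simp add: represents_def)
  then show ?case ..
qed (blast intro: represents_atomic represents_imp)+

lemma sigma1_represented_witness:
  assumes "sigma1 (\<lambda>e. e 0 \<in> A)"
  obtains \<alpha> P where "represents \<alpha> (case_nat w (\<lambda>_. x)) P" "\<And>n. n \<in> A \<longleftrightarrow> (\<exists>v. P (case_nat v (\<lambda>_. n)))"
proof -
  obtain P where "delta0 P" and A_iff: "\<And>e. e 0 \<in> A \<longleftrightarrow> (\<exists>v. P (case_nat v e))"
    using assms by (auto simp: sigma1_def)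
  have "finite (range (case_nat w (\<lambda>_. x)))" by (simp add: range_case_nat)
  then obtain \<alpha> where "represents \<alpha> (case_nat w (\<lambda>_. x)) P"
    using delta0_representable[OF \<open>delta0 P\<close>] by blast
  moreover have "n \<in> A \<longleftrightarrow> (\<exists>v. P (case_nat v (\<lambda>_. n)))" for n using A_iff[of "\<lambda>_. n"] by simp
  ultimately show thesis by (rule that)
qed

text \<open>Rosser's trick: \<open>x\<close> is put on the side of \<open>A\<close> if a witness for \<open>x \<in> A\<close> appears before
  any witness for \<open>x \<in> B\<close>.\<close>

definition rosser :: "fm \<Rightarrow> fm \<Rightarrow> fm" where
  "rosser \<alpha> \<beta> = Ex 1 (And \<alpha> (All 2 (Imp (leq (Var 2) (Var 1)) (Neg \<beta>))))"

lemma sat_rosser_iff: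
  "sat M e (rosser \<alpha> \<beta>) \<longleftrightarrow> (\<exists>a\<in>univ M. sat M (e(1 := a)) \<alpha> \<and>
     (\<forall>b\<in>univ M. rint M 1 [b, a] \<longrightarrow> \<not> sat M (e(1 := a, 2 := b)) \<beta>))"
  by (simp add: rosser_def leq_def)

lemma (in R_structure) sat_rosserI:
  assumes "sat M (e(1 := num_val M v)) \<alpha>"
    and "\<And>a w. \<not> sat M (e(1 := a, 2 := num_val M w)) \<beta>"
  shows "sat M e (rosser \<alpha> \<beta>)"
proof -
  have "\<not> sat M (e(1 := num_val M v, 2 := b)) \<beta>" if before: "b \<in> univ M" "rint M 1 [b, num_val M v]" for b
  proof -
    obtain w where "b = num_val M w" by (rule leq_num_valD[OF before(2,1)])
    then show ?thesis using assms(2) by simp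
  qed
  then show ?thesis unfolding sat_rosser_iff using assms(1) num_val_in_univ by blast
qed

lemma (in R_structure) not_sat_rosserI:
  assumes "\<And>v. \<not> sat M (e(1 := num_val M v)) \<alpha>"
    and "\<And>a. sat M (e(1 := a, 2 := num_val M w)) \<beta>"
  shows "\<not> sat M e (rosser \<alpha> \<beta>)"
proof
  assume "sat M e (rosser \<alpha> \<beta>)"
  then obtain a where "a \<in> univ M" "sat M (e(1 := a)) \<alpha>"
    and no_earlier: "\<forall>b\<in>univ M. rint M 1 [b, a] \<longrightarrow> \<not> sat M (e(1 := a, 2 := b)) \<beta>"
    unfolding sat_rosser_iff by blast
  from leq_num_val_total[OF \<open>a \<in> univ M\<close>, of w] show False
  proof
    assume "rint M 1 [a, num_val M w]"
    then obtain v where "a = num_val M v" by (rule leq_num_valD[OF _ \<open>a \<in> univ M\<close>])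
    with assms(1) \<open>sat M (e(1 := a)) \<alpha>\<close> show False by simp
  next
    assume "rint M 1 [num_val M w, a]"
    with no_earlier num_val_in_univ assms(2) show False by blast
  qed
qed

theorem separating_formula:
  assumes "re_set A" "re_set B" "A \<inter> B = {}"
  obtains \<sigma> where "fm_in L_R \<sigma>" "fv \<sigma> \<subseteq> {0}"
    "\<And>(M :: trm struct) e n. R_structure M \<Longrightarrow> e 0 = num_val M n \<Longrightarrow> n \<in> A \<Longrightarrow> sat M e \<sigma>"
    "\<And>(M :: trm struct) e n. R_structure M \<Longrightarrow> e 0 = num_val M n \<Longrightarrow> n \<in> B \<Longrightarrow> \<not> sat M e \<sigma>"
proof -
  obtain \<alpha> P where rep_\<alpha>: "represents \<alpha> (case_nat 1 (\<lambda>_. 0)) P"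
    and A_iff: "\<And>n. n \<in> A \<longleftrightarrow> (\<exists>v. P (case_nat v (\<lambda>_. n)))"
    by (rule sigma1_represented_witness[OF re_set_sigma1[OF assms(1) sigma1_fun_var], of 1 0]) blast
  obtain \<beta> Q where rep_\<beta>: "represents \<beta> (case_nat 2 (\<lambda>_. 0)) Q"
    and B_iff: "\<And>n. n \<in> B \<longleftrightarrow> (\<exists>v. Q (case_nat v (\<lambda>_. n)))"
    by (rule sigma1_represented_witness[OF re_set_sigma1[OF assms(2) sigma1_fun_var], of 2 0]) blast
  show thesis
  proof (rule that[of "rosser \<alpha> \<beta>"])
    have "fm_in L_R \<alpha>" "fm_in L_R \<beta>" "fv \<alpha> \<subseteq> {0, 1}" "fv \<beta> \<subseteq> {0, 2}"
      using rep_\<alpha> rep_\<beta> by (auto simp: represents_def split: nat.splits)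
    then show "fm_in L_R (rosser \<alpha> \<beta>)" "fv (rosser \<alpha> \<beta>) \<subseteq> {0}"
      by (auto simp: rosser_def leq_def L_R_def)
  next
    fix M :: "trm struct" and e :: "nat \<Rightarrow> trm" and n
    assume R_struct: "R_structure M" and assignment: "e 0 = num_val M n"
    have sat_iff: "sat M (e(1 := num_val M v)) \<alpha> \<longleftrightarrow> P (case_nat v (\<lambda>_. n))"
      "sat M (e(1 := a, 2 := num_val M v)) \<beta> \<longleftrightarrow> Q (case_nat v (\<lambda>_. n))" for v a
      by (rule representsD[OF rep_\<alpha> R_struct] representsD[OF rep_\<beta> R_struct],
          simp add: assignment split: nat.split)+
    show "sat M e (rosser \<alpha> \<beta>)" if "n \<in> A"
    proof -
      have "n \<notin> B" using assms(3) that by blast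
      obtain v where "P (case_nat v (\<lambda>_. n))" using \<open>n \<in> A\<close> unfolding A_iff ..
      then show ?thesis
        using B_iff \<open>n \<notin> B\<close>
        by (intro R_structure.sat_rosserI[OF R_struct, of e v]) (simp_all only: sat_iff, simp)
    qed
    show "\<not> sat M e (rosser \<alpha> \<beta>)" if "n \<in> B"
    proof -
      have "n \<notin> A" using assms(3) that by blast
      obtain w where "Q (case_nat w (\<lambda>_. n))" using \<open>n \<in> B\<close> unfolding B_iff ..
      then show ?thesis
        using A_iff \<open>n \<notin> A\<close>
        by (intro R_structure.not_sat_rosserI[OF R_struct, of e _ w]) (simp_all only: sat_iff, simp)
    qed
  qed
qed

definition rosser_interp :: "fm \<Rightarrow> interp" where
  "rosser_interp \<sigma> = (Top, \<lambda>_. \<sigma>,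
     \<lambda>(f, n). if f = 0 then Eq (Var 0) (num 0) else Eq (Var 1) (Fn 1 [Var 0]))"

lemma rosser_interp_sel:
  "idom (rosser_interp \<sigma>) = Top" "irel (rosser_interp \<sigma>) r = \<sigma>"
  "ifun (rosser_interp \<sigma>) (0, n) = Eq (Var 0) (num 0)"
  "ifun (rosser_interp \<sigma>) (Suc 0, n) = Eq (Var 1) (Fn 1 [Var 0])"
  by (simp_all add: rosser_interp_def idom_def irel_def ifun_def)

lemma univ_rosser_interp: "univ (interpreted M (rosser_interp \<sigma>)) = univ M"
  by (simp add: univ_interpreted interpreted_univ_def rosser_interp_sel)

lemma rosser_interp_interpretation_in:
  assumes model: "model M (snd R_thy)" and "fm_in L_R \<sigma>" "fv \<sigma> \<subseteq> {0}"
  shows "interpretation_in M (rosser_interp \<sigma>) L_U L_R"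
proof
  show "wf_interp (rosser_interp \<sigma>) L_U L_R"
    using assms(2,3) by (auto simp: wf_interp_def L_U_def L_R_def rosser_interp_sel)
  show "univ (interpreted M (rosser_interp \<sigma>)) \<noteq> {}"
    using model by (simp add: univ_rosser_interp model_def)
  fix f xs
  assume "(f, length xs) \<in> fsyms L_U" "set xs \<subseteq> univ (interpreted M (rosser_interp \<sigma>))"
  then consider "f = 0" "xs = []" | x where "f = Suc 0" "xs = [x]" "x \<in> univ M"
    by (auto simp: L_U_def univ_rosser_interp length_Suc_conv)
  then show "\<exists>!y. y \<in> univ (interpreted M (rosser_interp \<sigma>)) \<and>
      sat M (env (xs @ [y])) (ifun (rosser_interp \<sigma>) (f, length xs))"
    by cases (auto simp: univ_rosser_interp rosser_interp_sel env_def
        intro!: model_fint_in_univ[OF model])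
qed

lemma num_val_rosser_interp:
  assumes model: "model M (snd R_thy)" and "fm_in L_R \<sigma>" "fv \<sigma> \<subseteq> {0}"
  shows "num_val (interpreted M (rosser_interp \<sigma>)) n = num_val M n"
proof -
  interpret interpretation_in M "rosser_interp \<sigma>" L_U L_R
    by (rule rosser_interp_interpretation_in[OF assms])
  interpret R_structure M by (rule model_R_structure[OF model])
  have "fint N 0 [] = num_val M 0"
    using sat_ifun_iff[of 0 "[]" "num_val M 0"] num_val_in_univ[of 0]
    by (simp add: L_U_def univ_rosser_interp rosser_interp_sel env_def fint_num_val)
  moreover have "fint N 1 [num_val M n] = num_val M (Suc n)" for n
    using sat_ifun_iff[of 1 "[num_val M n]" "num_val M (Suc n)"] num_val_in_univ
    by (simp add: L_U_def univ_rosser_interp rosser_interp_sel env_def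
        fint_num_val(2)[unfolded One_nat_def])
  ultimately show ?thesis unfolding num_val_def by (induction n) simp_all
qed

theorem U_interpretable_in_R:
  assumes "re_set A" "re_set B" "A \<inter> B = {}"
  shows "interpretable (U_thy A B) R_thy"
proof -
  obtain \<sigma> where formula: "fm_in L_R \<sigma>" "fv \<sigma> \<subseteq> {0}"
    and separates: "\<And>(M :: trm struct) e n. R_structure M \<Longrightarrow> e 0 = num_val M n \<Longrightarrow> n \<in> A \<Longrightarrow> sat M e \<sigma>"
      "\<And>(M :: trm struct) e n. R_structure M \<Longrightarrow> e 0 = num_val M n \<Longrightarrow> n \<in> B \<Longrightarrow> \<not> sat M e \<sigma>"
    by (rule separating_formula[OF assms]) blast
  have "is_interpretation (rosser_interp \<sigma>) (U_thy A B) R_thy"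
  proof (rule is_interpretationI[OF wf_thy_U wf_thy_R])
    show "wf_interp (rosser_interp \<sigma>) (fst (U_thy A B)) (fst R_thy)"
      using formula by (auto simp: wf_interp_def U_thy_def R_thy_def L_U_def L_R_def rosser_interp_sel)
    fix M :: "trm struct" assume model: "model M (snd R_thy)"
    show "interpretation_in M (rosser_interp \<sigma>) (fst (U_thy A B)) (fst R_thy)"
      using rosser_interp_interpretation_in[OF model formula] by (simp add: U_thy_def R_thy_def)
    show "sat (interpreted M (rosser_interp \<sigma>)) e \<phi>" if "\<phi> \<in> snd (U_thy A B)" for e \<phi>
      using that separates[OF model_R_structure[OF model], of "env [num_val M _]"]
      by (auto simp: U_thy_def val_num num_val_rosser_interp[OF model formula] rint_interpreted
          rosser_interp_sel env_def R_structure.num_val_inject[OF model_R_structure[OF model]])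
  qed
  then show ?thesis unfolding interpretable_def by blast
qed

section \<open>Provability is recursively enumerable\<close>

lemma enc_list_inject: "enc_list xs = enc_list ys \<longleftrightarrow> xs = ys"
proof (induction xs arbitrary: ys)
  case Nil
  show ?case by (cases ys) auto
next
  case (Cons x xs)
  then show ?case by (cases ys) auto
qed

lemma enc_trm_inject: "enc_trm s = enc_trm t \<longleftrightarrow> s = t"
proof (induction s arbitrary: t)
  case (Var x)
  show ?case by (cases t) auto
next
  case (Fn f ss)
  show ?case
  proof (cases t)
    case (Fn g ts)
    have "map enc_trm ss = map enc_trm ts \<longleftrightarrow> ss = ts"
      using Fn.IH by (auto simp: list_eq_iff_nth_eq)
    then show ?thesis using Fn by (simp add: enc_list_inject)
  qed auto
qed

lemma map_enc_trm_inject: "map enc_trm ss = map enc_trm ts \<longleftrightarrow> ss = ts"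
  by (rule inj_map_eq_map) (simp add: inj_def enc_trm_inject)

lemma enc_fm_inject: "enc_fm \<phi> = enc_fm \<psi> \<longleftrightarrow> \<phi> = \<psi>"
proof (induction \<phi> arbitrary: \<psi>)
  case Bot
  show ?case by (cases \<psi>) auto
next
  case (Eq s t)
  show ?case by (cases \<psi>) (auto simp: enc_trm_inject)
next
  case (Rel r ts)
  show ?case by (cases \<psi>) (auto simp: enc_list_inject map_enc_trm_inject)
next
  case (Imp \<phi>\<^sub>1 \<phi>\<^sub>2)
  then show ?case by (cases \<psi>) auto
next
  case (All x \<phi>)
  then show ?case by (cases \<psi>) auto
qed

abbreviation "code_pair a b \<equiv> prod_encode (a, b)"
abbreviation "code_Cons a l \<equiv> Suc (code_pair a l)"
abbreviation "code_Var x \<equiv> code_pair 0 x"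
abbreviation "code_Fn f l \<equiv> code_pair 1 (code_pair f l)"
abbreviation "code_Bot \<equiv> code_pair 0 0"
abbreviation "code_Eq s t \<equiv> code_pair 1 (code_pair s t)"
abbreviation "code_Rel r l \<equiv> code_pair 2 (code_pair r l)"
abbreviation "code_Imp a b \<equiv> code_pair 3 (code_pair a b)"
abbreviation "code_All x a \<equiv> code_pair 4 (code_pair x a)"
abbreviation "code_Neg a \<equiv> code_Imp a code_Bot"
abbreviation "code_triple a b c \<equiv> code_pair a (code_pair b c)"
abbreviation "code_quadruple a b c d \<equiv> code_pair a (code_triple b c d)"

text \<open>Substitution instances and freeness are tested on codes by comparing normal forms, which involve
  only substitutions with finitely many deviations from \<open>even_var\<close>.\<close>

fun alist_subst :: "(nat \<times> trm) list \<Rightarrow> nat \<Rightarrow> trm" where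
  "alist_subst [] = even_var"
| "alist_subst ((x, t) # ps) = (alist_subst ps)(x := t)"

fun enc_alist :: "(nat \<times> trm) list \<Rightarrow> nat" where
  "enc_alist [] = 0"
| "enc_alist ((x, t) # ps) = code_Cons (code_pair x (enc_trm t)) (enc_alist ps)"

inductive lookup_code :: "nat \<Rightarrow> nat \<Rightarrow> nat \<Rightarrow> bool" where
  lookup_code_Nil: "lookup_code 0 x (code_Var (2 * x))"
| lookup_code_eq: "lookup_code (code_Cons (code_pair x t) l) x t"
| lookup_code_neq: "y \<noteq> x \<Longrightarrow> lookup_code l x t \<Longrightarrow> lookup_code (code_Cons (code_pair y s) l) x t"

inductive_simps lookup_code_simps:
  "lookup_code 0 x t"
  "lookup_code (code_Cons (code_pair y s) l) x t"

lemma lookup_code_iff: "lookup_code (enc_alist ps) x t \<longleftrightarrow> t = enc_trm (alist_subst ps x)"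
  by (induction ps rule: enc_alist.induct) (auto simp: lookup_code_simps even_var_def)

lemma sigma1_lookup_code:
  assumes "sigma1_fun l" "sigma1_fun x" "sigma1_fun t"
  shows "sigma1 (\<lambda>e. lookup_code (l e) (x e) (t e))"
proof -
  define base where "base p \<longleftrightarrow>
    (\<exists>x. p = code_triple 0 x (code_Var (2 * x))) \<or>
    (\<exists>x t l. p = code_triple (code_Cons (code_pair x t) l) x t)" for p
  define step where "step p q q' \<longleftrightarrow>
    (\<exists>y s l x t. y \<noteq> x \<and> p = code_triple (code_Cons (code_pair y s) l) x t \<and>
       q = code_triple l x t \<and> q' = q)" for p q q' :: nat
  have "lookup_code l x t \<Longrightarrow> generated base step (code_triple l x t)" for l x t
  proof (induction rule: lookup_code.induct)
    case (lookup_code_neq y x l t s)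
    then show ?case
      by (intro generated_step[OF _ lookup_code_neq.IH lookup_code_neq.IH]) (auto simp: step_def)
  qed (auto intro: generated_base simp: base_def)
  moreover have "generated base step p \<Longrightarrow> p = code_triple l x t \<Longrightarrow> lookup_code l x t" for p l x t
    by (induction arbitrary: l x t rule: generated.induct)
      (auto simp: base_def step_def intro: lookup_code.intros)
  ultimately have "lookup_code l x t \<longleftrightarrow> generated base step (code_triple l x t)" for l x t by blast
  moreover have "sigma1 (\<lambda>e. base (e 0))" "sigma1 (\<lambda>e. step (e 0) (e 1) (e 2))"
    unfolding base_def step_def by (intro sigma1_intros)+
  ultimately show ?thesis by (simp add: sigma1_generated sigma1_fun_prod_encode assms)
qed

inductive tsubst_code :: "nat \<Rightarrow> nat \<Rightarrow> nat \<Rightarrow> bool"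
  and tsubst_list_code :: "nat \<Rightarrow> nat \<Rightarrow> nat \<Rightarrow> bool" for l where
  tsubst_code_Var: "lookup_code l x b \<Longrightarrow> tsubst_code l (code_Var x) b"
| tsubst_code_Fn: "tsubst_list_code l as bs \<Longrightarrow> tsubst_code l (code_Fn f as) (code_Fn f bs)"
| tsubst_list_code_Nil: "tsubst_list_code l 0 0"
| tsubst_list_code_Cons: "tsubst_code l a b \<Longrightarrow> tsubst_list_code l as bs \<Longrightarrow>
    tsubst_list_code l (code_Cons a as) (code_Cons b bs)"

lemma tsubst_code_sound:
  "tsubst_code (enc_alist ps) a b \<Longrightarrow> \<exists>t. a = enc_trm t \<and> b = enc_trm (tsubst (alist_subst ps) t)"
  and tsubst_list_code_sound:
  "tsubst_list_code (enc_alist ps) as bs \<Longrightarrow> \<exists>ts. as = enc_list (map enc_trm ts) \<and>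
     bs = enc_list (map (enc_trm \<circ> tsubst (alist_subst ps)) ts)"
proof (induction rule: tsubst_code_tsubst_list_code.inducts)
  case (tsubst_code_Var x b)
  then show ?case by (intro exI[of _ "Var x"]) (simp add: lookup_code_iff)
next
  case (tsubst_code_Fn as bs f)
  then obtain ts where "as = enc_list (map enc_trm ts)"
    "bs = enc_list (map (enc_trm \<circ> tsubst (alist_subst ps)) ts)" by blast
  then show ?case by (intro exI[of _ "Fn f ts"]) simp
next
  case tsubst_list_code_Nil
  show ?case by (intro exI[of _ "[]"]) simp
next
  case (tsubst_list_code_Cons a b as bs)
  then obtain t ts where "a = enc_trm t" "b = enc_trm (tsubst (alist_subst ps) t)"
    "as = enc_list (map enc_trm ts)" "bs = enc_list (map (enc_trm \<circ> tsubst (alist_subst ps)) ts)"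
    by blast
  then show ?case by (intro exI[of _ "t # ts"]) (simp add: comp_def)
qed

lemma tsubst_list_code_map:
  "\<forall>t\<in>set ts. tsubst_code l (enc_trm t) (enc_trm (f t)) \<Longrightarrow>
    tsubst_list_code l (enc_list (map enc_trm ts)) (enc_list (map (enc_trm \<circ> f) ts))"
  by (induction ts) (auto intro: tsubst_code_tsubst_list_code.intros simp: comp_def)

lemma tsubst_code_complete:
  "tsubst_code (enc_alist ps) (enc_trm t) (enc_trm (tsubst (alist_subst ps) t))"
proof (induction t)
  case (Var x)
  show ?case by (simp add: lookup_code_iff tsubst_code_Var)
next
  case (Fn f ts)
  then have "tsubst_list_code (enc_alist ps) (enc_list (map enc_trm ts))
      (enc_list (map (enc_trm \<circ> tsubst (alist_subst ps)) ts))"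
    by (intro tsubst_list_code_map) blast
  then show ?case using tsubst_code_Fn by simp
qed

lemma
  assumes "sigma1_fun l" "sigma1_fun a" "sigma1_fun b"
  shows sigma1_tsubst_code: "sigma1 (\<lambda>e. tsubst_code (l e) (a e) (b e))"
    and sigma1_tsubst_list_code: "sigma1 (\<lambda>e. tsubst_list_code (l e) (a e) (b e))"
proof -
  define base where "base p \<longleftrightarrow>
    (\<exists>l x b. lookup_code l x b \<and> p = code_quadruple 0 l (code_Var x) b) \<or>
    (\<exists>l. p = code_quadruple 1 l 0 0)" for p
  define step where "step p q q' \<longleftrightarrow>
    (\<exists>l f as bs. p = code_quadruple 0 l (code_Fn f as) (code_Fn f bs) \<and>
       q = code_quadruple 1 l as bs \<and> q' = q) \<or>
    (\<exists>l a b as bs. p = code_quadruple 1 l (code_Cons a as) (code_Cons b bs) \<and>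
       q = code_quadruple 0 l a b \<and> q' = code_quadruple 1 l as bs)" for p q q' :: nat
  have "tsubst_code l a b \<Longrightarrow> generated base step (code_quadruple 0 l a b)"
    and "tsubst_list_code l as bs \<Longrightarrow> generated base step (code_quadruple 1 l as bs)" for l a b as bs
  proof (induction rule: tsubst_code_tsubst_list_code.inducts)
    case (tsubst_code_Fn as bs f)
    show ?case by (rule generated_step[OF _ tsubst_code_Fn(2,2)]) (auto simp: step_def)
  next
    case (tsubst_list_code_Cons a b as bs)
    show ?case by (rule generated_step[OF _ tsubst_list_code_Cons(2,4)]) (auto simp: step_def)
  qed (auto intro: generated_base simp: base_def)
  moreover have "generated base step p \<Longrightarrow> (p = code_quadruple 0 l a b \<longrightarrow> tsubst_code l a b) \<and>
      (p = code_quadruple 1 l a b \<longrightarrow> tsubst_list_code l a b)" for p l a b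
    by (induction arbitrary: l a b rule: generated.induct)
      (auto simp: base_def step_def simp del: One_nat_def intro!: tsubst_code_tsubst_list_code.intros)
  ultimately have
    "tsubst_code l a b \<longleftrightarrow> generated base step (code_quadruple 0 l a b)"
    "tsubst_list_code l a b \<longleftrightarrow> generated base step (code_quadruple 1 l a b)" for l a b by blast+
  moreover have "sigma1 (\<lambda>e. base (e 0))" "sigma1 (\<lambda>e. step (e 0) (e 1) (e 2))"
    unfolding base_def step_def by (intro sigma1_intros sigma1_lookup_code)+
  ultimately show "sigma1 (\<lambda>e. tsubst_code (l e) (a e) (b e))"
    "sigma1 (\<lambda>e. tsubst_list_code (l e) (a e) (b e))"
    by (simp_all add: sigma1_generated sigma1_fun_prod_encode sigma1_fun_const assms)
qed

inductive nf_code :: "nat \<Rightarrow> nat \<Rightarrow> nat \<Rightarrow> nat \<Rightarrow> bool" where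
  nf_code_Bot: "nf_code d l code_Bot code_Bot"
| nf_code_Eq: "tsubst_code l s u \<Longrightarrow> tsubst_code l t v \<Longrightarrow> nf_code d l (code_Eq s t) (code_Eq u v)"
| nf_code_Rel: "tsubst_list_code l as bs \<Longrightarrow> nf_code d l (code_Rel r as) (code_Rel r bs)"
| nf_code_Imp: "nf_code d l a b \<Longrightarrow> nf_code d l a' b' \<Longrightarrow> nf_code d l (code_Imp a a') (code_Imp b b')"
| nf_code_All: "nf_code (Suc d) (code_Cons (code_pair x (code_Var (2 * d + 1))) l) a b \<Longrightarrow>
    nf_code d l (code_All x a) (code_All 0 b)"

lemma nf_code_sound:
  "nf_code d l a b \<Longrightarrow> l = enc_alist ps \<Longrightarrow>
    \<exists>\<phi>. a = enc_fm \<phi> \<and> b = enc_fm (nf d (alist_subst ps) \<phi>)"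
proof (induction arbitrary: ps rule: nf_code.induct)
  case (nf_code_Bot d l)
  show ?case by (intro exI[of _ Bot]) simp
next
  case (nf_code_Eq l s u t v d)
  then obtain s' t' where "s = enc_trm s'" "u = enc_trm (tsubst (alist_subst ps) s')"
    "t = enc_trm t'" "v = enc_trm (tsubst (alist_subst ps) t')" using tsubst_code_sound by metis
  then show ?case by (intro exI[of _ "Eq s' t'"]) simp
next
  case (nf_code_Rel l as bs d r)
  then obtain ts where "as = enc_list (map enc_trm ts)"
    "bs = enc_list (map (enc_trm \<circ> tsubst (alist_subst ps)) ts)" using tsubst_list_code_sound by metis
  then show ?case by (intro exI[of _ "Rel r ts"]) simp
next
  case (nf_code_Imp d l a b a' b')
  then obtain \<phi> \<psi> where "a = enc_fm \<phi>" "b = enc_fm (nf d (alist_subst ps) \<phi>)"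
    "a' = enc_fm \<psi>" "b' = enc_fm (nf d (alist_subst ps) \<psi>)" by metis
  then show ?case by (intro exI[of _ "Imp \<phi> \<psi>"]) simp
next
  case (nf_code_All d x l a b)
  then obtain \<phi> where "a = enc_fm \<phi>"
    "b = enc_fm (nf (Suc d) (alist_subst ((x, Var (2 * d + 1)) # ps)) \<phi>)"
    by (metis enc_alist.simps(2) enc_trm.simps(1))
  then show ?case by (intro exI[of _ "All x \<phi>"]) simp
qed

lemma nf_code_complete: "nf_code d (enc_alist ps) (enc_fm \<phi>) (enc_fm (nf d (alist_subst ps) \<phi>))"
proof (induction \<phi> arbitrary: d ps)
  case (Rel r ts)
  have "tsubst_list_code (enc_alist ps) (enc_list (map enc_trm ts))
      (enc_list (map (enc_trm \<circ> tsubst (alist_subst ps)) ts))"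
    by (intro tsubst_list_code_map ballI tsubst_code_complete)
  then show ?case using nf_code_Rel by simp
next
  case (All x \<phi>)
  show ?case using All.IH[of "Suc d" "(x, Var (2 * d + 1)) # ps"]
    by (simp add: nf_code_All del: fun_upd_apply)
qed (auto simp del: One_nat_def intro: nf_code.intros tsubst_code_complete)

lemma nf_code_iff:
  "nf_code d (enc_alist ps) a b \<longleftrightarrow> (\<exists>\<phi>. a = enc_fm \<phi> \<and> b = enc_fm (nf d (alist_subst ps) \<phi>))"
  using nf_code_sound nf_code_complete by blast

lemma sigma1_nf_code:
  assumes "sigma1_fun d" "sigma1_fun l" "sigma1_fun a" "sigma1_fun b"
  shows "sigma1 (\<lambda>e. nf_code (d e) (l e) (a e) (b e))"
proof -
  define base where "base p \<longleftrightarrow>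
    (\<exists>d l. p = code_quadruple d l code_Bot code_Bot) \<or>
    (\<exists>d l s t u v. tsubst_code l s u \<and> tsubst_code l t v \<and>
       p = code_quadruple d l (code_Eq s t) (code_Eq u v)) \<or>
    (\<exists>d l r as bs. tsubst_list_code l as bs \<and>
       p = code_quadruple d l (code_Rel r as) (code_Rel r bs))" for p
  define step where "step p q q' \<longleftrightarrow>
    (\<exists>d l a b a' b'. p = code_quadruple d l (code_Imp a a') (code_Imp b b') \<and>
       q = code_quadruple d l a b \<and> q' = code_quadruple d l a' b') \<or>
    (\<exists>d l x a b. p = code_quadruple d l (code_All x a) (code_All 0 b) \<and>
       q = code_quadruple (Suc d) (code_Cons (code_pair x (code_Var (2 * d + 1))) l) a b \<and> q' = q)"
    for p q q' :: nat
  have "nf_code d l a b \<Longrightarrow> generated base step (code_quadruple d l a b)" for d l a b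
  proof (induction rule: nf_code.induct)
    case (nf_code_Imp d l a b a' b')
    show ?case by (rule generated_step[OF _ nf_code_Imp.IH]) (auto simp: step_def)
  next
    case (nf_code_All d x l a b)
    show ?case by (rule generated_step[OF _ nf_code_All.IH nf_code_All.IH]) (auto simp: step_def)
  qed (rule generated_base, auto simp: base_def)+
  moreover have "generated base step p \<Longrightarrow> p = code_quadruple d l a b \<Longrightarrow> nf_code d l a b" for p d l a b
    by (induction arbitrary: d l a b rule: generated.induct)
      (auto simp: base_def step_def simp del: One_nat_def intro!: nf_code.intros)
  ultimately have "nf_code d l a b \<longleftrightarrow> generated base step (code_quadruple d l a b)" for d l a b by blast
  moreover have "sigma1 (\<lambda>e. base (e 0))" "sigma1 (\<lambda>e. step (e 0) (e 1) (e 2))"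
    unfolding base_def step_def by (intro sigma1_intros sigma1_tsubst_code sigma1_tsubst_list_code)+
  ultimately show ?thesis by (simp add: sigma1_generated sigma1_fun_prod_encode assms)
qed

definition trm_code :: "nat \<Rightarrow> bool" where
  "trm_code a \<longleftrightarrow> (\<exists>b. tsubst_code 0 a b)"

definition fm_code :: "nat \<Rightarrow> bool" where
  "fm_code a \<longleftrightarrow> (\<exists>b. nf_code 0 0 a b)"

definition instance_code :: "nat \<Rightarrow> nat \<Rightarrow> nat \<Rightarrow> nat \<Rightarrow> bool" where
  "instance_code x t a b \<longleftrightarrow> (\<exists>u c. tsubst_code 0 t u \<and>
     nf_code 0 (code_Cons (code_pair x u) 0) a c \<and> nf_code 0 0 b c)"

definition notin_fv_code :: "nat \<Rightarrow> nat \<Rightarrow> bool" where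
  "notin_fv_code x a \<longleftrightarrow> (\<exists>c. nf_code 0 0 a c \<and> nf_code 0 (code_Cons (code_pair x (code_Var 1)) 0) a c)"

lemma tsubst_code_even_var_iff:
  "tsubst_code 0 a b \<longleftrightarrow> (\<exists>t. a = enc_trm t \<and> b = enc_trm (tsubst even_var t))"
  using tsubst_code_sound[of "[]"] tsubst_code_complete[of "[]"] by auto

lemma nf_code_even_var_iff:
  "nf_code d 0 a b \<longleftrightarrow> (\<exists>\<phi>. a = enc_fm \<phi> \<and> b = enc_fm (nf d even_var \<phi>))"
  "nf_code d (code_Cons (code_pair x (enc_trm t)) 0) a b \<longleftrightarrow>
    (\<exists>\<phi>. a = enc_fm \<phi> \<and> b = enc_fm (nf d (even_var(x := t)) \<phi>))"
  using nf_code_iff[of d "[]"] nf_code_iff[of d "[(x, t)]"] by simp_all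

lemma trm_code_iff: "trm_code a \<longleftrightarrow> (\<exists>t. a = enc_trm t)"
  by (auto simp: trm_code_def tsubst_code_even_var_iff)

lemma fm_code_iff: "fm_code a \<longleftrightarrow> (\<exists>\<phi>. a = enc_fm \<phi>)"
  by (auto simp: fm_code_def nf_code_even_var_iff)

lemma instance_code_iff:
  "instance_code x a b c \<longleftrightarrow> (\<exists>t \<phi> \<psi>. a = enc_trm t \<and> b = enc_fm \<phi> \<and> c = enc_fm \<psi> \<and>
     nf 0 even_var \<psi> = nf 0 even_var (ssubst (Var(x := t)) \<phi>))"
  unfolding instance_code_def tsubst_code_even_var_iff nf_ssubst_upd
  by (auto simp: nf_code_even_var_iff enc_fm_inject simp del: fun_upd_apply)

lemma notin_fv_code_iff: "notin_fv_code x a \<longleftrightarrow> (\<exists>\<phi>. a = enc_fm \<phi> \<and> x \<notin> fv \<phi>)"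
  unfolding notin_fv_code_def nf_upd_eq_iff_notin_fv[symmetric, of _ _ 0]
  using nf_code_even_var_iff(2)[of 0 x "Var 1"]
  by (auto simp: nf_code_even_var_iff(1) enc_fm_inject simp del: fun_upd_apply)

inductive axiom_code :: "nat \<Rightarrow> bool" where
  axiom_code_K: "fm_code a \<Longrightarrow> fm_code b \<Longrightarrow> axiom_code (code_Imp a (code_Imp b a))"
| axiom_code_S: "fm_code a \<Longrightarrow> fm_code b \<Longrightarrow> fm_code c \<Longrightarrow>
    axiom_code (code_Imp (code_Imp a (code_Imp b c)) (code_Imp (code_Imp a b) (code_Imp a c)))"
| axiom_code_DN: "fm_code a \<Longrightarrow> axiom_code (code_Imp (code_Neg (code_Neg a)) a)"
| axiom_code_inst: "instance_code x t a b \<Longrightarrow> axiom_code (code_Imp (code_All x a) b)"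
| axiom_code_vac: "notin_fv_code x a \<Longrightarrow> axiom_code (code_Imp a (code_All x a))"
| axiom_code_dist: "fm_code a \<Longrightarrow> fm_code b \<Longrightarrow>
    axiom_code (code_Imp (code_All x (code_Imp a b)) (code_Imp (code_All x a) (code_All x b)))"
| axiom_code_refl: "trm_code t \<Longrightarrow> axiom_code (code_Eq t t)"
| axiom_code_leib: "instance_code x s a b \<Longrightarrow> instance_code x t a c \<Longrightarrow>
    axiom_code (code_Imp (code_Eq s t) (code_Imp b c))"

lemma sigma1_axiom_code: "sigma1 (\<lambda>e. axiom_code (e 0))"
  unfolding axiom_code.simps trm_code_def fm_code_def instance_code_def notin_fv_code_def
  by (intro sigma1_intros sigma1_nf_code sigma1_tsubst_code)

lemma enc_fm_Neg [simp]: "enc_fm (Neg \<phi>) = code_Neg (enc_fm \<phi>)"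
  by (simp add: Neg_def)

lemma prv_alpha_instance:
  assumes "nf 0 even_var \<psi> = nf 0 even_var (ssubst (Var(x := t)) \<phi>)"
  shows "prv T (Imp (All x \<phi>) \<psi>)"
  using prv_inst prv_Imp_alpha[OF assms[symmetric]] by (rule prv_Imp_trans)

lemma prv_alpha_leibniz:
  assumes \<psi>: "nf 0 even_var \<psi> = nf 0 even_var (ssubst (Var(x := s)) \<phi>)"
    and \<chi>: "nf 0 even_var \<chi> = nf 0 even_var (ssubst (Var(x := t)) \<phi>)"
  shows "prv T (Imp (Eq s t) (Imp \<psi> \<chi>))"
proof -
  have "derives T {\<psi>, Eq s t} \<chi>"
    using prv_leib[of T s t x \<phi>] prv_Imp_alpha[OF \<psi>] prv_Imp_alpha[OF \<chi>[symmetric]]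
    by (meson insertI1 insertI2 derives.intros)
  then show ?thesis by (meson deduction_theorem derives_empty)
qed

lemma axiom_code_sound: "axiom_code p \<Longrightarrow> \<exists>\<phi>. p = enc_fm \<phi> \<and> prv T \<phi>"
proof (induction rule: axiom_code.induct)
  case (axiom_code_K a b)
  then obtain \<phi> \<psi> where "a = enc_fm \<phi>" "b = enc_fm \<psi>" by (auto simp: fm_code_iff)
  then show ?case using prv_K[of T \<phi> \<psi>] by (intro exI[of _ "Imp \<phi> (Imp \<psi> \<phi>)"]) simp
next
  case (axiom_code_S a b c)
  then obtain \<phi> \<psi> \<chi> where "a = enc_fm \<phi>" "b = enc_fm \<psi>" "c = enc_fm \<chi>" by (auto simp: fm_code_iff)
  then show ?case using prv_S[of T \<phi> \<psi> \<chi>]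
    by (intro exI[of _ "Imp (Imp \<phi> (Imp \<psi> \<chi>)) (Imp (Imp \<phi> \<psi>) (Imp \<phi> \<chi>))"]) simp
next
  case (axiom_code_DN a)
  then obtain \<phi> where "a = enc_fm \<phi>" by (auto simp: fm_code_iff)
  then show ?case using prv_DN[of T \<phi>] by (intro exI[of _ "Imp (Neg (Neg \<phi>)) \<phi>"]) simp
next
  case (axiom_code_inst x t a b)
  then obtain \<phi> \<psi> where "a = enc_fm \<phi>" "b = enc_fm \<psi>" "prv T (Imp (All x \<phi>) \<psi>)"
    using prv_alpha_instance by (auto simp: instance_code_iff)
  then show ?case by (intro exI[of _ "Imp (All x \<phi>) \<psi>"]) simp
next
  case (axiom_code_vac x a)
  then obtain \<phi> where "a = enc_fm \<phi>" "x \<notin> fv \<phi>" by (auto simp: notin_fv_code_iff)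
  then show ?case using prv_vac[of x \<phi> T] by (intro exI[of _ "Imp \<phi> (All x \<phi>)"]) simp
next
  case (axiom_code_dist a b x)
  then obtain \<phi> \<psi> where "a = enc_fm \<phi>" "b = enc_fm \<psi>" by (auto simp: fm_code_iff)
  then show ?case using prv_dist[of T x \<phi> \<psi>]
    by (intro exI[of _ "Imp (All x (Imp \<phi> \<psi>)) (Imp (All x \<phi>) (All x \<psi>))"]) simp
next
  case (axiom_code_refl t)
  then obtain s where "t = enc_trm s" by (auto simp: trm_code_iff)
  then show ?case using prv_refl[of T s] by (intro exI[of _ "Eq s s"]) simp
next
  case (axiom_code_leib x s a b t c)
  then obtain s' t' \<psi> \<chi> where "s = enc_trm s'" "t = enc_trm t'" "b = enc_fm \<psi>" "c = enc_fm \<chi>"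
    "prv T (Imp (Eq s' t') (Imp \<psi> \<chi>))"
    using prv_alpha_leibniz by (auto simp: instance_code_iff enc_fm_inject)
  then show ?case by (intro exI[of _ "Imp (Eq s' t') (Imp \<psi> \<chi>)"]) simp
qed

inductive prv_code :: "fm set \<Rightarrow> nat \<Rightarrow> bool" for T where
  prv_code_ax: "p \<in> enc_fm ` T \<Longrightarrow> prv_code T p"
| prv_code_logical: "axiom_code p \<Longrightarrow> prv_code T p"
| prv_code_MP: "prv_code T (code_Imp q p) \<Longrightarrow> prv_code T q \<Longrightarrow> prv_code T p"
| prv_code_Gen: "prv_code T p \<Longrightarrow> prv_code T (code_All x p)"

lemma prv_code_sound: "prv_code T p \<Longrightarrow> \<exists>\<phi>. p = enc_fm \<phi> \<and> prv T \<phi>"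
proof (induction rule: prv_code.induct)
  case (prv_code_ax p)
  then show ?case using prv_ax by blast
next
  case (prv_code_logical p)
  then show ?case by (rule axiom_code_sound)
next
  case (prv_code_MP q p)
  then obtain \<phi> \<psi> where implication: "code_Imp q p = enc_fm \<phi>" "prv T \<phi>"
    and premise: "q = enc_fm \<psi>" "prv T \<psi>" by blast
  then obtain \<chi> where "\<phi> = Imp \<psi> \<chi>" "p = enc_fm \<chi>" by (cases \<phi>) (auto simp: enc_fm_inject)
  then show ?case using implication premise prv_MP by blast
next
  case (prv_code_Gen p x)
  then obtain \<phi> where "p = enc_fm \<phi>" "prv T \<phi>" by blast
  then show ?case using prv_Gen[of T \<phi> x] by (intro exI[of _ "All x \<phi>"]) simp
qed

lemma prv_code_complete: "prv T \<phi> \<Longrightarrow> prv_code T (enc_fm \<phi>)"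
proof (induction rule: prv.induct)
  case (prv_ax \<phi> T)
  then show ?case by (intro prv_code_ax) simp
next
  case (prv_MP T \<phi> \<psi>)
  then show ?case using prv_code_MP by simp
next
  case (prv_Gen T \<phi> x)
  then show ?case using prv_code_Gen by simp
next
  case (prv_inst T x \<phi> t)
  have "instance_code x (enc_trm t) (enc_fm \<phi>) (enc_fm (ssubst (Var(x := t)) \<phi>))"
    by (auto simp: instance_code_iff)
  then show ?case unfolding enc_fm.simps by (intro prv_code_logical axiom_code_inst)
next
  case (prv_leib T s t x \<phi>)
  have "instance_code x (enc_trm u) (enc_fm \<phi>) (enc_fm (ssubst (Var(x := u)) \<phi>))" for u
    by (auto simp: instance_code_iff)
  then show ?case unfolding enc_fm.simps by (intro prv_code_logical axiom_code_leib)
qed (unfold enc_fm.simps enc_fm_Neg, intro prv_code_logical axiom_code.intros;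
    auto simp: fm_code_iff trm_code_iff notin_fv_code_iff)+

lemma sigma1_prv_code:
  assumes axioms: "sigma1 (\<lambda>e. e 0 \<in> enc_fm ` T)" and "sigma1_fun t"
  shows "sigma1 (\<lambda>e. prv_code T (t e))"
proof -
  define base where "base p \<longleftrightarrow> p \<in> enc_fm ` T \<or> axiom_code p" for p
  define step where "step p q q' \<longleftrightarrow> q = code_Imp q' p \<or> (\<exists>x. p = code_All x q \<and> q' = q)" for p q q'
  have "prv_code T p \<Longrightarrow> generated base step p" for p
  proof (induction rule: prv_code.induct)
    case (prv_code_MP q p)
    show ?case by (rule generated_step[OF _ prv_code_MP.IH]) (simp add: step_def)
  next
    case (prv_code_Gen p x)
    show ?case by (rule generated_step[OF _ prv_code_Gen.IH prv_code_Gen.IH]) (auto simp: step_def)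
  qed (rule generated_base, simp add: base_def)+
  moreover have "generated base step p \<Longrightarrow> prv_code T p" for p
    by (induction rule: generated.induct) (auto simp: base_def step_def intro: prv_code.intros)
  ultimately have "prv_code T p \<longleftrightarrow> generated base step p" for p by blast
  moreover have "sigma1 (\<lambda>e. base (e 0))" "sigma1 (\<lambda>e. step (e 0) (e 1) (e 2))"
    unfolding base_def step_def by (intro sigma1_intros sigma1_axiom_code axioms)+
  ultimately show ?thesis by (simp add: sigma1_generated assms)
qed

theorem sigma1_prv:
  assumes "re_set (enc_fm ` T)" "sigma1_fun (\<lambda>e. enc_fm (f e))"
  shows "sigma1 (\<lambda>e. prv T (f e))"
proof -
  have "prv T \<phi> \<longleftrightarrow> prv_code T (enc_fm \<phi>)" for \<phi>
    using prv_code_sound[of T "enc_fm \<phi>"] prv_code_complete by (auto simp: enc_fm_inject)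
  then show ?thesis
    using sigma1_prv_code[OF re_set_sigma1[OF assms(1) sigma1_fun_var] assms(2)] by simp
qed

section \<open>The first incompleteness theorem for \<open>U\<close>\<close>

lemma sigma1_fun_enc_num:
  assumes "sigma1_fun t"
  shows "sigma1_fun (\<lambda>e. enc_trm (num (t e)))"
proof -
  have "enc_trm (num n) = ((\<lambda>c. code_Fn 1 (code_Cons c 0)) ^^ n) (code_Fn 0 0)" for n
    by (induction n) simp_all
  then show ?thesis
    by (simp only:) (intro sigma1_fun_funpow assms sigma1_intros)
qed

theorem re_thy_U:
  assumes "re_set A" "re_set B"
  shows "re_thy (U_thy A B)"
  unfolding re_thy_def
proof (rule sigma1_imp_re_set)
  have "c \<in> enc_fm ` snd (U_thy A B) \<longleftrightarrow>
      (\<exists>m n. m \<noteq> n \<and> c = enc_fm (Neg (Eq (num m) (num n)))) \<or>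
      (\<exists>n. n \<in> A \<and> c = enc_fm (Rel 0 [num n])) \<or> (\<exists>n. n \<in> B \<and> c = enc_fm (Neg (Rel 0 [num n])))" for c
    unfolding U_thy_def snd_conv by blast
  then show "sigma1 (\<lambda>e. e 0 \<in> enc_fm ` snd (U_thy A B))"
    by simp (intro sigma1_intros sigma1_fun_enc_num re_set_sigma1 assms)
qed

abbreviation "code_And a b \<equiv> code_Neg (code_Imp a (code_Neg b))"
abbreviation "code_Ex x a \<equiv> code_Neg (code_All x (code_Neg a))"

text \<open>\<open>num_fm I n\<close> says that \<open>Var 0\<close> is the interpreted numeral \<open>n\<close>. Unlike the translation of the
  numeral, it involves no renaming of variables, so its code is computed by iterating a fixed
  function.\<close>

fun num_fm :: "interp \<Rightarrow> nat \<Rightarrow> fm" where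
  "num_fm I 0 = And (idom I) (ifun I (0, 0))"
| "num_fm I (Suc n) =
     And (idom I) (Ex 1 (And (Eq (Var 1) (Var 0)) (Ex 0 (And (num_fm I n) (ifun I (1, 1))))))"

definition rel_num_fm :: "interp \<Rightarrow> nat \<Rightarrow> nat \<Rightarrow> fm" where
  "rel_num_fm I r n = Ex 0 (And (num_fm I n) (irel I (r, 1)))"

lemma sigma1_fun_enc_rel_num_fm: "sigma1_fun (\<lambda>e. enc_fm (rel_num_fm I r (e 0)))"
proof -
  let ?k = "\<lambda>c. code_And (enc_fm (idom I)) (code_Ex 1 (code_And (enc_fm (Eq (Var 1) (Var 0)))
    (code_Ex 0 (code_And c (enc_fm (ifun I (1, 1)))))))"
  have enc_And: "enc_fm (And \<phi> \<psi>) = code_And (enc_fm \<phi>) (enc_fm \<psi>)" for \<phi> \<psi> by (simp add: And_def)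
  have enc_Ex: "enc_fm (Ex x \<phi>) = code_Ex x (enc_fm \<phi>)" for x \<phi> by (simp add: Ex_def)
  have "enc_fm (num_fm I n) = (?k ^^ n) (enc_fm (And (idom I) (ifun I (0, 0))))" for n
    by (induction n) (simp_all only: num_fm.simps enc_And enc_Ex funpow.simps id_apply comp_apply)
  then show ?thesis
    unfolding rel_num_fm_def enc_And enc_Ex by (simp only:) (intro sigma1_intros sigma1_fun_funpow)
qed

lemma rel_num_fm_sentence:
  assumes "wf_interp I L L'" "(0, 0) \<in> fsyms L" "(1, 1) \<in> fsyms L" "(r, 1) \<in> rsyms L"
  shows "rel_num_fm I r n \<in> sentences L'"
proof -
  have formulas: "fm_in L' (idom I)" "fm_in L' (ifun I (0, 0))" "fm_in L' (ifun I (1, 1))"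
    "fm_in L' (irel I (r, 1))"
    and free_vars: "fv (idom I) \<subseteq> {0}" "fv (ifun I (0, 0)) \<subseteq> {0}" "fv (ifun I (1, 1)) \<subseteq> {0, 1}"
    "fv (irel I (r, 1)) \<subseteq> {0}"
    using assms by (fastforce simp: wf_interp_def)+
  have "fm_in L' (num_fm I n) \<and> fv (num_fm I n) \<subseteq> {0}"
    by (induction n) (use formulas free_vars in auto)
  then show ?thesis using formulas free_vars by (auto simp: rel_num_fm_def sentences_def)
qed

lemma (in interpretation_in) sat_num_fm_iff:
  assumes "(0, 0) \<in> fsyms L" "(1, 1) \<in> fsyms L"
  shows "e 0 \<in> univ M \<Longrightarrow> sat M e (num_fm I n) \<longleftrightarrow> e 0 = num_val N n"
proof (induction n arbitrary: e)
  case 0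
  have "fint N 0 [] \<in> univ N" using assms(1) by (intro fint_in_univ) auto
  have "sat M e (ifun I (0, 0)) \<longleftrightarrow> sat M (env ([] @ [e 0])) (ifun I (0, 0))"
    by (rule sat_env_cong) (use wf_interp_fv_fun[OF wf assms(1)] in auto)
  also have "\<dots> \<longleftrightarrow> e 0 = fint N 0 []" if "e 0 \<in> univ N"
    using sat_ifun_iff[of 0 "[]" "e 0"] assms(1) that by simp
  finally show ?case
    using sat_idom_iff[OF wf, of e] 0 \<open>fint N 0 [] \<in> univ N\<close> by (auto simp: num_val_def)
next
  case (Suc n)
  let ?c = "num_val N n"
  have c_in_univ: "?c \<in> univ N" by (rule num_val_interpreted_in_univ[OF assms])
  then have "?c \<in> univ M" using univ_interpreted_subset[of M I] by blast
  then have "sat M e (num_fm I (Suc n)) \<longleftrightarrow> e 0 \<in> univ N \<and> sat M (e(1 := e 0, 0 := ?c)) (ifun I (1, 1))"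
    using Suc.IH Suc.prems sat_idom_iff[OF wf, of e] by auto
  also have "sat M (e(1 := e 0, 0 := ?c)) (ifun I (1, 1)) \<longleftrightarrow> sat M (env ([?c] @ [e 0])) (ifun I (1, 1))"
    by (rule sat_env_cong) (use wf_interp_fv_fun[OF wf assms(2)] in \<open>auto simp: less_Suc_eq\<close>)
  also have "e 0 \<in> univ N \<and> \<dots> \<longleftrightarrow> e 0 = fint N 1 [?c]"
    using sat_ifun_iff[of 1 "[?c]" "e 0"] fint_in_univ[of 1 "[?c]"] assms(2) c_in_univ by auto
  finally show ?case by (simp add: num_val_def)
qed

lemma (in interpretation_in) sat_rel_num_fm_iff:
  assumes "(0, 0) \<in> fsyms L" "(1, 1) \<in> fsyms L" "(r, 1) \<in> rsyms L"
  shows "sat M e (rel_num_fm I r n) \<longleftrightarrow> sat N e' (Rel r [num n])"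
proof -
  have "num_val N n \<in> univ N" by (rule num_val_interpreted_in_univ[OF assms(1,2)])
  then have "num_val N n \<in> univ M" using univ_interpreted_subset[of M I] by blast
  then have "sat M e (rel_num_fm I r n) \<longleftrightarrow> sat M (e(0 := num_val N n)) (irel I (r, 1))"
    unfolding rel_num_fm_def using sat_num_fm_iff[OF assms(1,2)] by auto
  also have "\<dots> \<longleftrightarrow> sat M (env [num_val N n]) (irel I (r, 1))"
    by (rule sat_env_cong) (use wf_interp_fv_rel[OF wf assms(3)] in auto)
  finally show ?thesis by (simp add: rint_interpreted val_num)
qed

lemma prv_rel_num_fm:
  assumes interp: "is_interpretation I T S" and wf: "wf_thy T" "wf_thy S"
    and symbols: "(0, 0) \<in> fsyms (fst T)" "(1, 1) \<in> fsyms (fst T)" "(r, 1) \<in> rsyms (fst T)"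
  shows "Rel r [num n] \<in> snd T \<Longrightarrow> prv (snd S) (rel_num_fm I r n)"
    and "Neg (Rel r [num n]) \<in> snd T \<Longrightarrow> prv (snd S) (Neg (rel_num_fm I r n))"
proof -
  have sat_iff: "sat M e (rel_num_fm I r n) \<longleftrightarrow> sat (interpreted M I) e (Rel r [num n])"
    if "model M (snd S)" for M :: "trm struct" and e
    by (rule interpretation_in.sat_rel_num_fm_iff[OF
          is_interpretation_interpretation_in[OF interp that] symbols])
  show "prv (snd S) (rel_num_fm I r n)" if "Rel r [num n] \<in> snd T"
    by (rule wf_thy_completeness[OF wf(2)])
      (simp only: sat_iff is_interpretation_sat[OF interp _ wf(1) that])
  show "prv (snd S) (Neg (rel_num_fm I r n))" if "Neg (Rel r [num n]) \<in> snd T"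
  proof (rule wf_thy_completeness[OF wf(2)])
    fix M :: "trm struct" and e assume model: "model M (snd S)"
    have "sat (interpreted M I) e (Neg (Rel r [num n]))"
      by (rule is_interpretation_sat[OF interp model wf(1) that])
    then show "sat M e (Neg (rel_num_fm I r n))" unfolding sat_connectives sat_iff[OF model] .
  qed
qed

lemma consistent_complete_prv_Neg_iff:
  assumes "consistent S" "complete S" "\<phi> \<in> sentences (fst S)"
  shows "prv (snd S) (Neg \<phi>) \<longleftrightarrow> \<not> prv (snd S) \<phi>"
  using assms prv_MP unfolding consistent_def complete_def Neg_def by blast

theorem complete_theory_decidable:
  assumes "rec_axiomatizable S" "consistent S" "complete S"
    and sentences: "\<And>n. f n \<in> sentences (fst S)" and codes: "sigma1_fun (\<lambda>e. enc_fm (f (e 0)))"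
  shows "recursive_set {n. prv (snd S) (f n)}"
proof (rule sigma1_imp_recursive_set)
  obtain Ax where "recursive_set (enc_fm ` Ax)" and prv_Ax_iff: "\<And>\<phi>. prv Ax \<phi> \<longleftrightarrow> prv (snd S) \<phi>"
    using assms(1) unfolding rec_axiomatizable_def by blast
  then have re_axioms: "re_set (enc_fm ` Ax)" by (intro recursive_set_imp_re_set)
  show "sigma1 (\<lambda>e. e 0 \<in> {n. prv (snd S) (f n)})"
    using sigma1_prv[OF re_axioms codes] by (simp add: prv_Ax_iff)
  have "sigma1 (\<lambda>e. prv Ax (Neg (f (e 0))))"
    by (rule sigma1_prv[OF re_axioms]) (simp, intro sigma1_intros codes)
  then show "sigma1 (\<lambda>e. e 0 \<in> - {n. prv (snd S) (f n)})"
    by (simp add: prv_Ax_iff consistent_complete_prv_Neg_iff assms(2,3) sentences)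
qed

theorem G1_holds_U:
  assumes inseparable: "rec_inseparable A B"
  shows "G1_holds (U_thy A B)"
  unfolding G1_holds_def
proof (intro allI impI notI)
  fix S
  assume S_props: "wf_thy S \<and> rec_axiomatizable S \<and> consistent S \<and> interpretable (U_thy A B) S"
    and "complete S"
  then obtain I where interp: "is_interpretation I (U_thy A B) S" unfolding interpretable_def by blast
  have symbols: "(0, 0) \<in> fsyms (fst (U_thy A B))" "(1, 1) \<in> fsyms (fst (U_thy A B))"
    "(0, 1) \<in> rsyms (fst (U_thy A B))" by (simp_all add: U_thy_def L_U_def)
  let ?X = "{n. prv (snd S) (rel_num_fm I 0 n)}"
  have sentence: "rel_num_fm I 0 n \<in> sentences (fst S)" for n
    using interp symbols by (intro rel_num_fm_sentence) (auto simp: is_interpretation_iff_wf_interp)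
  then have "recursive_set ?X"
    using S_props \<open>complete S\<close> by (intro complete_theory_decidable sigma1_fun_enc_rel_num_fm) auto
  moreover have "A \<subseteq> ?X"
    using prv_rel_num_fm(1)[OF interp wf_thy_U _ symbols] S_props by (auto simp: U_thy_def)
  moreover have "?X \<inter> B = {}"
  proof -
    have "prv (snd S) (Neg (rel_num_fm I 0 n))" if "n \<in> B" for n
      by (rule prv_rel_num_fm(2)[OF interp wf_thy_U _ symbols])
        (use S_props that in \<open>auto simp: U_thy_def\<close>)
    then show ?thesis using S_props \<open>complete S\<close> sentence consistent_complete_prv_Neg_iff by blast
  qed
  ultimately show False using inseparable unfolding rec_inseparable_def by blast
qed

theorem mainTheorem6:
  fixes A B :: "nat set"
  assumes "rec_inseparable A B"
  shows "wf_thy (U_thy A B) \<and> re_thy (U_thy A B) \<and> G1_holds (U_thy A B) \<and>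
         strictly_below (U_thy A B) R_thy"
proof -
  have re_disjoint: "re_set A" "re_set B" "A \<inter> B = {}" using assms by (auto simp: rec_inseparable_def)
  have "strictly_below (U_thy A B) R_thy"
    unfolding strictly_below_def
    using U_interpretable_in_R[OF re_disjoint] R_not_interpretable_in_U[OF re_disjoint(3)] by blast
  then show ?thesis using wf_thy_U re_thy_U[OF re_disjoint(1,2)] G1_holds_U[OF assms] by blast
qed

end
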